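(* Let $a=0$. For all $t\in[0,1)$, $x\in\mathbb{R}$ and $\pi\in[0,1]$, the value function $$V(t,x,\pi)=\sup_{0\le\tau\le 1-t}\mathbb{E}_\pi\bigl[X^{t,x}_{t+\tau}\bigr]$$ is given by $$V(t,x,\pi)=\bigl(1-\Pi(t,x,\pi)\bigr)\,x+\Pi(t,x,\pi)\,V_1^0(t,x).$$ Further, an optimal stopping time (i.e. one attaining the supremum) is $\tau^*=\tau_b\wedge(1-t)$, where $\tau_b=\inf\{s\ge 0 : X^{t,x}_{t+s}\ge \alpha\sqrt{1-t-s}\}$. This stopping strategy is the same for all $\pi\in[0,1]$.
   Context: Setting (case $a=0$). The process $X$ is either a driftless Brownian motion ($\theta=0$) or a Brownian bridge pinning to $0$ at time $1$ ($\theta=1$), and $\theta$ is not observed. Learning starts at time $0$ with $X_0=0$ and prior belief $\pi\in[0,1]$ that $\theta=1$. If the process is at $x$ at time $t\in[0,1)$, the updated belief that $\theta=1$ is $$\Pi(t,x,\pi):=\frac{\frac{\pi}{1-\pi}L^0(t,x)}{1+\frac{\pi}{1-\pi}L^0(t,x)}=\frac{\pi L^0(t,x)}{1-\pi+\pi L^0(t,x)},\qquad L^0(t,x):=\frac{1}{\sqrt{1-t}}\exp\Bigl(-\frac{x^2}{2(1-t)}\Bigr)$$ (the last expression for $\Pi$ is used for $\pi=1$, giving $\Pi(t,x,1)=1$). Embedded problem. Given $(t,x,\pi)$, under $\mathbb{P}_\pi$ the process $X=X^{t,x}$ starts at $X_t=x$, the hidden variable $\theta$ takes the value $1$ with probability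 $\Pi(t,x,\pi)$ and $0$ with probability $1-\Pi(t,x,\pi)$, and $$dX_{t+s}=-\theta\,\frac{X_{t+s}}{1-t-s}\,ds+dB_{t+s},\qquad 0\le s<1-t,$$ where $B$ is a standard Brownian motion independent of $\theta$; $X_1$ is the limit of $X_{t+s}$ as $s\uparrow 1-t$. (Equivalently, in the observation filtration, $dX_{t+s}=\Pi_{t+s}\,\rho(t+s,X_{t+s})\,ds+d\bar B_{t+s}$ and $d\Pi_{t+s}=\rho(t+s,X_{t+s})\Pi_{t+s}(1-\Pi_{t+s})\,d\bar B_{t+s}$ with $\Pi_t=\Pi(t,x,\pi)$, $\rho(u,y)=-y/(1-u)$, and $\bar B$ the innovation Brownian motion.) The supremum defining $V$ is over stopping times $\tau$ of the observed process $(X_{t+s})_{s\ge0}$ with $0\le\tau\le1-t$. Known-pinning value function. Let $\pi_\circ=3.14159\ldots$ be the circle constant, $\Phi$ the standard normal distribution function, and $\alpha\approx 0.839924$ the unique positive solution of $\sqrt{2\pi_\circ}(1-\alpha^2)e^{\alpha^2/2}\Phi(\alpha)=\alpha$. For $t<1$, $$V_1^0(t,x):=\begin{cases}\sqrt{2\pi_\circ(1-t)}\,(1-\alpha^2)\exp\bigl(\frac{x^2}{2(1-t)}\bigr)\Phi\bigl(\frac{x}{\sqrt{1-t}}\bigr), & x<\alpha\sqrt{1-t},\\ x, & x\ge\alpha\sqrt{1-t}.\end{cases}$$ By convention $\inf\emptyset=\infty$. *)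

theory Defs
  imports "HOL-Probability.Probability"
begin

definition L0 :: "real \<Rightarrow> real \<Rightarrow> real" where
  "L0 t x = 1 / sqrt (1 - t) * exp (- (x\<^sup>2 / (2 * (1 - t))))"

definition posterior :: "real \<Rightarrow> real \<Rightarrow> real \<Rightarrow> real" where
  "posterior t x p = p * L0 t x / (1 - p + p * L0 t x)"

abbreviation Phi :: "real \<Rightarrow> real" where
  "Phi \<equiv> cdf std_normal_distribution"

definition alpha :: real where
  "alpha = (THE a. 0 < a \<and> sqrt (2 * pi) * (1 - a\<^sup>2) * exp (a\<^sup>2 / 2) * Phi a = a)"

definition V10 :: "real \<Rightarrow> real \<Rightarrow> real" where
  "V10 t x =
    (if x < alpha * sqrt (1 - t)
     then sqrt (2 * pi * (1 - t)) * (1 - alpha\<^sup>2) * exp (x\<^sup>2 / (2 * (1 - t))) * Phi (x / sqrt (1 - t))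
     else x)"

locale standard_brownian_motion = prob_space M for M :: "'a measure" +
  fixes B :: "real \<Rightarrow> 'a \<Rightarrow> real"
  assumes random_variable_B: "\<And>u. 0 \<le> u \<Longrightarrow> random_variable borel (B u)"
    and B_0: "AE \<omega> in M. B 0 \<omega> = 0"
    and independent_increments:
      "\<And>(u :: nat \<Rightarrow> real) n. \<lbrakk>0 \<le> u 0; strict_mono u\<rbrakk> \<Longrightarrow>
         indep_vars (\<lambda>_. borel) (\<lambda>i \<omega>. B (u (Suc i)) \<omega> - B (u i) \<omega>) {..<n}"
    and normal_increments:
      "\<And>r s. \<lbrakk>0 \<le> r; r < s\<rbrakk> \<Longrightarrow>
         distributed M lborel (\<lambda>\<omega>. B s \<omega> - B r \<omega>) (normal_density 0 (sqrt (s - r)))"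
    and continuous_paths_B: "AE \<omega> in M. continuous_on {0..} (\<lambda>u. B u \<omega>)"

text \<open>
  The embedded problem started from \<open>(t, x)\<close> with prior \<open>p\<close>; \<open>M\<close> plays the role of the law
  \<open>P\<^sub>p\<close>, and \<open>X\<close> and \<open>B\<close> are indexed by absolute time. The noise is additive, so the stochastic
  differential equation is the pathwise integral equation \<open>integral_equation\<close>; at \<open>s = 0\<close> it
  says that \<open>X\<close> starts at \<open>x\<close>. At the singular time 1, \<open>X\<close> is only required to be the almost sure
  left limit.
\<close>

locale embedded_problem = standard_brownian_motion M B
  for M :: "'a measure" and B :: "real \<Rightarrow> 'a \<Rightarrow> real" +
  fixes \<theta> :: "'a \<Rightarrow> real" and X :: "real \<Rightarrow> 'a \<Rightarrow> real" and t x p :: real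
  assumes random_variable_theta: "random_variable borel \<theta>"
    and theta_values: "\<And>\<omega>. \<omega> \<in> space M \<Longrightarrow> \<theta> \<omega> \<in> {0, 1}"
    and theta_1: "\<P>(\<omega> in M. \<theta> \<omega> = 1) = posterior t x p"
    and theta_0: "\<P>(\<omega> in M. \<theta> \<omega> = 0) = 1 - posterior t x p"
    and theta_indep_B:
      "indep_set (sets (vimage_algebra (space M) \<theta> borel))
         (sets (vimage_algebra (space M) (\<lambda>\<omega>. \<lambda>u\<in>{0..}. B u \<omega>) (PiM {0..} (\<lambda>_. borel))))"
    and random_variable_X: "\<And>u. u \<in> {t..1} \<Longrightarrow> random_variable borel (X u)"
    and continuous_paths_X: "\<And>\<omega>. \<omega> \<in> space M \<Longrightarrow> continuous_on {t..<1} (\<lambda>u. X u \<omega>)"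
    and integral_equation:
      "AE \<omega> in M. \<forall>s\<in>{0..<1 - t}.
         X (t + s) \<omega> = x + integral {0..s} (\<lambda>r. - \<theta> \<omega> * X (t + r) \<omega> / (1 - t - r))
                         + (B (t + s) \<omega> - B t \<omega>)"
    and X_1: "AE \<omega> in M. ((\<lambda>u. X u \<omega>) \<longlongrightarrow> X 1 \<omega>) (at_left 1)"

text \<open>
  The natural filtration of the observed process, indexed by the time \<open>s\<close> elapsed since \<open>t\<close>. It is
  constant for \<open>s \<ge> 1 - t\<close> and trivial for \<open>s < 0\<close>.
\<close>

definition observed_filtration ::
    "'a measure \<Rightarrow> real \<Rightarrow> (real \<Rightarrow> 'a \<Rightarrow> real) \<Rightarrow> real \<Rightarrow> 'a measure" where
  "observed_filtration M t X s =
     sigma (space M) {X (t + u) -` A \<inter> space M | u A. 0 \<le> u \<and> u \<le> s \<and> u \<le> 1 - t \<and> A \<in> sets borel}"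

definition admissible :: "'a measure \<Rightarrow> real \<Rightarrow> (real \<Rightarrow> 'a \<Rightarrow> real) \<Rightarrow> ('a \<Rightarrow> real) set" where
  "admissible M t X =
     {\<tau>. stopping_time (observed_filtration M t X) \<tau> \<and> (\<forall>\<omega>\<in>space M. 0 \<le> \<tau> \<omega> \<and> \<tau> \<omega> \<le> 1 - t)}"

definition stopped :: "real \<Rightarrow> (real \<Rightarrow> 'a \<Rightarrow> real) \<Rightarrow> ('a \<Rightarrow> real) \<Rightarrow> 'a \<Rightarrow> real" where
  "stopped t X \<tau> \<omega> = X (t + \<tau> \<omega>) \<omega>"

text \<open>The supremum is taken in the extended reals, so that it is meaningful without a prior bound.\<close>

definition value_function :: "'a measure \<Rightarrow> real \<Rightarrow> (real \<Rightarrow> 'a \<Rightarrow> real) \<Rightarrow> ereal" where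
  "value_function M t X = (SUP \<tau>\<in>admissible M t X. ereal (integral\<^sup>L M (stopped t X \<tau>)))"

definition optimal_stopping_time ::
    "'a measure \<Rightarrow> real \<Rightarrow> (real \<Rightarrow> 'a \<Rightarrow> real) \<Rightarrow> ('a \<Rightarrow> real) \<Rightarrow> bool" where
  "optimal_stopping_time M t X \<tau> \<longleftrightarrow>
     \<tau> \<in> admissible M t X \<and> ereal (integral\<^sup>L M (stopped t X \<tau>)) = value_function M t X"

text \<open>
  \<open>\<tau>\<^sub>b\<close> and \<open>\<tau>\<^sup>*\<close> are functionals of an observed path \<open>w\<close> in absolute time. They involve neither the
  prior nor the probability measure, so one stopping rule serves all priors. The infimum of the
  empty set is \<open>\<infinity>\<close> in the extended reals.
\<close>

definition tau_b :: "real \<Rightarrow> (real \<Rightarrow> real) \<Rightarrow> ereal" where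
  "tau_b t w = Inf (ereal ` {s. 0 \<le> s \<and> s \<le> 1 - t \<and> w (t + s) \<ge> alpha * sqrt (1 - t - s)})"

definition tau_star :: "real \<Rightarrow> (real \<Rightarrow> real) \<Rightarrow> real" where
  "tau_star t w = real_of_ereal (min (tau_b t w) (ereal (1 - t)))"

end

theory Submission
  imports Defs
begin

text \<open>
  On the event \<open>\<theta> = j\<close> the process \<open>Y s = c s * X (t + s)\<close>, with \<open>c = 1\<close> for \<open>j = 0\<close> and
  \<open>c s = 1 / (1 - t - s)\<close> for \<open>j = 1\<close>, has differential \<open>c dB\<close>. Optional stopping of
  \<open>exp (l Y - l\<^sup>2 / 2 * (integral of c\<^sup>2))\<close> at a stopping time of \<open>X\<close> that stays away from time 1 is
  obtained by discretization, without stochastic integrals. For \<open>j = 0\<close>, differentiation at \<open>l = 0\<close> gives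
  mean \<open>x\<close>. For \<open>j = 1\<close>, put \<open>v s = 1 / (1 - t - s)\<close>, so that \<open>X = Y / v\<close>; integrating over \<open>l \<ge> 0\<close> gives
  the positive martingale \<open>G v Y = g (Y / sqrt v) / sqrt v\<close> with \<open>g z = sqrt (2 * pi) * exp (z\<^sup>2 / 2) * Phi z\<close>.
  Convexity of \<open>g\<close> yields \<open>z \<le> (1 - alpha\<^sup>2) * g z\<close>, with equality at \<open>alpha\<close>. Hence the gain \<open>Y / v\<close> is dominated
  by the martingale \<open>(v0 + b) / v0 * (1 - alpha\<^sup>2) * G (v + b) Y\<close> for every \<open>b \<ge> 0\<close>, and a suitable \<open>b\<close> makes its
  initial value \<open>V10 t x\<close>. At the hitting time of the boundary, gain and martingale agree.
\<close>

section \<open>Gaussian ratio and the free boundary\<close>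

text \<open>All martingale arguments run in the filtration of \<open>\<theta>\<close> and the noise,
  so the upper bound is that of an observer who knows \<open>\<theta>\<close>. On
  \<open>\<theta> = 0\<close> every stopping time gives the same mean x, so such an observer can
  only optimise the pinned case; the pinned rule attains the bound without looking at
  \<open>\<theta>\<close>. This is why one rule serves every prior. The integral equation holds only
  almost surely, so observed events need not lie in that filtration; they are replaced by versions
  that differ by null sets. The factor 1 / (1 - t - s) blows up at time 1. Means are therefore
  computed up to a horizon S < 1 - t, and second moments bounded uniformly in S carry them to the
  limit. In the lower bound, paths that have not hit the boundary by S are controlled by the mean of
  |X (t + S)| under pinning, which is of order sqrt (1 - t - S). The shift b is forced by starts
  strictly beyond the boundary: there \<open>V10\<close> is x, while the unshifted multiple of G
  starts above x, since the tangent inequality is strict away from \<open>alpha\<close>.\<close>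

lemma Phi_has_real_derivative: "(Phi has_real_derivative std_normal_density x) (at x)"
proof -
  interpret real_distribution std_normal_distribution
    by (rule real_dist_normal_dist)
  define f where "f = std_normal_density"
  have f: "f \<in> borel_measurable borel" "\<And>u. 0 \<le> f u" "continuous_on A f" for A
    unfolding f_def normal_density_def by (auto intro!: continuous_intros)
  \<comment> \<open>The base point only has to lie to the left of x, so that x is an interior point
    when the integral is differentiated.\<close>
  have eq: "Phi u = Phi (x - 1) + integral {x - 1..u} f" if "x - 1 < u" for u
  proof -
    have "emeasure std_normal_distribution {x - 1..u} = (\<integral>\<^sup>+y. ennreal (f y) * indicator {x - 1..u} y \<partial>lborel)"
      unfolding f_def by (simp add: emeasure_density)
    also have "\<dots> = integral {x - 1..u} f"
      using f by (intro nn_integral_has_integral_lebesgue' integrable_integral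
          integrable_continuous_interval) auto
    finally have "measure std_normal_distribution {x - 1..u} = integral {x - 1..u} f"
      using f integral_nonneg[of f "{x - 1..u}"]
      by (simp add: measure_def integrable_continuous_interval)
    moreover have "measure std_normal_distribution {x - 1<..u} = measure std_normal_distribution {x - 1..u}"
    proof (intro measure_eq_AE)
      have "AE y in lborel. y \<noteq> x - 1" by (rule AE_lborel_singleton)
      then show "AE y in std_normal_distribution. y \<in> {x - 1<..u} \<longleftrightarrow> y \<in> {x - 1..u}"
        by (auto simp: AE_density elim!: eventually_mono)
    qed auto
    ultimately show ?thesis using cdf_diff_eq[OF that] by simp
  qed
  have "((\<lambda>u. integral {x - 1..u} f) has_real_derivative f x) (at x within {x - 1..x + 1})"
    by (intro integral_has_real_derivative f) auto
  then have "((\<lambda>u. integral {x - 1..u} f) has_real_derivative f x) (at x)"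
    by (simp add: at_within_Icc_at)
  then have "((\<lambda>u. Phi (x - 1) + integral {x - 1..u} f) has_real_derivative f x) (at x)"
    by (auto intro!: derivative_eq_intros)
  then show ?thesis
    unfolding f_def[symmetric]
    by (rule has_field_derivative_transform_within_open[where S="{x - 1<..}"])
      (use eq in \<open>auto simp: f_def\<close>)
qed

lemma Phi_pos: "0 < Phi x"
proof -
  interpret real_distribution std_normal_distribution
    by (rule real_dist_normal_dist)
  have "Phi (x - 1) < Phi x"
    by (rule DERIV_pos_imp_increasing) (auto intro!: exI Phi_has_real_derivative normal_density_pos)
  then show ?thesis
    using cdf_nonneg[of "x - 1"] by linarith
qed

text \<open>The quotient of \<open>Phi\<close> by the standard normal density, that is, the Mills
  ratio at - z; it is g in the overview.\<close>

definition gauss_ratio :: "real \<Rightarrow> real" where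
  "gauss_ratio z = sqrt (2 * pi) * exp (z\<^sup>2 / 2) * Phi z"

lemma gauss_ratio_pos: "0 < gauss_ratio z"
  by (simp add: gauss_ratio_def Phi_pos)

text \<open>The density f satisfies f' = - z f, which turns the product rule into a linear
  differential equation for g. The smooth fit and the sign of g'' are both read off from it.\<close>

lemma gauss_ratio_has_real_derivative:
  "(gauss_ratio has_real_derivative 1 + z * gauss_ratio z) (at z)"
proof -
  have "sqrt (2 * pi) * exp (z\<^sup>2 / 2) * std_normal_density z = 1"
    by (simp add: std_normal_density_def exp_minus)
  then have "sqrt (2 * pi) * (exp (z\<^sup>2 / 2) * z) * Phi z + sqrt (2 * pi) * exp (z\<^sup>2 / 2) * std_normal_density z
    = 1 + z * gauss_ratio z"
    by (simp add: gauss_ratio_def)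
  moreover have "(gauss_ratio has_real_derivative
     sqrt (2 * pi) * (exp (z\<^sup>2 / 2) * z) * Phi z + sqrt (2 * pi) * exp (z\<^sup>2 / 2) * std_normal_density z) (at z)"
    unfolding gauss_ratio_def[abs_def]
    by (auto intro!: derivative_eq_intros Phi_has_real_derivative)
  ultimately show ?thesis by simp
qed

text \<open>Differentiating g' = 1 + z g once more gives g'' = g + z (1 + z g), visibly nonnegative
  for z \<ge> 0, so g lies above its tangents there.\<close>

lemma gauss_ratio_tangent:
  assumes "0 \<le> a" "0 \<le> z"
  shows "gauss_ratio a + (1 + a * gauss_ratio a) * (z - a) \<le> gauss_ratio z"
proof -
  have "(1 + a * gauss_ratio a) * (z - a) \<le> gauss_ratio z - gauss_ratio a"
  proof (rule f''_imp_f'[where C="{0..}" and f'="\<lambda>z. 1 + z * gauss_ratio z"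
        and f''="\<lambda>z. gauss_ratio z + z * (1 + z * gauss_ratio z)"])
    show "((\<lambda>z. 1 + z * gauss_ratio z) has_real_derivative gauss_ratio y + y * (1 + y * gauss_ratio y)) (at y)" for y
      by (auto intro!: derivative_eq_intros gauss_ratio_has_real_derivative)
    show "0 \<le> gauss_ratio y + y * (1 + y * gauss_ratio y)" if "y \<in> {0..}" for y
      using that gauss_ratio_pos[of y] by simp
  qed (use assms in \<open>auto intro: gauss_ratio_has_real_derivative\<close>)
  then show ?thesis by simp
qed

lemma free_boundary_root_less_1:
  assumes "0 < a" "(1 - a\<^sup>2) * gauss_ratio a = a"
  shows "a < 1"
proof -
  have "0 < (1 - a\<^sup>2) * gauss_ratio a" using assms by simp
  then have "a\<^sup>2 < 1" using gauss_ratio_pos[of a] by (simp add: zero_less_mult_iff)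
  then show ?thesis using assms(1) by (simp add: power2_eq_square abs_square_less_1[unfolded power2_eq_square])
qed

text \<open>At a root \<open>a\<close> the line \<open>z\<close> is tangent to \<open>(1 - a\<^sup>2) * gauss_ratio z\<close> (smooth fit), so \<open>1 - a\<^sup>2\<close>
  is the maximum of \<open>z / gauss_ratio z\<close>; this also gives uniqueness of the root.\<close>

lemma free_boundary_root_majorant:
  assumes a: "0 < a" "(1 - a\<^sup>2) * gauss_ratio a = a"
  shows "z \<le> (1 - a\<^sup>2) * gauss_ratio z"
proof -
  have a1: "0 < 1 - a\<^sup>2"
    using free_boundary_root_less_1[OF a] a by (simp add: power_less_one_iff abs_square_less_1)
  show ?thesis
  proof (cases "0 \<le> z")
    case True
    \<comment> \<open>The root equation makes the scaled tangent have value a and slope (1 - a^2) +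
      a * a = 1 at a, so this tangent is the identity.\<close>
    have "z = (1 - a\<^sup>2) * gauss_ratio a + ((1 - a\<^sup>2) + a * ((1 - a\<^sup>2) * gauss_ratio a)) * (z - a)"
      unfolding a(2) by (simp add: power2_eq_square)
    also have "\<dots> = (1 - a\<^sup>2) * (gauss_ratio a + (1 + a * gauss_ratio a) * (z - a))"
      by (simp add: algebra_simps)
    also have "\<dots> \<le> (1 - a\<^sup>2) * gauss_ratio z"
      using gauss_ratio_tangent[of a z] a a1 True by (intro mult_left_mono) auto
    finally show ?thesis .
  next
    case False
    then show ?thesis
      using mult_pos_pos[OF a1 gauss_ratio_pos[of z]] by linarith
  qed
qed

lemma free_boundary_root_unique:
  assumes "0 < a" "(1 - a\<^sup>2) * gauss_ratio a = a" "0 < b" "(1 - b\<^sup>2) * gauss_ratio b = b"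
  shows "a = b"
proof -
  have "(1 - b\<^sup>2) * gauss_ratio b \<le> (1 - a\<^sup>2) * gauss_ratio b"
       "(1 - a\<^sup>2) * gauss_ratio a \<le> (1 - b\<^sup>2) * gauss_ratio a"
    using free_boundary_root_majorant[of a b] free_boundary_root_majorant[of b a] assms by auto
  then have "a\<^sup>2 = b\<^sup>2"
    using gauss_ratio_pos[of a] gauss_ratio_pos[of b] by (auto simp: mult_le_cancel_right)
  then show ?thesis
    using assms by (simp add: power2_eq_iff)
qed

text \<open>The difference of the two sides is - g 0 < 0 at 0 and equals 1 at 1, so the intermediate
  value theorem applies.\<close>

lemma free_boundary_root_exists: "\<exists>a>0. (1 - a\<^sup>2) * gauss_ratio a = a"
proof -
  have "isCont (\<lambda>a. a - (1 - a\<^sup>2) * gauss_ratio a) a" for a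
    using gauss_ratio_has_real_derivative[of a, THEN DERIV_isCont] by (intro continuous_intros) auto
  then obtain a where a: "0 \<le> a" "a - (1 - a\<^sup>2) * gauss_ratio a = 0"
    using IVT[of "\<lambda>a. a - (1 - a\<^sup>2) * gauss_ratio a" 0 0 1] gauss_ratio_pos[of 0] by auto
  moreover have "a \<noteq> 0"
    using a gauss_ratio_pos[of 0] by auto
  ultimately show ?thesis by (intro exI[of _ a]) auto
qed

lemma alpha_root: "0 < alpha" "(1 - alpha\<^sup>2) * gauss_ratio alpha = alpha"
proof -
  have "alpha = (THE a. 0 < a \<and> (1 - a\<^sup>2) * gauss_ratio a = a)"
    unfolding alpha_def gauss_ratio_def by (simp add: mult_ac)
  moreover have "\<exists>!a. 0 < a \<and> (1 - a\<^sup>2) * gauss_ratio a = a"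
    using free_boundary_root_exists free_boundary_root_unique by blast
  ultimately have "0 < alpha \<and> (1 - alpha\<^sup>2) * gauss_ratio alpha = alpha"
    using theI'[of "\<lambda>a. 0 < a \<and> (1 - a\<^sup>2) * gauss_ratio a = a"] by simp
  then show "0 < alpha" "(1 - alpha\<^sup>2) * gauss_ratio alpha = alpha" by auto
qed

lemma le_gauss_ratio: "z \<le> (1 - alpha\<^sup>2) * gauss_ratio z"
  using free_boundary_root_majorant[OF alpha_root] .

lemma alpha_sq_less_1: "alpha\<^sup>2 < 1"
  using free_boundary_root_less_1[OF alpha_root] alpha_root(1) by (simp add: power_less_one_iff abs_square_less_1)

text \<open>Completing the square by l = y / v - u / sqrt v. The substitution reverses orientation,
  so l \<ge> 0 becomes u \<le> y / sqrt v and the Gaussian mass is \<open>Phi\<close> itself, not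
  its complement.\<close>

lemma nn_integral_exp_quadratic:
  assumes "0 < v"
  shows "(\<integral>\<^sup>+l\<in>{0..}. ennreal (exp (l * y - l\<^sup>2 * v / 2)) \<partial>lborel) = ennreal (gauss_ratio (y / sqrt v) / sqrt v)"
proof -
  have "(\<integral>\<^sup>+l. ennreal (exp (l * y - l\<^sup>2 * v / 2)) * indicator {0..} l \<partial>lborel) =
    ennreal \<bar>- 1 / sqrt v\<bar> * (\<integral>\<^sup>+u. ennreal (exp ((y / v + (- 1 / sqrt v) * u) * y - (y / v + (- 1 / sqrt v) * u)\<^sup>2 * v / 2)) * indicator {0..} (y / v + (- 1 / sqrt v) * u) \<partial>lborel)"
    using assms by (intro nn_integral_real_affine) auto
  also have "(\<lambda>u. ennreal (exp ((y / v + (- 1 / sqrt v) * u) * y - (y / v + (- 1 / sqrt v) * u)\<^sup>2 * v / 2)) * indicator {0..} (y / v + (- 1 / sqrt v) * u)) =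
    (\<lambda>u. ennreal (sqrt (2 * pi) * exp ((y / sqrt v)\<^sup>2 / 2)) * (ennreal (std_normal_density u) * indicator {..y / sqrt v} u))"
  proof
    fix u
    define w where "w = sqrt v"
    have w: "0 < w" "v = w\<^sup>2" using assms by (auto simp: w_def)
    have ind: "indicator {0..} (y / v + (- 1 / sqrt v) * u) = (indicator {..y / sqrt v} u :: ennreal)"
      using w by (auto simp: indicator_def w_def[symmetric] field_simps power2_eq_square)
    have e: "(y / v + (- 1 / sqrt v) * u) * y - (y / v + (- 1 / sqrt v) * u)\<^sup>2 * v / 2 = (y / sqrt v)\<^sup>2 / 2 + - u\<^sup>2 / 2"
      unfolding w_def[symmetric] w(2) using w(1) by (simp add: field_simps power2_eq_square)
    show "ennreal (exp ((y / v + (- 1 / sqrt v) * u) * y - (y / v + (- 1 / sqrt v) * u)\<^sup>2 * v / 2)) * indicator {0..} (y / v + (- 1 / sqrt v) * u)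
      = ennreal (sqrt (2 * pi) * exp ((y / sqrt v)\<^sup>2 / 2)) * (ennreal (std_normal_density u) * indicator {..y / sqrt v} u)"
      unfolding ind e exp_add std_normal_density_def
      by (simp add: ennreal_mult[symmetric] mult.assoc[symmetric])
  qed
  also have "(\<integral>\<^sup>+u. ennreal (sqrt (2 * pi) * exp ((y / sqrt v)\<^sup>2 / 2)) * (ennreal (std_normal_density u) * indicator {..y / sqrt v} u) \<partial>lborel)
    = ennreal (sqrt (2 * pi) * exp ((y / sqrt v)\<^sup>2 / 2)) * emeasure std_normal_distribution {..y / sqrt v}"
    by (simp add: nn_integral_cmult emeasure_density)
  also have "emeasure std_normal_distribution {..y / sqrt v} = Phi (y / sqrt v)"
  proof -
    interpret real_distribution std_normal_distribution
      by (rule real_dist_normal_dist)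
    show ?thesis by (simp add: cdf_def emeasure_eq_measure)
  qed
  finally show ?thesis
    using assms by (simp add: ennreal_mult[symmetric] gauss_ratio_def cdf_def field_simps)
qed

text \<open>In the integral representation the integrand exp (l y - l^2 / 2) increases with y,
  because l \<ge> 0. This settles negative arguments too, where the sign of 1 + z g is not
  apparent.\<close>

lemma mono_gauss_ratio:
  assumes "y \<le> z"
  shows "gauss_ratio y \<le> gauss_ratio z"
proof -
  have "ennreal (gauss_ratio (y / sqrt 1) / sqrt 1) \<le> ennreal (gauss_ratio (z / sqrt 1) / sqrt 1)"
    unfolding nn_integral_exp_quadratic[OF zero_less_one, symmetric] using assms
    by (intro nn_integral_mono) (auto simp: indicator_def mult_left_mono)
  then show ?thesis using gauss_ratio_pos[of z] by (simp add: ennreal_le_iff less_imp_le)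
qed

text \<open>The weight is absorbed by l \<le> exp l, which merely moves y to y + 1.\<close>

lemma nn_integral_weighted_exp_quadratic_finite:
  assumes "0 < v"
  shows "(\<integral>\<^sup>+l\<in>{0..}. ennreal (l * exp (l * y - l\<^sup>2 * v / 2)) \<partial>lborel) < \<infinity>"
proof -
  have "(\<integral>\<^sup>+l\<in>{0..}. ennreal (l * exp (l * y - l\<^sup>2 * v / 2)) \<partial>lborel)
    \<le> (\<integral>\<^sup>+l\<in>{0..}. ennreal (exp (l * (y + 1) - l\<^sup>2 * v / 2)) \<partial>lborel)"
  proof (intro nn_integral_mono)
    fix l :: real
    have "l \<le> exp l" using exp_ge_add_one_self[of l] by linarith
    then have "l * exp (l * y - l\<^sup>2 * v / 2) \<le> exp l * exp (l * y - l\<^sup>2 * v / 2)"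
      by (intro mult_right_mono) auto
    also have "\<dots> = exp (l * (y + 1) - l\<^sup>2 * v / 2)"
      by (simp add: exp_add[symmetric] algebra_simps)
    finally show "ennreal (l * exp (l * y - l\<^sup>2 * v / 2)) * indicator {0..} l
      \<le> ennreal (exp (l * (y + 1) - l\<^sup>2 * v / 2)) * indicator {0..} l"
      by (auto simp: indicator_def intro!: ennreal_leI)
  qed
  also have "\<dots> < \<infinity>" using nn_integral_exp_quadratic[OF assms, of "y + 1"] by simp
  finally show ?thesis .
qed

text \<open>Turns exponential moments at the two parameters l and - l into second moments; all
  uniform square bounds below rest on it.\<close>

lemma sq_le_exp_add_exp: "u\<^sup>2 \<le> 2 * (exp u + exp (- u))" for u :: real
proof -
  have aux: "w\<^sup>2 \<le> 2 * (exp w + exp (- w))" if "0 \<le> w" for w :: real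
    using exp_lower_Taylor_quadratic[OF that] exp_ge_add_one_self[of "- w"] by simp
  show ?thesis
  proof (cases "0 \<le> u")
    case True
    then show ?thesis by (rule aux)
  next
    case False
    then show ?thesis using aux[of "- u"] by simp
  qed
qed

section \<open>Brownian increments\<close>

text \<open>Bounded second moments give uniform integrability, hence convergence of means. Fatou's
  lemma transfers the bound to the limit, and truncation at a level K splits the difference into a
  dominated part and a uniformly small tail.\<close>

lemma (in prob_space) L2_bounded_limit:
  fixes f :: "nat \<Rightarrow> 'a \<Rightarrow> real"
  assumes [measurable]: "\<And>n. f n \<in> borel_measurable M" "g \<in> borel_measurable M"
    and lim: "AE \<omega> in M. (\<lambda>n. f n \<omega>) \<longlonglongrightarrow> g \<omega>"
    and bound: "\<And>n. (\<integral>\<^sup>+\<omega>. ennreal ((f n \<omega>)\<^sup>2) \<partial>M) \<le> ennreal C"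
  shows "integrable M g" "(\<lambda>n. \<integral>\<omega>. f n \<omega> \<partial>M) \<longlonglongrightarrow> (\<integral>\<omega>. g \<omega> \<partial>M)"
proof -
  \<comment> \<open>The real bound is \<open>max 0 C\<close> because \<open>ennreal\<close> sends a
    negative C to 0.\<close>
  have int: "integrable M h" "integrable M (\<lambda>\<omega>. (h \<omega>)\<^sup>2)" "(\<integral>\<omega>. (h \<omega>)\<^sup>2 \<partial>M) \<le> max 0 C"
    if [measurable]: "h \<in> borel_measurable M" and h: "(\<integral>\<^sup>+\<omega>. ennreal ((h \<omega>)\<^sup>2) \<partial>M) \<le> ennreal C" for h :: "'a \<Rightarrow> real"
  proof -
    have "(\<integral>\<^sup>+\<omega>. ennreal (norm ((h \<omega>)\<^sup>2)) \<partial>M) < \<infinity>"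
      using le_less_trans[OF h ennreal_less_top] by simp
    then show sq: "integrable M (\<lambda>\<omega>. (h \<omega>)\<^sup>2)"
      by (intro integrableI_bounded) simp_all
    have "(\<integral>\<^sup>+\<omega>. ennreal ((h \<omega>)\<^sup>2) \<partial>M) = ennreal (\<integral>\<omega>. (h \<omega>)\<^sup>2 \<partial>M)"
      by (intro nn_integral_eq_integral sq) simp
    then have "ennreal (\<integral>\<omega>. (h \<omega>)\<^sup>2 \<partial>M) \<le> ennreal C"
      using h by (simp only:)
    then show "(\<integral>\<omega>. (h \<omega>)\<^sup>2 \<partial>M) \<le> max 0 C"
      unfolding ennreal_le_iff2 by linarith
    show "integrable M h"
      by (rule square_integrable_imp_integrable[OF that(1) sq])
  qed
  note f = int[OF assms(1) bound]
  have "(\<integral>\<^sup>+\<omega>. ennreal ((g \<omega>)\<^sup>2) \<partial>M) = (\<integral>\<^sup>+\<omega>. liminf (\<lambda>n. ennreal ((f n \<omega>)\<^sup>2)) \<partial>M)"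
  proof (intro nn_integral_cong_AE, use lim in eventually_elim)
    fix \<omega> assume "(\<lambda>n. f n \<omega>) \<longlonglongrightarrow> g \<omega>"
    then have "(\<lambda>n. ennreal ((f n \<omega>)\<^sup>2)) \<longlonglongrightarrow> ennreal ((g \<omega>)\<^sup>2)"
      by (intro tendsto_ennrealI tendsto_power)
    then show "ennreal ((g \<omega>)\<^sup>2) = liminf (\<lambda>n. ennreal ((f n \<omega>)\<^sup>2))"
      using lim_imp_Liminf[OF sequentially_bot] by metis
  qed
  also have "\<dots> \<le> liminf (\<lambda>n. \<integral>\<^sup>+\<omega>. ennreal ((f n \<omega>)\<^sup>2) \<partial>M)"
    by (intro nn_integral_liminf) auto
  also have "\<dots> \<le> ennreal C"
    by (intro Liminf_le) (auto simp: bound)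
  finally have g: "integrable M g" "integrable M (\<lambda>\<omega>. (g \<omega>)\<^sup>2)" "(\<integral>\<omega>. (g \<omega>)\<^sup>2 \<partial>M) \<le> max 0 C"
    using int[OF assms(2)] by blast+
  show "integrable M g" by fact
  define D where "D = max 0 C"
  \<comment> \<open>Where |f n - g| \<ge> K it is at most (f n - g)^2 / K, whose mean is at most 4 D
    / K for every n.\<close>
  have key: "\<bar>(\<integral>\<omega>. f n \<omega> \<partial>M) - (\<integral>\<omega>. g \<omega> \<partial>M)\<bar> \<le> (\<integral>\<omega>. min \<bar>f n \<omega> - g \<omega>\<bar> K \<partial>M) + 4 * D / K"
    if K: "0 < K" for n K
  proof -
    have m: "integrable M (\<lambda>\<omega>. min \<bar>f n \<omega> - g \<omega>\<bar> K)"
      using K by (intro integrable_const_bound[where B=K]) auto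
    have "\<bar>(\<integral>\<omega>. f n \<omega> \<partial>M) - (\<integral>\<omega>. g \<omega> \<partial>M)\<bar> \<le> (\<integral>\<omega>. \<bar>f n \<omega> - g \<omega>\<bar> \<partial>M)"
      using integral_abs_bound[of M "\<lambda>\<omega>. f n \<omega> - g \<omega>"] f g by simp
    also have "\<dots> \<le> (\<integral>\<omega>. min \<bar>f n \<omega> - g \<omega>\<bar> K + (2 * (f n \<omega>)\<^sup>2 + 2 * (g \<omega>)\<^sup>2) / K \<partial>M)"
    proof (intro integral_mono)
      fix \<omega>
      have "(f n \<omega> - g \<omega>)\<^sup>2 \<le> 2 * (f n \<omega>)\<^sup>2 + 2 * (g \<omega>)\<^sup>2"
        using zero_le_power2[of "f n \<omega> + g \<omega>"] by (simp add: power2_eq_square algebra_simps)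
      then have le: "(f n \<omega> - g \<omega>)\<^sup>2 / K \<le> (2 * (f n \<omega>)\<^sup>2 + 2 * (g \<omega>)\<^sup>2) / K"
        using K by (intro divide_right_mono) auto
      show "\<bar>f n \<omega> - g \<omega>\<bar> \<le> min \<bar>f n \<omega> - g \<omega>\<bar> K + (2 * (f n \<omega>)\<^sup>2 + 2 * (g \<omega>)\<^sup>2) / K"
      proof (cases "K \<le> \<bar>f n \<omega> - g \<omega>\<bar>")
        case True
        then have "\<bar>f n \<omega> - g \<omega>\<bar> * K \<le> \<bar>f n \<omega> - g \<omega>\<bar> * \<bar>f n \<omega> - g \<omega>\<bar>"
          by (intro mult_left_mono) auto
        then have "\<bar>f n \<omega> - g \<omega>\<bar> \<le> (f n \<omega> - g \<omega>)\<^sup>2 / K"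
          using K by (simp add: pos_le_divide_eq power2_eq_square abs_mult_self_eq)
        then show ?thesis using le K True by simp
      next
        case False
        then show ?thesis using K by simp
      qed
    qed (use f g m in auto)
    also have "\<dots> = (\<integral>\<omega>. min \<bar>f n \<omega> - g \<omega>\<bar> K \<partial>M) + (2 * (\<integral>\<omega>. (f n \<omega>)\<^sup>2 \<partial>M) + 2 * (\<integral>\<omega>. (g \<omega>)\<^sup>2 \<partial>M)) / K"
      using f g m by simp
    also have "\<dots> \<le> (\<integral>\<omega>. min \<bar>f n \<omega> - g \<omega>\<bar> K \<partial>M) + 4 * D / K"
      using f(3)[of n] g(3) K by (intro add_left_mono divide_right_mono) (auto simp: D_def)
    finally show ?thesis .
  qed
  have trunc: "(\<lambda>n. \<integral>\<omega>. min \<bar>f n \<omega> - g \<omega>\<bar> K \<partial>M) \<longlonglongrightarrow> 0" if K: "0 < K" for K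
  proof -
    have "(\<lambda>n. \<integral>\<omega>. min \<bar>f n \<omega> - g \<omega>\<bar> K \<partial>M) \<longlonglongrightarrow> (\<integral>\<omega>. 0 \<partial>M)"
    proof (rule integral_dominated_convergence[where w="\<lambda>_. K"])
      show "AE \<omega> in M. (\<lambda>n. min \<bar>f n \<omega> - g \<omega>\<bar> K) \<longlonglongrightarrow> 0"
        using lim
      proof eventually_elim
        fix \<omega> assume "(\<lambda>n. f n \<omega>) \<longlonglongrightarrow> g \<omega>"
        then have "(\<lambda>n. min \<bar>f n \<omega> - g \<omega>\<bar> K) \<longlonglongrightarrow> min \<bar>g \<omega> - g \<omega>\<bar> K"
          by (intro tendsto_intros)
        then show "(\<lambda>n. min \<bar>f n \<omega> - g \<omega>\<bar> K) \<longlonglongrightarrow> 0" using K by simp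
      qed
    qed (use K in auto)
    then show ?thesis by simp
  qed
  show "(\<lambda>n. \<integral>\<omega>. f n \<omega> \<partial>M) \<longlonglongrightarrow> (\<integral>\<omega>. g \<omega> \<partial>M)"
  proof (rule LIMSEQ_I)
    fix r :: real assume r: "0 < r"
    \<comment> \<open>Makes the tail 4 D / K smaller than r / 2; the summand 1 keeps K positive when
      D = 0.\<close>
    define K where "K = 8 * (D + 1) / r"
    have K: "0 < K" "4 * D / K < r / 2"
    proof -
      have D: "0 \<le> D" by (simp add: D_def)
      then show "0 < K" using r by (simp add: K_def)
      moreover have "r / 2 * K = 4 * (D + 1)" using r by (simp add: K_def)
      ultimately show "4 * D / K < r / 2" by (simp add: pos_divide_less_eq)
    qed
    obtain N where N: "\<And>n. N \<le> n \<Longrightarrow> norm ((\<integral>\<omega>. min \<bar>f n \<omega> - g \<omega>\<bar> K \<partial>M) - 0) < r / 2"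
      using LIMSEQ_D[OF trunc[OF K(1)], of "r / 2"] r by auto
    have "norm ((\<integral>\<omega>. f n \<omega> \<partial>M) - (\<integral>\<omega>. g \<omega> \<partial>M)) < r" if "N \<le> n" for n
      using N[OF that] key[OF K(1), of n] K(2) unfolding real_norm_def by linarith
    then show "\<exists>N. \<forall>n\<ge>N. norm ((\<integral>\<omega>. f n \<omega> \<partial>M) - (\<integral>\<omega>. g \<omega> \<partial>M)) < r"
      by blast
  qed
qed

text \<open>Exponential tilting: exp (c y) times the centred normal density is a constant multiple
  of the normal density with mean c \<sigma>^2, so both claims reduce to facts about a
  density.\<close>

lemma (in prob_space) normal_exponential_moment:
  assumes D: "distributed M lborel D (normal_density 0 \<sigma>)" and "0 < \<sigma>"
  shows "integrable M (\<lambda>\<omega>. exp (c * D \<omega>))" "(\<integral>\<omega>. exp (c * D \<omega>) \<partial>M) = exp (c\<^sup>2 * \<sigma>\<^sup>2 / 2)"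
proof -
  have eq: "normal_density 0 \<sigma> y * exp (c * y) = exp (c\<^sup>2 * \<sigma>\<^sup>2 / 2) * normal_density (c * \<sigma>\<^sup>2) \<sigma> y" for y
  proof -
    have "- (y - 0)\<^sup>2 / (2 * \<sigma>\<^sup>2) + c * y = c\<^sup>2 * \<sigma>\<^sup>2 / 2 + - (y - c * \<sigma>\<^sup>2)\<^sup>2 / (2 * \<sigma>\<^sup>2)"
      using assms(2) by (simp add: field_simps power2_eq_square)
    then have "exp (- (y - 0)\<^sup>2 / (2 * \<sigma>\<^sup>2)) * exp (c * y) = exp (c\<^sup>2 * \<sigma>\<^sup>2 / 2) * exp (- (y - c * \<sigma>\<^sup>2)\<^sup>2 / (2 * \<sigma>\<^sup>2))"
      unfolding exp_add[symmetric] by simp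
    then show ?thesis
      unfolding normal_density_def by (simp add: mult_ac)
  qed
  show "integrable M (\<lambda>\<omega>. exp (c * D \<omega>))"
    using distributed_integrable[OF D, of "\<lambda>y. exp (c * y)"] assms(2) by (simp add: eq)
  show "(\<integral>\<omega>. exp (c * D \<omega>) \<partial>M) = exp (c\<^sup>2 * \<sigma>\<^sup>2 / 2)"
    using distributed_integral[OF D, of "\<lambda>y. exp (c * y)"] assms(2) by (simp add: eq)
qed

lemma sets_Collect_preimage:
  "f \<in> measurable M N \<Longrightarrow> A \<in> sets N \<Longrightarrow> {\<omega>\<in>space M. f \<omega> \<in> A} \<in> sets M"
  using measurable_sets[of f M N A] by (simp add: vimage_def Int_def conj_commute)

text \<open>Independence is given for increments along strictly increasing sequences of times.
  Sorting J together with 0 and a, and continuing with b, makes the event on the left a condition on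
  the partial sums of the first n increments, while B b - B a is the next increment.\<close>

lemma (in standard_brownian_motion) finite_past_indep_increment:
  assumes "0 \<le> a" "a < b" and J: "finite J" "J \<subseteq> {0..a}"
    and E: "\<And>r. E r \<in> sets borel" and C: "C \<in> sets borel"
  shows "prob ({\<omega>\<in>space M. \<forall>r\<in>J. B r \<omega> \<in> E r} \<inter> {\<omega>\<in>space M. B b \<omega> - B a \<omega> \<in> C}) =
    prob {\<omega>\<in>space M. \<forall>r\<in>J. B r \<omega> \<in> E r} * prob {\<omega>\<in>space M. B b \<omega> - B a \<omega> \<in> C}"
proof -
  define xs where "xs = sorted_list_of_set (insert 0 (insert a J))"
  have xs: "set xs = insert 0 (insert a J)" "sorted_wrt (<) xs"
    using J(1) by (simp_all add: xs_def del: sorted_list_of_set_insert_remove)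
  define n where "n = length xs - 1"
  have "xs \<noteq> []" using xs(1) by auto
  then have len: "length xs = Suc n" by (simp add: n_def)
  \<comment> \<open>Indices up to n run through the sorted times and end at a; then come b, b + 1,
    and so on, since the sequence has to increase on all natural numbers.\<close>
  define u where "u i = (if i \<le> n then xs ! i else b + real (i - Suc n))" for i
  have u_le: "u i \<le> a" "0 \<le> u i" if "i \<le> n" for i
    using that nth_mem[of i xs] xs(1) J(2) assms(1) len by (auto simp: u_def)
  have "u i < u (Suc i)" for i
  proof -
    consider "Suc i \<le> n" | "i = n" | "n < i" by linarith
    then show "u i < u (Suc i)"
    proof cases
      case 1
      then show ?thesis
        using sorted_wrt_nth_less[OF xs(2), of i "Suc i"] len by (simp add: u_def)
    next
      case 2
      then show ?thesis using u_le[of n] \<open>a < b\<close> by (simp add: u_def)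
    qed (simp add: u_def)
  qed
  then have smono: "strict_mono u"
    by (simp add: strict_mono_Suc_iff)
  have u_onto: "\<exists>i\<le>n. u i = r" if "r \<in> set xs" for r
    using that len unfolding in_set_conv_nth by (auto simp: u_def less_Suc_eq_le)
  obtain i0 where i0: "i0 \<le> n" "u i0 = 0"
    using u_onto[of 0] xs(1) by auto
  have u0: "u 0 = 0"
    using strict_mono_less_eq[OF smono, of 0 i0] i0 u_le(2)[of 0] by simp
  obtain i1 where i1: "i1 \<le> n" "u i1 = a"
    using u_onto[of a] xs(1) by auto
  have "u n = a"
    using strict_mono_less_eq[OF smono, of i1 n] i1 u_le(1)[of n] by auto
  then have un: "u n = a" "u (Suc n) = b"
    by (simp_all add: u_def[of "Suc n"])
  define D where "D i \<omega> = B (u (Suc i)) \<omega> - B (u i) \<omega>" for i \<omega>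
  have ind: "indep_vars (\<lambda>_. borel) D {..<Suc n}"
    unfolding D_def[abs_def] using independent_increments[of u "Suc n"] u0 smono by simp
  have Dm[measurable]: "D i \<in> borel_measurable M" for i
    unfolding D_def[abs_def] using strict_mono_leD[OF smono, of 0 i] strict_mono_leD[OF smono, of 0 "Suc i"] u0
    by (intro borel_measurable_diff random_variable_B) auto
  have ind2: "indep_var (PiM {..<n} (\<lambda>_. borel)) (\<lambda>\<omega>. restrict (\<lambda>i. D i \<omega>) {..<n})
     (PiM {n} (\<lambda>_. borel)) (\<lambda>\<omega>. restrict (\<lambda>i. D i \<omega>) {n})"
    by (intro indep_var_restrict[OF ind]) auto
  define S where "S = {f \<in> space (PiM {..<n} (\<lambda>_. borel::real measure)). \<forall>k\<in>{k. k \<le> n \<and> u k \<in> J}. (\<Sum>i<k. f i) \<in> E (u k)}"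
  define R where "R = {f \<in> space (PiM {n} (\<lambda>_. borel::real measure)). f n \<in> C}"
  have S: "S \<in> sets (PiM {..<n} (\<lambda>_. borel))"
  proof -
    have *: "{f \<in> space (PiM {..<n} (\<lambda>_. borel::real measure)). (\<Sum>i<k. f i) \<in> E (u k)} \<in> sets (PiM {..<n} (\<lambda>_. borel))"
      if "k \<le> n" for k
    proof (rule sets_Collect_preimage[OF _ E])
      show "(\<lambda>f. \<Sum>i<k. f i) \<in> borel_measurable (PiM {..<n} (\<lambda>_. borel::real measure))"
        using that by (intro borel_measurable_sum measurable_component_singleton) auto
    qed
    have "S = (\<Inter>k\<in>{..n}. {f \<in> space (PiM {..<n} (\<lambda>_. borel::real measure)). u k \<in> J \<longrightarrow> (\<Sum>i<k. f i) \<in> E (u k)})"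
      by (auto simp: S_def)
    also have "\<dots> \<in> sets (PiM {..<n} (\<lambda>_. borel))"
    proof (intro sets.finite_INT)
      fix k assume "k \<in> {..n}"
      then show "{f \<in> space (PiM {..<n} (\<lambda>_. borel::real measure)). u k \<in> J \<longrightarrow> (\<Sum>i<k. f i) \<in> E (u k)} \<in> sets (PiM {..<n} (\<lambda>_. borel))"
        using * by (cases "u k \<in> J") auto
    qed auto
    finally show ?thesis .
  qed
  have R: "R \<in> sets (PiM {n} (\<lambda>_. borel))"
    unfolding R_def
  proof (rule sets_Collect_preimage[OF _ C])
    show "(\<lambda>f. f n) \<in> borel_measurable (PiM {n} (\<lambda>_. borel::real measure))"
      by (intro measurable_component_singleton) auto
  qed
  have meas[measurable]: "B r \<in> borel_measurable M" if "0 \<le> r" for r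
    using random_variable_B that by auto
  \<comment> \<open>The increments up to u k sum to B (u k) only where B 0 = 0, hence almost
    everywhere.\<close>
  have E1: "AE \<omega> in M. (\<forall>r\<in>J. B r \<omega> \<in> E r) \<longleftrightarrow> restrict (\<lambda>i. D i \<omega>) {..<n} \<in> S"
    using B_0
  proof eventually_elim
    fix \<omega> assume 0: "B 0 \<omega> = 0"
    have sum: "(\<Sum>i<k. D i \<omega>) = B (u k) \<omega>" for k
      unfolding D_def by (subst sum_lessThan_telescope) (simp add: u0 0)
    have "restrict (\<lambda>i. D i \<omega>) {..<n} \<in> S \<longleftrightarrow> (\<forall>k\<in>{k. k \<le> n \<and> u k \<in> J}. (\<Sum>i<k. restrict (\<lambda>i. D i \<omega>) {..<n} i) \<in> E (u k))"
      unfolding S_def by (simp add: space_PiM)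
    also have "\<dots> \<longleftrightarrow> (\<forall>k\<in>{k. k \<le> n \<and> u k \<in> J}. B (u k) \<omega> \<in> E (u k))"
    proof (intro ball_cong refl)
      fix k assume "k \<in> {k. k \<le> n \<and> u k \<in> J}"
      then have "(\<Sum>i<k. restrict (\<lambda>i. D i \<omega>) {..<n} i) = (\<Sum>i<k. D i \<omega>)"
        by (intro sum.cong) auto
      then show "((\<Sum>i<k. restrict (\<lambda>i. D i \<omega>) {..<n} i) \<in> E (u k)) = (B (u k) \<omega> \<in> E (u k))"
        by (simp add: sum)
    qed
    also have "\<dots> \<longleftrightarrow> (\<forall>r\<in>J. B r \<omega> \<in> E r)"
    proof -
      have "r \<in> u ` {k. k \<le> n \<and> u k \<in> J}" if "r \<in> J" for r
        using u_onto[of r] that xs(1) by auto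
      then show ?thesis by blast
    qed
    finally show "(\<forall>r\<in>J. B r \<omega> \<in> E r) \<longleftrightarrow> restrict (\<lambda>i. D i \<omega>) {..<n} \<in> S" by simp
  qed
  have R_iff: "restrict (\<lambda>i. D i \<omega>) {n} \<in> R \<longleftrightarrow> B b \<omega> - B a \<omega> \<in> C" for \<omega>
    by (simp add: R_def space_PiM D_def un)
  have EJ[measurable]: "{\<omega>\<in>space M. \<forall>r\<in>J. B r \<omega> \<in> E r} \<in> events"
  proof -
    have "{\<omega>\<in>space M. B r \<omega> \<in> E r} \<in> events" if "r \<in> J" for r
      using that J(2) by (intro sets_Collect_preimage[OF meas E]) auto
    then show ?thesis using J(1) by (intro sets.sets_Collect_finite_All) auto
  qed
  have EC[measurable]: "{\<omega>\<in>space M. B b \<omega> - B a \<omega> \<in> C} \<in> events"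
    using assms(1,2) by (intro sets_Collect_preimage[OF _ C] borel_measurable_diff meas) auto
  have DS[measurable]: "(\<lambda>\<omega>. restrict (\<lambda>i. D i \<omega>) A) \<in> measurable M (PiM A (\<lambda>_. borel))" for A
    by (intro measurable_restrict Dm)
  have "prob ({\<omega>\<in>space M. \<forall>r\<in>J. B r \<omega> \<in> E r} \<inter> {\<omega>\<in>space M. B b \<omega> - B a \<omega> \<in> C})
    = prob ((\<lambda>\<omega>. (restrict (\<lambda>i. D i \<omega>) {..<n}, restrict (\<lambda>i. D i \<omega>) {n})) -` (S \<times> R) \<inter> space M)"
  proof (rule measure_eq_AE)
    show "(\<lambda>\<omega>. (restrict (\<lambda>i. D i \<omega>) {..<n}, restrict (\<lambda>i. D i \<omega>) {n})) -` (S \<times> R) \<inter> space M \<in> events"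
      using S R by (intro measurable_sets[OF measurable_Pair[OF DS DS]]) auto
    show "AE \<omega> in M. (\<omega> \<in> {\<omega>\<in>space M. \<forall>r\<in>J. B r \<omega> \<in> E r} \<inter> {\<omega>\<in>space M. B b \<omega> - B a \<omega> \<in> C}) =
      (\<omega> \<in> (\<lambda>\<omega>. (restrict (\<lambda>i. D i \<omega>) {..<n}, restrict (\<lambda>i. D i \<omega>) {n})) -` (S \<times> R) \<inter> space M)"
      using E1 by eventually_elim (simp only: mem_Collect_eq Int_iff vimage_eq mem_Times_iff fst_conv snd_conv R_iff, blast)
  qed simp
  also have "\<dots> = prob ((\<lambda>\<omega>. restrict (\<lambda>i. D i \<omega>) {..<n}) -` S \<inter> space M) * prob ((\<lambda>\<omega>. restrict (\<lambda>i. D i \<omega>) {n}) -` R \<inter> space M)"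
    by (rule indep_varD[OF ind2 S R])
  also have "(\<lambda>\<omega>. restrict (\<lambda>i. D i \<omega>) {n}) -` R \<inter> space M = {\<omega>\<in>space M. B b \<omega> - B a \<omega> \<in> C}"
    unfolding vimage_def R_iff by blast
  also have "prob ((\<lambda>\<omega>. restrict (\<lambda>i. D i \<omega>) {..<n}) -` S \<inter> space M) = prob {\<omega>\<in>space M. \<forall>r\<in>J. B r \<omega> \<in> E r}"
  proof (rule measure_eq_AE)
    show "(\<lambda>\<omega>. restrict (\<lambda>i. D i \<omega>) {..<n}) -` S \<inter> space M \<in> events"
      using S by (intro measurable_sets[OF DS]) auto
    show "AE \<omega> in M. (\<omega> \<in> (\<lambda>\<omega>. restrict (\<lambda>i. D i \<omega>) {..<n}) -` S \<inter> space M) = (\<omega> \<in> {\<omega>\<in>space M. \<forall>r\<in>J. B r \<omega> \<in> E r})"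
      using E1 by eventually_elim (simp only: mem_Collect_eq Int_iff vimage_eq, blast)
  qed simp
  finally show ?thesis .
qed

section \<open>Euler sums and the past\<close>

text \<open>Each of the m steps has length S / m and local error at most (e / S) (S / m) = e / m, so
  the error stays below e at every grid index at once. Uniformity in i is what later allows a random
  index.\<close>

lemma uniform_limit_of_local_increments:
  fixes \<Psi> :: "real \<Rightarrow> real" and D :: "real \<Rightarrow> real \<Rightarrow> real"
  assumes S: "0 < S" and e: "0 < e"
    and local: "\<And>\<eta>. 0 < \<eta> \<Longrightarrow> \<exists>d>0. \<forall>u\<in>{0..S}. \<forall>v\<in>{0..S}. u \<le> v \<and> v - u < d \<longrightarrow>
      \<bar>\<Psi> v - \<Psi> u - D u v\<bar> \<le> \<eta> * (v - u)"
  shows "\<forall>\<^sub>F m in sequentially. \<forall>i\<le>m. \<bar>\<Psi> (real i * S / real m) -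
     (\<Psi> 0 + (\<Sum>k<i. D (real k * S / real m) (real (Suc k) * S / real m)))\<bar> \<le> e"
proof -
  obtain d where d: "0 < d" "\<And>u v. u \<in> {0..S} \<Longrightarrow> v \<in> {0..S} \<Longrightarrow> u \<le> v \<Longrightarrow> v - u < d \<Longrightarrow>
      \<bar>\<Psi> v - \<Psi> u - D u v\<bar> \<le> e / S * (v - u)"
    using local[of "e / S"] S e by auto
  have "\<forall>\<^sub>F m in sequentially. S / real m < d"
    using d(1) by (intro order_tendstoD(2)[OF lim_const_over_n])
  with eventually_gt_at_top[of 0] show ?thesis
  proof eventually_elim
    fix m :: nat assume m: "0 < m" "S / real m < d"
    define r where "r k = real k * S / real m" for k
    have r_Suc: "r (Suc k) = r k + S / real m" for k
      by (simp add: r_def field_simps add_divide_distrib)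
    have Sm: "0 < S / real m" using S m(1) by simp
    have r_in: "r k \<in> {0..S}" if "k \<le> m" for k
      using that S m(1) mult_right_mono[of "real k" "real m" S] by (auto simp: r_def pos_divide_le_eq mult.commute)
    have "\<bar>\<Psi> (r i) - (\<Psi> 0 + (\<Sum>k<i. D (r k) (r (Suc k))))\<bar> \<le> real i * (e / real m)" if "i \<le> m" for i
      using that
    proof (induction i)
      case 0
      show ?case by (simp add: r_def)
    next
      case (Suc i)
      have "\<bar>\<Psi> (r (Suc i)) - \<Psi> (r i) - D (r i) (r (Suc i))\<bar> \<le> e / S * (r (Suc i) - r i)"
        using Suc.prems m(2) Sm r_Suc[of i] by (intro d r_in) auto
      also have "\<dots> = e / real m" using S by (simp add: r_Suc)
      finally show ?case
        using Suc unfolding sum.lessThan_Suc of_nat_Suc distrib_right by linarith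
    qed
    moreover have "real i * (e / real m) \<le> e" if "i \<le> m" for i
      using that m(1) e mult_right_mono[of "real i" "real m" e] by (simp add: pos_divide_le_eq mult.commute)
    ultimately show "\<forall>i\<le>m. \<bar>\<Psi> (real i * S / real m) -
       (\<Psi> 0 + (\<Sum>k<i. D (real k * S / real m) (real (Suc k) * S / real m)))\<bar> \<le> e"
      unfolding r_def by (meson order_trans)
  qed
qed

text \<open>The local error of g u (v - u) comes from the mean value inequality and the uniform
  continuity of g. It will be applied to the quadratic variation, with g the squared
  coefficient.\<close>

lemma riemann_sum_uniform_limit:
  fixes V g :: "real \<Rightarrow> real"
  assumes S: "0 < S" and e: "0 < e"
    and V': "\<And>u. u \<in> {0..S} \<Longrightarrow> (V has_real_derivative g u) (at u within {0..S})"
    and g: "continuous_on {0..S} g"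
  shows "\<forall>\<^sub>F m in sequentially. \<forall>i\<le>m. \<bar>V (real i * S / real m) -
     (V 0 + (\<Sum>k<i. g (real k * S / real m) * (real (Suc k) * S / real m - real k * S / real m)))\<bar> \<le> e"
proof (rule uniform_limit_of_local_increments[where D="\<lambda>u v. g u * (v - u)", OF S e])
  fix \<eta> :: real assume \<eta>: "0 < \<eta>"
  have "uniformly_continuous_on {0..S} g"
    using g by (intro compact_uniformly_continuous) auto
  then obtain d where d: "0 < d" "\<And>u w. u \<in> {0..S} \<Longrightarrow> w \<in> {0..S} \<Longrightarrow> \<bar>u - w\<bar> < d \<Longrightarrow> \<bar>g u - g w\<bar> < \<eta>"
    unfolding uniformly_continuous_on_def dist_real_def using \<eta> by metis
  have "\<bar>V v - V u - g u * (v - u)\<bar> \<le> \<eta> * (v - u)" if uv: "u \<in> {0..S}" "v \<in> {0..S}" "u \<le> v" "v - u < d" for u v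
  proof -
    have sub: "{u..v} \<subseteq> {0..S}" using uv by auto
    have "norm ((V v - g u * v) - (V u - g u * u)) \<le> \<eta> * norm (v - u)"
    proof (rule field_differentiable_bound[OF convex_real_interval(5)])
      fix z assume z: "z \<in> {u..v}"
      show "((\<lambda>z. V z - g u * z) has_real_derivative g z - g u) (at z within {u..v})"
        using subsetD[OF sub z] by (auto intro!: derivative_eq_intros DERIV_subset[OF V' sub])
      show "norm (g z - g u) \<le> \<eta>"
        using d(2)[of z u] subsetD[OF sub z] z uv by simp
    qed (use uv in auto)
    then show ?thesis using uv by (simp add: algebra_simps)
  qed
  then show "\<exists>d>0. \<forall>u\<in>{0..S}. \<forall>v\<in>{0..S}. u \<le> v \<and> v - u < d \<longrightarrow> \<bar>V v - V u - g u * (v - u)\<bar> \<le> \<eta> * (v - u)"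
    using d(1) by blast
qed

text \<open>An integration by parts against a rough path \<open>f - h\<close>: only \<open>c\<close> and \<open>h\<close> are differentiable, and their
  derivatives are such that \<open>c f\<close> has differential \<open>c d(f - h)\<close>.\<close>

lemma stieltjes_sum_uniform_limit:
  fixes c f h :: "real \<Rightarrow> real"
  assumes S: "0 < S" and e: "0 < e"
    and c': "\<And>u. u \<in> {0..S} \<Longrightarrow> (c has_real_derivative j * (c u)\<^sup>2) (at u within {0..S})"
    and h': "\<And>u. u \<in> {0..S} \<Longrightarrow> (h has_real_derivative - (j * c u * f u)) (at u within {0..S})"
    and f: "continuous_on {0..S} f"
  shows "\<forall>\<^sub>F m in sequentially. \<forall>i\<le>m. \<bar>c (real i * S / real m) * f (real i * S / real m) -
     (c 0 * f 0 + (\<Sum>k<i. c (real k * S / real m) * ((f (real (Suc k) * S / real m) - h (real (Suc k) * S / real m)) -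
       (f (real k * S / real m) - h (real k * S / real m)))))\<bar> \<le> e"
proof (rule uniform_limit_of_local_increments[where \<Psi>="\<lambda>u. c u * f u" and
    D="\<lambda>u v. c u * ((f v - h v) - (f u - h u))", OF S e])
  have cc: "continuous_on {0..S} c"
    unfolding continuous_on_eq_continuous_within by (intro ballI DERIV_continuous[OF c'])
  obtain Kf where Kf: "\<And>u. u \<in> {0..S} \<Longrightarrow> \<bar>f u\<bar> \<le> Kf"
    using compact_imp_bounded[OF compact_continuous_image[OF f compact_Icc]] unfolding bounded_iff real_norm_def by (meson imageI)
  obtain Kc where Kc: "\<And>u. u \<in> {0..S} \<Longrightarrow> \<bar>c u\<bar> \<le> Kc"
    using compact_imp_bounded[OF compact_continuous_image[OF cc compact_Icc]] unfolding bounded_iff real_norm_def by (meson imageI)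
  have K0: "0 \<le> Kf" "0 \<le> Kc"
    using Kf[of 0] Kc[of 0] S by auto
  fix \<epsilon> :: real assume \<epsilon>: "0 < \<epsilon>"
  \<comment> \<open>The derivative estimated below is at most |j| Kc (Kf + Kc) \<eta>; the summand 1
    makes division by L legitimate when j = 0.\<close>
  define L where "L = \<bar>j\<bar> * Kc * (Kf + Kc) + 1"
  define \<eta> where "\<eta> = \<epsilon> / L"
  have L: "0 < L" using K0 by (auto simp: L_def intro!: add_nonneg_pos mult_nonneg_nonneg)
  then have \<eta>: "0 < \<eta>" using \<epsilon> by (simp add: \<eta>_def)
  have "uniformly_continuous_on {0..S} f" "uniformly_continuous_on {0..S} c"
    using f cc by (auto intro: compact_uniformly_continuous)
  then obtain d1 d2 where d: "0 < d1" "0 < d2"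
    "\<And>u w. u \<in> {0..S} \<Longrightarrow> w \<in> {0..S} \<Longrightarrow> \<bar>u - w\<bar> < d1 \<Longrightarrow> \<bar>f u - f w\<bar> < \<eta>"
    "\<And>u w. u \<in> {0..S} \<Longrightarrow> w \<in> {0..S} \<Longrightarrow> \<bar>u - w\<bar> < d2 \<Longrightarrow> \<bar>c u - c w\<bar> < \<eta>"
    unfolding uniformly_continuous_on_def dist_real_def using \<eta> by metis
  have "\<bar>c v * f v - c u * f u - c u * ((f v - h v) - (f u - h u))\<bar> \<le> \<epsilon> * (v - u)"
    if uv: "u \<in> {0..S}" "v \<in> {0..S}" "u \<le> v" "v - u < min d1 d2" for u v
  proof -
    have sub: "{u..v} \<subseteq> {0..S}" using uv by auto
    have "norm ((c v * f v + c u * h v) - (c u * f v + c u * h u)) \<le> \<epsilon> * norm (v - u)"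
    proof (rule field_differentiable_bound[OF convex_real_interval(5)])
      fix z assume z: "z \<in> {u..v}"
      have zS: "z \<in> {0..S}" using subsetD[OF sub z] .
      show "((\<lambda>z. c z * f v + c u * h z) has_real_derivative j * c z * (c z * f v - c u * f z)) (at z within {u..v})"
        using zS by (auto intro!: derivative_eq_intros DERIV_subset[OF c' sub] DERIV_subset[OF h' sub]
            simp: algebra_simps power2_eq_square)
      have "c z * f v - c u * f z = (c z - c u) * f v + c u * (f v - f z)"
        by (simp add: algebra_simps)
      also have "\<bar>\<dots>\<bar> \<le> \<eta> * Kf + Kc * \<eta>"
      proof (rule order_trans[OF abs_triangle_ineq], unfold abs_mult, intro add_mono mult_mono)
        show "\<bar>c z - c u\<bar> \<le> \<eta>" using d(4)[OF zS uv(1)] z uv by simp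
        show "\<bar>f v - f z\<bar> \<le> \<eta>" using d(3)[OF uv(2) zS] z uv by simp
      qed (use Kf Kc uv \<eta> K0 in auto)
      finally have "\<bar>c z * f v - c u * f z\<bar> \<le> (Kf + Kc) * \<eta>"
        by (simp add: algebra_simps)
      then have "\<bar>j\<bar> * \<bar>c z\<bar> * \<bar>c z * f v - c u * f z\<bar> \<le> \<bar>j\<bar> * Kc * ((Kf + Kc) * \<eta>)"
        using Kc[OF zS] K0 by (intro mult_mono) auto
      also have "\<dots> \<le> L * \<eta>" using \<eta> by (simp add: L_def algebra_simps)
      also have "\<dots> = \<epsilon>" using L by (simp add: \<eta>_def)
      finally show "norm (j * c z * (c z * f v - c u * f z)) \<le> \<epsilon>" by (simp add: abs_mult)
    qed (use uv in auto)
    then show ?thesis using uv by (simp add: algebra_simps)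
  qed
  then show "\<exists>d>0. \<forall>u\<in>{0..S}. \<forall>v\<in>{0..S}. u \<le> v \<and> v - u < d \<longrightarrow>
      \<bar>c v * f v - c u * f u - c u * ((f v - h v) - (f u - h u))\<bar> \<le> \<epsilon> * (v - u)"
    using d(1,2) by (intro exI[of _ "min d1 d2"]) auto
qed

lemma measurable_finer_sigma:
  "f \<in> measurable N K \<Longrightarrow> sets N \<subseteq> sets M \<Longrightarrow> space N = space M \<Longrightarrow> f \<in> measurable M K"
  unfolding measurable_def by auto

section \<open>The past of the hidden variable and the noise, and discrete exponential
  martingales\<close>

context embedded_problem
begin

text \<open>Generated by cylinder events over finitely many times rather than by the single maps,
  because these events are closed under intersection and a product formula on them extends to the
  whole sigma-algebra. The time a is absolute.\<close>

definition past :: "real \<Rightarrow> 'a measure" where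
  "past a = sigma (space M) {{\<omega>\<in>space M. \<theta> \<omega> \<in> A \<and> (\<forall>r\<in>J. B r \<omega> \<in> D r)} | A J D.
     A \<in> sets borel \<and> finite J \<and> J \<subseteq> {0..a} \<and> (\<forall>r. D r \<in> sets borel)}"

lemma space_past[simp]: "space (past a) = space M"
  unfolding past_def by (rule space_measure_of) auto

lemma sets_past: "sets (past a) = sigma_sets (space M) {{\<omega>\<in>space M. \<theta> \<omega> \<in> A \<and> (\<forall>r\<in>J. B r \<omega> \<in> D r)} | A J D.
     A \<in> sets borel \<and> finite J \<and> J \<subseteq> {0..a} \<and> (\<forall>r. D r \<in> sets borel)}"
  unfolding past_def by (rule sets_measure_of) auto

lemma in_sets_past:
  assumes "A \<in> sets borel" "finite J" "J \<subseteq> {0..a}" "\<And>r. D r \<in> sets borel"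
  shows "{\<omega>\<in>space M. \<theta> \<omega> \<in> A \<and> (\<forall>r\<in>J. B r \<omega> \<in> D r)} \<in> sets (past a)"
  unfolding sets_past using assms by (intro sigma_sets.Basic) blast

lemma theta_past: "\<theta> \<in> borel_measurable (past a)"
proof (rule measurableI)
  fix A :: "real set" assume "A \<in> sets borel"
  then have "{\<omega>\<in>space M. \<theta> \<omega> \<in> A \<and> (\<forall>r\<in>{}. B r \<omega> \<in> UNIV)} \<in> sets (past a)"
    by (intro in_sets_past) auto
  then show "\<theta> -` A \<inter> space (past a) \<in> sets (past a)"
    by (simp add: vimage_def Int_def conj_commute)
qed simp

lemma B_past:
  assumes "0 \<le> r" "r \<le> a"
  shows "B r \<in> borel_measurable (past a)"
proof (rule measurableI)
  fix A :: "real set" assume "A \<in> sets borel"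
  then have "{\<omega>\<in>space M. \<theta> \<omega> \<in> UNIV \<and> (\<forall>r\<in>{r}. B r \<omega> \<in> A)} \<in> sets (past a)"
    using assms by (intro in_sets_past) auto
  then show "B r -` A \<inter> space (past a) \<in> sets (past a)"
    by (simp add: vimage_def Int_def conj_commute)
qed simp

lemma sets_past_mono:
  assumes "a \<le> b"
  shows "sets (past a) \<subseteq> sets (past b)"
  unfolding sets_past[of a]
proof (rule sets.sigma_sets_subset'[where M="past b"], rule subsetI)
  fix P assume "P \<in> {{\<omega>\<in>space M. \<theta> \<omega> \<in> A \<and> (\<forall>r\<in>J. B r \<omega> \<in> D r)} | A J D.
     A \<in> sets borel \<and> finite J \<and> J \<subseteq> {0..a} \<and> (\<forall>r. D r \<in> sets borel)}"
  then obtain A J D where P: "P = {\<omega>\<in>space M. \<theta> \<omega> \<in> A \<and> (\<forall>r\<in>J. B r \<omega> \<in> D r)}"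
    and *: "A \<in> sets borel" "finite J" "J \<subseteq> {0..a}" "\<And>r. D r \<in> sets borel"
    by blast
  have "J \<subseteq> {0..b}" using *(3) assms by (auto simp: subset_eq)
  with * show "P \<in> sets (past b)" unfolding P by (intro in_sets_past)
next
  show "space M \<in> sets (past b)" using sets.top[of "past b"] by simp
qed

lemma past_event: "{\<omega>\<in>space M. \<theta> \<omega> \<in> A \<and> (\<forall>r\<in>J. B r \<omega> \<in> D r)} \<in> events"
  if "A \<in> sets borel" "finite J" "J \<subseteq> {0..a}" "\<And>r. D r \<in> sets borel"
proof -
  have "{\<omega>\<in>space M. \<theta> \<omega> \<in> A} \<in> events"
    using that random_variable_theta by (intro sets_Collect_preimage[where N=borel])
  moreover have "{\<omega>\<in>space M. \<forall>r\<in>J. B r \<omega> \<in> D r} \<in> events"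
    using that random_variable_B
    by (intro sets.sets_Collect_finite_All sets_Collect_preimage[where N=borel]) auto
  ultimately show ?thesis by (intro sets.sets_Collect_conj)
qed

lemma sets_past_subset: "sets (past a) \<subseteq> events"
  unfolding sets_past by (rule sets.sigma_sets_subset) (auto intro: past_event)

lemma measurable_past_M: "u \<in> measurable (past a) N \<Longrightarrow> u \<in> measurable M N"
  by (erule measurable_finer_sigma) (simp_all add: sets_past_subset)

lemma measurable_past_mono: "u \<in> measurable (past a) N \<Longrightarrow> a \<le> b \<Longrightarrow> u \<in> measurable (past b) N"
  by (erule measurable_finer_sigma) (simp_all add: sets_past_mono)

text \<open>A pi-system argument. On a generating event the hidden variable splits off first, being
  independent of the whole noise path, and the finite past of the noise splits off by independence
  of increments.\<close>

lemma indep_past_increment: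
  assumes u: "u \<in> borel_measurable (past a)" and "0 \<le> a" "a < b"
  shows "indep_var borel u borel (\<lambda>\<omega>. B b \<omega> - B a \<omega>)"
proof -
  let ?Q = "{{\<omega>\<in>space M. \<theta> \<omega> \<in> A \<and> (\<forall>r\<in>J. B r \<omega> \<in> D r)} | A J D.
     A \<in> sets borel \<and> finite J \<and> J \<subseteq> {0..a} \<and> (\<forall>r. D r \<in> sets borel)}"
  let ?R = "{(\<lambda>\<omega>. B b \<omega> - B a \<omega>) -` C \<inter> space M | C. C \<in> sets borel}"
  define V where "V = vimage_algebra (space M) (\<lambda>\<omega>. \<lambda>u\<in>{0..}. B u \<omega>) (PiM {0..} (\<lambda>_. borel :: real measure))"
  have sV: "space V = space M" by (simp add: V_def)
  have path: "(\<lambda>\<omega>. \<lambda>u\<in>{0..}. B u \<omega>) \<in> measurable V (PiM {0..} (\<lambda>_. borel))"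
    unfolding V_def by (rule measurable_vimage_algebra1) (auto simp: space_PiM)
  have BV: "B r \<in> borel_measurable V" if "0 \<le> r" for r
  proof -
    have "(\<lambda>\<omega>. (\<lambda>u\<in>{0..}. B u \<omega>) r) \<in> borel_measurable V"
      using that by (intro measurable_compose[OF path] measurable_component_singleton) simp
    then show ?thesis using that by simp
  qed
  have Bm: "(\<lambda>\<omega>. B b \<omega> - B a \<omega>) \<in> borel_measurable M"
    using assms by (intro borel_measurable_diff random_variable_B) auto
  have "indep_set ?Q ?R"
  proof (rule indep_setI)
    show "?Q \<subseteq> events" using past_event by blast
    show "?R \<subseteq> events" using measurable_sets[OF Bm] by auto
    fix P R assume "P \<in> ?Q" "R \<in> ?R"
    then obtain A J D C where P: "P = {\<omega>\<in>space M. \<theta> \<omega> \<in> A \<and> (\<forall>r\<in>J. B r \<omega> \<in> D r)}"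
      and R: "R = (\<lambda>\<omega>. B b \<omega> - B a \<omega>) -` C \<inter> space M"
      and *: "A \<in> sets borel" "finite J" "J \<subseteq> {0..a}" "\<And>r. D r \<in> sets borel" "C \<in> sets borel"
      by blast
    define \<Theta> E F where "\<Theta> = {\<omega>\<in>space M. \<theta> \<omega> \<in> A}" and "E = {\<omega>\<in>space M. \<forall>r\<in>J. B r \<omega> \<in> D r}"
      and "F = {\<omega>\<in>space M. B b \<omega> - B a \<omega> \<in> C}"
    have \<Theta>: "\<Theta> \<in> sets (vimage_algebra (space M) \<theta> borel)"
      unfolding \<Theta>_def sets_vimage_algebra using * by (auto intro!: sigma_sets.Basic)
    have E: "E \<in> sets V"
      unfolding E_def sV[symmetric] using * BV
      by (intro sets.sets_Collect_finite_All sets_Collect_preimage[where N=borel]) auto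
    have F: "F \<in> sets V"
      unfolding F_def sV[symmetric] using assms *(5)
      by (intro sets_Collect_preimage[where N=borel] borel_measurable_diff BV) auto
    have ind: "prob (\<Theta> \<inter> G) = prob \<Theta> * prob G" if "G \<in> sets V" for G
      using indep_setD[OF theta_indep_B \<Theta>] that unfolding V_def by blast
    have "prob (P \<inter> R) = prob (\<Theta> \<inter> (E \<inter> F))"
      unfolding P R \<Theta>_def E_def F_def by (rule arg_cong[where f=prob]) auto
    also have "\<dots> = prob \<Theta> * prob (E \<inter> F)"
      by (intro ind sets.Int E F)
    also have "prob (E \<inter> F) = prob E * prob F"
      unfolding E_def F_def using assms * by (intro finite_past_indep_increment) auto
    also have "prob \<Theta> * (prob E * prob F) = prob (\<Theta> \<inter> E) * prob F"
      using ind[OF E] by simp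
    also have "\<Theta> \<inter> E = P" unfolding P \<Theta>_def E_def by auto
    also have "F = R" unfolding R F_def by auto
    finally show "prob (P \<inter> R) = prob P * prob R" .
  qed
  moreover have "Int_stable ?Q"
  proof (rule Int_stableI)
    fix P P' assume "P \<in> ?Q" "P' \<in> ?Q"
    then obtain A J D A' J' D' where P: "P = {\<omega>\<in>space M. \<theta> \<omega> \<in> A \<and> (\<forall>r\<in>J. B r \<omega> \<in> D r)}"
      and P': "P' = {\<omega>\<in>space M. \<theta> \<omega> \<in> A' \<and> (\<forall>r\<in>J'. B r \<omega> \<in> D' r)}"
      and *: "A \<in> sets borel" "finite J" "J \<subseteq> {0..a}" "\<And>r. D r \<in> sets borel"
        "A' \<in> sets borel" "finite J'" "J' \<subseteq> {0..a}" "\<And>r. D' r \<in> sets borel"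
      by blast
    \<comment> \<open>A time that only one of the two cylinders constrains is padded with
      \<open>UNIV\<close>, so the intersection is again one cylinder, over J \<union> J'.\<close>
    define D'' where "D'' r = (if r \<in> J then D r else UNIV) \<inter> (if r \<in> J' then D' r else UNIV)" for r
    have D'': "D'' r \<in> sets borel" for r using *(4,8) by (auto simp: D''_def)
    have "P \<inter> P' = {\<omega>\<in>space M. \<theta> \<omega> \<in> A \<inter> A' \<and> (\<forall>r\<in>J \<union> J'. B r \<omega> \<in> D'' r)}"
      unfolding P P' D''_def by auto
    moreover have "A \<inter> A' \<in> sets borel" "finite (J \<union> J')" "J \<union> J' \<subseteq> {0..a}" "\<forall>r. D'' r \<in> sets borel"
      using * D'' by simp_all
    ultimately show "P \<inter> P' \<in> ?Q" by blast
  qed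
  moreover have "Int_stable ?R"
  proof (rule Int_stableI)
    fix P P' assume "P \<in> ?R" "P' \<in> ?R"
    then obtain C C' where "P = (\<lambda>\<omega>. B b \<omega> - B a \<omega>) -` C \<inter> space M" "P' = (\<lambda>\<omega>. B b \<omega> - B a \<omega>) -` C' \<inter> space M"
      "C \<in> sets borel" "C' \<in> sets borel" by blast
    then show "P \<inter> P' \<in> ?R"
      by (intro CollectI exI[of _ "C \<inter> C'"]) auto
  qed
  ultimately have "indep_set (sets (past a)) (sigma_sets (space M) ?R)"
    unfolding sets_past by (rule indep_set_sigma_sets)
  moreover have "sigma_sets (space M) {u -` A \<inter> space M |A. A \<in> sets borel} \<subseteq> sets (past a)"
  proof (rule sets.sigma_sets_subset'[where M="past a"])
    show "{u -` A \<inter> space M |A. A \<in> sets borel} \<subseteq> sets (past a)"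
      using measurable_sets[OF u] by auto
    show "space M \<in> sets (past a)" using sets.top[of "past a"] by simp
  qed
  moreover have "u \<in> borel_measurable M"
    by (rule measurable_past_M[OF u])
  ultimately show ?thesis
    unfolding indep_var_eq indep_sets2_eq using Bm by blast
qed

text \<open>A discrete stochastic exponential on \<open>\<theta> = j\<close>. The event G k is meant
  to say that stopping has not occurred by time r k: once it fails, the exponent no longer moves, so
  optional stopping is built into the sum.\<close>

definition exp_transform ::
    "real \<Rightarrow> real \<Rightarrow> (nat \<Rightarrow> 'a set) \<Rightarrow> (nat \<Rightarrow> real) \<Rightarrow> (nat \<Rightarrow> real) \<Rightarrow> nat \<Rightarrow> 'a \<Rightarrow> real" where
  "exp_transform j y G a r n \<omega> = indicator {j} (\<theta> \<omega>) * exp (y + (\<Sum>k<n. indicator (G k) \<omega> *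
      (a k * (B (r (Suc k)) \<omega> - B (r k) \<omega>) - (a k)\<^sup>2 * (r (Suc k) - r k) / 2)))"

text \<open>One step multiplies by exp (a \<Delta>B - a^2 \<Delta>r / 2) on G k and by 1 elsewhere.
  The change is therefore a past-measurable variable times a centred factor independent of the past,
  and the mean is preserved.\<close>

lemma exp_transform_martingale:
  assumes r: "0 \<le> r 0" "\<And>k. k < i \<Longrightarrow> r k < r (Suc k)"
    and G: "\<And>k. k < i \<Longrightarrow> G k \<in> sets (past (r k))"
  shows "exp_transform j y G a r i \<in> borel_measurable (past (r i))"
    and "integrable M (exp_transform j y G a r i)"
    and "(\<integral>\<omega>. exp_transform j y G a r i \<omega> \<partial>M) = \<P>(\<omega> in M. \<theta> \<omega> = j) * exp y"
proof -
  define W where "W = exp_transform j y G a r"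
  have W_def: "W = (\<lambda>n \<omega>. indicator {j} (\<theta> \<omega>) * exp (y + (\<Sum>k<n. indicator (G k) \<omega> *
      (a k * (B (r (Suc k)) \<omega> - B (r k) \<omega>) - (a k)\<^sup>2 * (r (Suc k) - r k) / 2))))"
    by (simp add: W_def exp_transform_def fun_eq_iff)
  have "0 \<le> r i \<and> W i \<in> borel_measurable (past (r i)) \<and> integrable M (W i) \<and>
    (\<integral>\<omega>. W i \<omega> \<partial>M) = \<P>(\<omega> in M. \<theta> \<omega> = j) * exp y"
    using r(2) G
  proof (induction i)
    case 0
    have th[measurable]: "\<theta> \<in> borel_measurable (past (r 0))" "\<theta> \<in> borel_measurable M"
      using theta_past random_variable_theta by auto
    have "W 0 \<in> borel_measurable (past (r 0))"
      unfolding W_def by (simp, measurable)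
    moreover have "integrable M (W 0)"
      unfolding W_def by (simp, intro integrable_const_bound[where B=1]) auto
    moreover have "(\<integral>\<omega>. W 0 \<omega> \<partial>M) = \<P>(\<omega> in M. \<theta> \<omega> = j) * exp y"
    proof -
      have "(\<integral>\<omega>. W 0 \<omega> \<partial>M) = (\<integral>\<omega>. indicator {\<omega>\<in>space M. \<theta> \<omega> = j} \<omega> * exp y \<partial>M)"
        unfolding W_def by (intro Bochner_Integration.integral_cong) (auto simp: indicator_def)
      then show ?thesis by simp
    qed
    ultimately show ?case using r(1) by simp
  next
    case (Suc i)
    have IH: "0 \<le> r i" "W i \<in> borel_measurable (past (r i))" "integrable M (W i)"
      "(\<integral>\<omega>. W i \<omega> \<partial>M) = \<P>(\<omega> in M. \<theta> \<omega> = j) * exp y"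
      using Suc by auto
    have less: "r i < r (Suc i)" and Gi: "G i \<in> sets (past (r i))"
      using Suc.prems by auto
    define U where "U \<omega> = indicator (G i) \<omega> * W i \<omega>" for \<omega>
    define D where "D \<omega> = B (r (Suc i)) \<omega> - B (r i) \<omega>" for \<omega>
    define c where "c = (a i)\<^sup>2 * (r (Suc i) - r i) / 2"
    define Q where "Q \<omega> = exp (a i * D \<omega> - c) - 1" for \<omega>
    have U: "U \<in> borel_measurable (past (r i))"
      unfolding U_def[abs_def] using Gi IH(2) by measurable
    have WSuc: "W (Suc i) \<omega> = W i \<omega> + U \<omega> * Q \<omega>" for \<omega>
    proof -
      have "W (Suc i) \<omega> = W i \<omega> * exp (indicator (G i) \<omega> * (a i * D \<omega> - c))"
        unfolding W_def sum.lessThan_Suc D_def c_def by (simp add: add.assoc[symmetric] exp_add)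
      then show ?thesis by (cases "\<omega> \<in> G i") (simp_all add: U_def Q_def algebra_simps)
    qed
    have "indep_var borel U borel D"
      unfolding D_def[abs_def] by (rule indep_past_increment[OF U IH(1) less])
    then have "indep_var borel (id \<circ> U) borel ((\<lambda>d. exp (a i * d - c) - 1) \<circ> D)"
      by (rule indep_var_compose) auto
    then have ind: "indep_var borel U borel Q"
      by (simp add: comp_def Q_def[abs_def])
    have intU: "integrable M U"
      using measurable_past_M[OF U]
      by (rule Bochner_Integration.integrable_bound[OF IH(3)]) (auto simp: U_def indicator_def)
    have D: "distributed M lborel D (normal_density 0 (sqrt (r (Suc i) - r i)))"
      unfolding D_def[abs_def] by (rule normal_increments[OF IH(1) less])
    have "integrable M (\<lambda>\<omega>. exp (- c) * exp (a i * D \<omega>) - 1)"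
      using normal_exponential_moment(1)[OF D] less by simp
    moreover have "exp (- c) * exp (a i * D \<omega>) - 1 = Q \<omega>" for \<omega>
      by (simp add: Q_def mult_exp_exp)
    ultimately have intQ: "integrable M Q" and Q: "Q = (\<lambda>\<omega>. exp (- c) * exp (a i * D \<omega>) - 1)"
      by (simp_all add: fun_eq_iff)
    have "(\<integral>\<omega>. Q \<omega> \<partial>M) = exp (- c) * exp c - 1"
      unfolding Q using normal_exponential_moment[OF D, of "a i"] less
      by (simp add: c_def prob_space)
    then have EQ: "(\<integral>\<omega>. Q \<omega> \<partial>M) = 0" by (simp add: mult_exp_exp)
    have "W (Suc i) \<in> borel_measurable (past (r (Suc i)))"
    proof -
      have "W i \<in> borel_measurable (past (r (Suc i)))" "U \<in> borel_measurable (past (r (Suc i)))"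
        using measurable_past_mono[OF IH(2)] measurable_past_mono[OF U] less by auto
      moreover have "D \<in> borel_measurable (past (r (Suc i)))"
        unfolding D_def[abs_def] using IH(1) less by (intro borel_measurable_diff B_past) auto
      ultimately show ?thesis
        unfolding WSuc[abs_def] Q_def[abs_def] by measurable
    qed
    moreover have "integrable M (W (Suc i))"
      unfolding WSuc[abs_def] using indep_var_integrable[OF ind intU intQ] IH(3) by simp
    moreover have "(\<integral>\<omega>. W (Suc i) \<omega> \<partial>M) = \<P>(\<omega> in M. \<theta> \<omega> = j) * exp y"
      unfolding WSuc[abs_def] using indep_var_integrable[OF ind intU intQ] IH(3,4)
        indep_var_lebesgue_integral[OF ind intU intQ] EQ by simp
    ultimately show ?case using IH(1) less by simp
  qed
  then show "exp_transform j y G a r i \<in> borel_measurable (past (r i))"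
    and "integrable M (exp_transform j y G a r i)"
    and "(\<integral>\<omega>. exp_transform j y G a r i \<omega> \<partial>M) = \<P>(\<omega> in M. \<theta> \<omega> = j) * exp y"
    by (simp_all add: exp_transform_def[abs_def] W_def)
qed

text \<open>One formula for the integrating factors c of both drifts: it satisfies c' = j
  c^2.\<close>

definition coef :: "real \<Rightarrow> real \<Rightarrow> real" where
  "coef j s = 1 / (1 - j * (t + s))"

text \<open>The left-endpoint sum for c X at the i-th of m grid points on [0, S]. As the integrand
  is deterministic and smooth, it can be handled path by path.\<close>

definition euler_sum :: "real \<Rightarrow> real \<Rightarrow> nat \<Rightarrow> nat \<Rightarrow> 'a \<Rightarrow> real" where
  "euler_sum j S m i \<omega> = coef j 0 * x + (\<Sum>k<i. coef j (real k * S / real m) *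
     (B (t + real (Suc k) * S / real m) \<omega> - B (t + real k * S / real m) \<omega>))"

end

locale embedded_problem_from = embedded_problem +
  assumes t_nonneg: "0 \<le> t" and t_less_1: "t < 1"
begin

lemma coef_denominator_pos: "j \<in> {0, 1} \<Longrightarrow> 0 \<le> s \<Longrightarrow> s < 1 - t \<Longrightarrow> 0 < 1 - j * (t + s)"
  by auto

lemma coef_pos: "j \<in> {0, 1} \<Longrightarrow> 0 \<le> s \<Longrightarrow> s < 1 - t \<Longrightarrow> 0 < coef j s"
  unfolding coef_def using coef_denominator_pos by simp

lemma coef_derivative:
  assumes "j \<in> {0, 1}" "0 \<le> s" "s < 1 - t"
  shows "(coef j has_real_derivative j * (coef j s)\<^sup>2) (at s within A)"
  using coef_denominator_pos[OF assms] unfolding coef_def[abs_def]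
  by (auto intro!: derivative_eq_intros simp: power2_eq_square)

text \<open>Integration by parts with f = X and h = x plus the drift integral, so that f - h is the
  Brownian increment. One null set serves all S and e, and the bound is uniform in i, so the grid
  index may depend on the path.\<close>

lemma euler_sum_converges:
  "AE \<omega> in M. X t \<omega> = x \<and> (\<forall>S e. 0 < S \<longrightarrow> S < 1 - t \<longrightarrow> 0 < e \<longrightarrow>
     (\<forall>\<^sub>F m in sequentially. \<forall>i\<le>m. \<bar>coef (\<theta> \<omega>) (real i * S / real m) * X (t + real i * S / real m) \<omega>
        - euler_sum (\<theta> \<omega>) S m i \<omega>\<bar> \<le> e))"
  using integral_equation AE_space
proof eventually_elim
  fix \<omega> assume eq: "\<forall>s\<in>{0..<1 - t}. X (t + s) \<omega> = x + integral {0..s} (\<lambda>r. - \<theta> \<omega> * X (t + r) \<omega> / (1 - t - r))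
       + (B (t + s) \<omega> - B t \<omega>)" and \<omega>: "\<omega> \<in> space M"
  have th: "\<theta> \<omega> \<in> {0, 1}" using theta_values[OF \<omega>] .
  have X0: "X t \<omega> = x"
    using bspec[OF eq, of 0] t_less_1 by simp
  define f where "f u = X (t + u) \<omega>" for u
  define h where "h u = x + integral {0..u} (\<lambda>r. - \<theta> \<omega> * f r / (1 - t - r))" for u
  have "\<forall>\<^sub>F m in sequentially. \<forall>i\<le>m. \<bar>coef (\<theta> \<omega>) (real i * S / real m) * X (t + real i * S / real m) \<omega>
        - euler_sum (\<theta> \<omega>) S m i \<omega>\<bar> \<le> e" if S: "0 < S" "S < 1 - t" and e: "0 < e" for S e
  proof -
    have f: "continuous_on {0..S} f"
      unfolding f_def using S
      by (intro continuous_on_compose2[OF continuous_paths_X[OF \<omega>]] continuous_intros) auto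
    have drift: "continuous_on {0..S} (\<lambda>r. - \<theta> \<omega> * f r / (1 - t - r))"
      using S f by (intro continuous_intros) auto
    have h': "(h has_real_derivative - (\<theta> \<omega> * coef (\<theta> \<omega>) u * f u)) (at u within {0..S})" if "u \<in> {0..S}" for u
    proof -
      have "- (\<theta> \<omega> * coef (\<theta> \<omega>) u * f u) = - \<theta> \<omega> * f u / (1 - t - u)"
        using th by (auto simp: coef_def algebra_simps)
      moreover have "(h has_real_derivative - \<theta> \<omega> * f u / (1 - t - u)) (at u within {0..S})"
        unfolding h_def[abs_def] using DERIV_add[OF DERIV_const[of x] integral_has_real_derivative[OF drift that]]
        by (simp only: add_0)
      ultimately show ?thesis by simp
    qed
    have B: "f u - h u = B (t + u) \<omega> - B t \<omega>" if "u \<in> {0..S}" for u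
      using bspec[OF eq, of u] that S by (simp add: f_def h_def)
    have "\<forall>\<^sub>F m in sequentially. \<forall>i\<le>m. \<bar>coef (\<theta> \<omega>) (real i * S / real m) * f (real i * S / real m) -
     (coef (\<theta> \<omega>) 0 * f 0 + (\<Sum>k<i. coef (\<theta> \<omega>) (real k * S / real m) * ((f (real (Suc k) * S / real m) - h (real (Suc k) * S / real m)) -
       (f (real k * S / real m) - h (real k * S / real m)))))\<bar> \<le> e"
      using S coef_derivative[OF th] by (intro stieltjes_sum_uniform_limit[OF S(1) e _ h' f]) auto
    with eventually_gt_at_top[of 0] show ?thesis
    proof eventually_elim
      fix m :: nat assume m: "0 < m" and H: "\<forall>i\<le>m. \<bar>coef (\<theta> \<omega>) (real i * S / real m) * f (real i * S / real m) -
     (coef (\<theta> \<omega>) 0 * f 0 + (\<Sum>k<i. coef (\<theta> \<omega>) (real k * S / real m) * ((f (real (Suc k) * S / real m) - h (real (Suc k) * S / real m)) -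
       (f (real k * S / real m) - h (real k * S / real m)))))\<bar> \<le> e"
      show "\<forall>i\<le>m. \<bar>coef (\<theta> \<omega>) (real i * S / real m) * X (t + real i * S / real m) \<omega> - euler_sum (\<theta> \<omega>) S m i \<omega>\<bar> \<le> e"
      proof (intro allI impI)
        fix i assume i: "i \<le> m"
        have in_S: "real k * S / real m \<in> {0..S}" if "k \<le> m" for k
          using that S m mult_right_mono[of "real k" "real m" S] by (auto simp: pos_divide_le_eq mult.commute)
        have "(\<Sum>k<i. coef (\<theta> \<omega>) (real k * S / real m) * ((f (real (Suc k) * S / real m) - h (real (Suc k) * S / real m)) -
       (f (real k * S / real m) - h (real k * S / real m)))) = (\<Sum>k<i. coef (\<theta> \<omega>) (real k * S / real m) *
     (B (t + real (Suc k) * S / real m) \<omega> - B (t + real k * S / real m) \<omega>))"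
        proof (intro sum.cong refl)
          fix k assume "k \<in> {..<i}"
          then have "k \<le> m" "Suc k \<le> m" using i by auto
          then show "coef (\<theta> \<omega>) (real k * S / real m) * ((f (real (Suc k) * S / real m) - h (real (Suc k) * S / real m)) -
       (f (real k * S / real m) - h (real k * S / real m))) = coef (\<theta> \<omega>) (real k * S / real m) *
     (B (t + real (Suc k) * S / real m) \<omega> - B (t + real k * S / real m) \<omega>)"
            using B[OF in_S[of k]] B[OF in_S[of "Suc k"]] by (simp del: of_nat_Suc)
        qed
        then show "\<bar>coef (\<theta> \<omega>) (real i * S / real m) * X (t + real i * S / real m) \<omega> - euler_sum (\<theta> \<omega>) S m i \<omega>\<bar> \<le> e"
          using H[rule_format, OF i] X0 by (simp add: euler_sum_def f_def)
      qed
    qed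
  qed
  with X0 show "X t \<omega> = x \<and> (\<forall>S e. 0 < S \<longrightarrow> S < 1 - t \<longrightarrow> 0 < e \<longrightarrow>
     (\<forall>\<^sub>F m in sequentially. \<forall>i\<le>m. \<bar>coef (\<theta> \<omega>) (real i * S / real m) * X (t + real i * S / real m) \<omega>
        - euler_sum (\<theta> \<omega>) S m i \<omega>\<bar> \<le> e))" by blast
qed

section \<open>Observed events as events of the past, up to null sets\<close>

lemma space_observed_filtration[simp]: "space (observed_filtration M t X s) = space M"
  unfolding observed_filtration_def by (rule space_measure_of) auto

lemma sets_observed_filtration: "sets (observed_filtration M t X s) =
    sigma_sets (space M) {X (t + u) -` A \<inter> space M | u A. 0 \<le> u \<and> u \<le> s \<and> u \<le> 1 - t \<and> A \<in> sets borel}"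
  unfolding observed_filtration_def by (rule sets_measure_of) auto

lemma sets_observed_filtration_subset: "sets (observed_filtration M t X s) \<subseteq> events"
  unfolding sets_observed_filtration
proof (rule sets.sigma_sets_subset, rule subsetI)
  fix P assume "P \<in> {X (t + u) -` A \<inter> space M | u A. 0 \<le> u \<and> u \<le> s \<and> u \<le> 1 - t \<and> A \<in> sets borel}"
  then obtain u A where "P = X (t + u) -` A \<inter> space M" "0 \<le> u" "u \<le> 1 - t" "A \<in> sets borel" by blast
  then show "P \<in> events" using t_nonneg by (auto intro!: measurable_sets[OF random_variable_X])
qed

lemma X_observed:
  assumes "0 \<le> u" "u \<le> s" "u \<le> 1 - t"
  shows "X (t + u) \<in> borel_measurable (observed_filtration M t X s)"
proof (rule measurableI)
  fix A :: "real set" assume "A \<in> sets borel"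
  then show "X (t + u) -` A \<inter> space (observed_filtration M t X s) \<in> sets (observed_filtration M t X s)"
    unfolding sets_observed_filtration space_observed_filtration using assms by (intro sigma_sets.Basic) blast
qed simp

text \<open>Dividing the limit of the Euler sums by the coefficient recovers X almost surely. The
  version Y uses \<open>lim\<close>, which is measurable whether or not the sequence converges on a
  given path.\<close>

lemma X_past_version:
  assumes "0 \<le> u" "u < 1 - t"
  shows "\<exists>Y \<in> borel_measurable (past (t + u)). AE \<omega> in M. X (t + u) \<omega> = Y \<omega>"
proof (cases "u = 0")
  case True
  \<comment> \<open>At u = 0 there is no grid; the starting value serves as the version.\<close>
  have "AE \<omega> in M. X (t + u) \<omega> = (\<lambda>_. x) \<omega>"
    using euler_sum_converges by eventually_elim (simp add: True)
  then show ?thesis by (intro bexI[of _ "\<lambda>_. x"]) auto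
next
  case False
  then have u: "0 < u" using assms by simp
  define Z where "Z m \<omega> = euler_sum (\<theta> \<omega>) u m m \<omega>" for m \<omega>
  define Y where "Y \<omega> = lim (\<lambda>m. Z m \<omega>) / coef (\<theta> \<omega>) u" for \<omega>
  have th[measurable]: "\<theta> \<in> borel_measurable (past (t + u))" by (rule theta_past)
  have Z: "Z m \<in> borel_measurable (past (t + u))" for m
  proof (cases "m = 0")
    case True
    then show ?thesis unfolding Z_def[abs_def] euler_sum_def coef_def by simp
  next
    case False
    have "real k * u / real m \<le> u" if "k \<le> m" for k
      using that u False mult_right_mono[of "real k" "real m" u] by (auto simp: pos_divide_le_eq mult.commute)
    then have "B (t + real k * u / real m) \<in> borel_measurable (past (t + u))" if "k \<le> m" for k
      using t_nonneg u that by (intro B_past) (auto intro!: add_nonneg_nonneg)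
    then show ?thesis
      unfolding Z_def[abs_def] euler_sum_def coef_def
      by (intro borel_measurable_add borel_measurable_sum borel_measurable_times borel_measurable_divide
          borel_measurable_diff borel_measurable_const th) (auto simp del: of_nat_Suc)
  qed
  have "Y \<in> borel_measurable (past (t + u))"
    unfolding Y_def[abs_def] coef_def
    by (intro borel_measurable_divide borel_measurable_lim_metric borel_measurable_diff
        borel_measurable_times borel_measurable_const Z th)
  moreover have "AE \<omega> in M. X (t + u) \<omega> = Y \<omega>"
    using euler_sum_converges AE_space
  proof eventually_elim
    fix \<omega> assume H: "X t \<omega> = x \<and> (\<forall>S e. 0 < S \<longrightarrow> S < 1 - t \<longrightarrow> 0 < e \<longrightarrow>
     (\<forall>\<^sub>F m in sequentially. \<forall>i\<le>m. \<bar>coef (\<theta> \<omega>) (real i * S / real m) * X (t + real i * S / real m) \<omega>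
        - euler_sum (\<theta> \<omega>) S m i \<omega>\<bar> \<le> e))" and \<omega>: "\<omega> \<in> space M"
    have "(\<lambda>m. Z m \<omega>) \<longlonglongrightarrow> coef (\<theta> \<omega>) u * X (t + u) \<omega>"
    proof (rule tendstoI)
      fix e :: real assume e: "0 < e"
      have "\<forall>\<^sub>F m in sequentially. \<forall>i\<le>m. \<bar>coef (\<theta> \<omega>) (real i * u / real m) * X (t + real i * u / real m) \<omega>
        - euler_sum (\<theta> \<omega>) u m i \<omega>\<bar> \<le> e / 2"
        using conjunct2[OF H] u assms(2) half_gt_zero[OF e] by blast
      with eventually_gt_at_top[of 0] show "\<forall>\<^sub>F m in sequentially. dist (Z m \<omega>) (coef (\<theta> \<omega>) u * X (t + u) \<omega>) < e"
      proof eventually_elim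
        case (elim m)
        then have "\<bar>coef (\<theta> \<omega>) u * X (t + u) \<omega> - euler_sum (\<theta> \<omega>) u m m \<omega>\<bar> \<le> e / 2"
          using elim(2)[rule_format, of m] by simp
        then show ?case using e by (simp add: dist_real_def Z_def abs_minus_commute)
      qed
    qed
    moreover have "coef (\<theta> \<omega>) u > 0"
      using coef_pos[OF theta_values[OF \<omega>]] assms by simp
    ultimately show "X (t + u) \<omega> = Y \<omega>"
      unfolding Y_def by (simp add: limI)
  qed
  ultimately show ?thesis by blast
qed

text \<open>The sets that agree almost everywhere with a past event form a sigma-algebra, and it
  contains the generators by the version of X. Countable unions are where the countably many null
  sets must be combined.\<close>

lemma observed_event_past_version:
  assumes s: "0 \<le> s" "s < 1 - t" and A: "A \<in> sets (observed_filtration M t X s)"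
  shows "\<exists>A'\<in>sets (past (t + s)). AE \<omega> in M. \<omega> \<in> A \<longleftrightarrow> \<omega> \<in> A'"
  using A unfolding sets_observed_filtration
proof (induction rule: sigma_sets.induct)
  case (Basic P)
  then obtain u A where P: "P = X (t + u) -` A \<inter> space M" and u: "0 \<le> u" "u \<le> s" and A: "A \<in> sets borel"
    by blast
  obtain Y where Y: "Y \<in> borel_measurable (past (t + u))" "AE \<omega> in M. X (t + u) \<omega> = Y \<omega>"
    using X_past_version[of u] u s by auto
  have "Y -` A \<inter> space M \<in> sets (past (t + s))"
    using measurable_sets[OF measurable_past_mono[OF Y(1), of "t + s"] A] u by simp
  moreover have "AE \<omega> in M. \<omega> \<in> P \<longleftrightarrow> \<omega> \<in> Y -` A \<inter> space M"
    using Y(2) by eventually_elim (simp add: P)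
  ultimately show ?case by blast
next
  case Empty
  then show ?case by (intro bexI[of _ "{}"]) auto
next
  case (Compl P)
  then obtain P' where P': "P' \<in> sets (past (t + s))" "AE \<omega> in M. \<omega> \<in> P \<longleftrightarrow> \<omega> \<in> P'" by blast
  have "space M - P' \<in> sets (past (t + s))"
    using sets.compl_sets[OF P'(1)] by simp
  moreover have "AE \<omega> in M. \<omega> \<in> space M - P \<longleftrightarrow> \<omega> \<in> space M - P'"
    using P'(2) by eventually_elim simp
  ultimately show ?case by blast
next
  case (Union P)
  then obtain P' where P': "\<And>i. P' i \<in> sets (past (t + s))" "\<And>i. AE \<omega> in M. \<omega> \<in> P i \<longleftrightarrow> \<omega> \<in> P' i"
    by metis
  have "(\<Union>i. P' i) \<in> sets (past (t + s))" using P'(1) by blast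
  moreover have "AE \<omega> in M. \<forall>i. \<omega> \<in> P i \<longleftrightarrow> \<omega> \<in> P' i"
    using P'(2) by (simp add: AE_all_countable)
  then have "AE \<omega> in M. \<omega> \<in> (\<Union>i. P i) \<longleftrightarrow> \<omega> \<in> (\<Union>i. P' i)"
    by eventually_elim simp
  ultimately show ?case by blast
qed

end

section \<open>Optional stopping of exponential martingales\<close>

text \<open>Rounds s up to the grid and caps it at the last index. Rounding up is essential: k lies
  below the index exactly when the k-th grid time is before s, which is known at that time if s is a
  stopping time.\<close>

definition grid_index :: "real \<Rightarrow> nat \<Rightarrow> real \<Rightarrow> nat" where
  "grid_index S m s = min m (nat \<lceil>s * real m / S\<rceil>)"

lemma grid_index_le: "grid_index S m s \<le> m"
  by (simp add: grid_index_def)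

lemma less_grid_index:
  assumes "0 < S" "0 < m"
  shows "k < grid_index S m s \<longleftrightarrow> k < m \<and> real k * S / real m < s"
proof -
  have "k < nat \<lceil>s * real m / S\<rceil> \<longleftrightarrow> real k * S / real m < s"
    using assms unfolding zless_nat_conj[symmetric] by (simp add: zless_nat_eq_int_zless less_ceiling_iff field_simps)
  then show ?thesis by (simp add: grid_index_def)
qed

lemma grid_index_close:
  assumes "0 < S" "0 < m" "0 \<le> s"
  shows "\<bar>real (grid_index S m s) * S / real m - min s S\<bar> \<le> S / real m"
proof (cases "nat \<lceil>s * real m / S\<rceil> \<le> m")
  case True
  define n where "n = nat \<lceil>s * real m / S\<rceil>"
  have n: "s * real m / S \<le> real n" "real n \<le> s * real m / S + 1"
    using assms by (auto simp: n_def of_nat_nat)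
  have "s * real m \<le> real n * S"
    using n(1) assms(1) by (simp add: pos_divide_le_eq)
  moreover have "real n * S \<le> s * real m + S"
    using mult_right_mono[OF n(2), of S] assms(1) by (simp add: distrib_right)
  then have "real n * S / real m \<le> (s * real m + S) / real m"
    by (rule divide_right_mono) simp
  ultimately have "s \<le> real n * S / real m" "real n * S / real m \<le> s + S / real m"
    using assms(2) by (simp_all add: pos_le_divide_eq add_divide_distrib)
  moreover have le: "n \<le> m" using True by (simp only: n_def)
  then have "real n * S / real m \<le> S"
    using assms mult_right_mono[of "real n" "real m" S] by (simp add: pos_divide_le_eq mult.commute)
  moreover have "grid_index S m s = n"
    using le unfolding grid_index_def n_def[symmetric] by simp
  ultimately show ?thesis
    by (simp add: min_def abs_le_iff)
next
  case False
  then have "grid_index S m s = m"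
    unfolding grid_index_def by (intro min_absorb1) (simp only: not_le less_imp_le)
  moreover have "real m < s * real m / S"
    using False by (simp add: not_le)
  then have "S < s"
    using assms by (simp add: pos_less_divide_eq mult.commute)
  ultimately show ?thesis using assms by simp
qed

lemma grid_index_tendsto:
  assumes "0 < S" "0 \<le> s"
  shows "(\<lambda>m. real (grid_index S m s) * S / real m) \<longlonglongrightarrow> min s S"
proof (rule LIM_zero_cancel, rule Lim_null_comparison)
  show "\<forall>\<^sub>F m in sequentially. norm (real (grid_index S m s) * S / real m - min s S) \<le> S / real m"
    using eventually_gt_at_top[of 0] by eventually_elim (simp add: grid_index_close assms)
qed (rule lim_const_over_n)

lemma grid_index_range: "0 < S \<Longrightarrow> real (grid_index S m s) * S / real m \<in> {0..S}"
  using grid_index_le[of S m s] mult_right_mono[of "real (grid_index S m s)" "real m" S]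
  by (cases "m = 0") (auto simp: pos_divide_le_eq mult.commute)

lemma min_range: "0 \<le> s \<Longrightarrow> 0 < S \<Longrightarrow> min s S \<in> {0..S}" for S :: real
  by auto

context embedded_problem_from
begin

lemma X_measurable: "0 \<le> u \<Longrightarrow> u \<le> 1 - t \<Longrightarrow> X (t + u) \<in> borel_measurable M"
  using random_variable_X[of "t + u"] by simp

lemma X_continuous: "\<omega> \<in> space M \<Longrightarrow> S < 1 - t \<Longrightarrow> continuous_on {0..S} (\<lambda>u. X (t + u) \<omega>)"
  by (intro continuous_on_compose2[OF continuous_paths_X] continuous_intros) auto

text \<open>X is given as measurable at each fixed time only. At the rounded time a countable case
  distinction suffices, and continuity before time 1 yields the limit.\<close>

lemma stopped_before_measurable:
  assumes [measurable]: "\<tau> \<in> borel_measurable M" and \<tau>: "\<And>\<omega>. \<omega> \<in> space M \<Longrightarrow> 0 \<le> \<tau> \<omega>"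
    and S: "0 < S" "S < 1 - t"
  shows "(\<lambda>\<omega>. X (t + min (\<tau> \<omega>) S) \<omega>) \<in> borel_measurable M"
proof (rule borel_measurable_LIMSEQ_real)
  fix m :: nat
  have g: "real (min k m) * S / real m \<in> {0..S}" for k
    using S mult_right_mono[of "real (min k m)" "real m" S]
    by (cases "m = 0") (auto simp: pos_divide_le_eq mult.commute)
  have "(\<lambda>\<omega>. X (t + real (min k m) * S / real m) \<omega>) \<in> borel_measurable M" for k
    using X_measurable[of "real (min k m) * S / real m"] g[of k] S by simp
  moreover have "(\<lambda>\<omega>. nat \<lceil>\<tau> \<omega> * real m / S\<rceil>) \<in> measurable M (count_space UNIV)"
    by measurable
  ultimately have "(\<lambda>\<omega>. X (t + real (min (nat \<lceil>\<tau> \<omega> * real m / S\<rceil>) m) * S / real m) \<omega>) \<in> borel_measurable M"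
    by (rule measurable_compose_countable)
  then show "(\<lambda>\<omega>. X (t + real (grid_index S m (\<tau> \<omega>)) * S / real m) \<omega>) \<in> borel_measurable M"
    by (simp add: grid_index_def min.commute)
next
  fix \<omega> assume \<omega>: "\<omega> \<in> space M"
  have "(\<lambda>m. X (t + real (grid_index S m (\<tau> \<omega>)) * S / real m) \<omega>) \<longlonglongrightarrow> X (t + min (\<tau> \<omega>) S) \<omega>"
    using continuous_on_tendsto_compose[OF X_continuous[OF \<omega> S(2)] grid_index_tendsto[OF S(1) \<tau>[OF \<omega>]]]
      grid_index_range[OF S(1)] min_range[OF \<tau>[OF \<omega>] S(1)] by simp
  then show "(\<lambda>m. X (t + real (grid_index S m (\<tau> \<omega>)) * S / real m) \<omega>) \<longlonglongrightarrow> X (t + min (\<tau> \<omega>) S) \<omega>" .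
qed

text \<open>The product coef j 0 * coef j s * s is a closed form for the integral of c^2 over
  [0, s], valid for both values of j.\<close>

definition exponent :: "real \<Rightarrow> real \<Rightarrow> real \<Rightarrow> real \<Rightarrow> real" where
  "exponent j l s w = l * coef j s * w - l\<^sup>2 / 2 * (coef j 0 * coef j s * s)"

definition stopped_exp :: "real \<Rightarrow> real \<Rightarrow> real \<Rightarrow> ('a \<Rightarrow> real) \<Rightarrow> 'a \<Rightarrow> real" where
  "stopped_exp j l S \<tau> \<omega> =
     indicator {j} (\<theta> \<omega>) * exp (exponent j l (min (\<tau> \<omega>) S) (X (t + min (\<tau> \<omega>) S) \<omega>))"

lemma coef_continuous: "j \<in> {0, 1} \<Longrightarrow> 0 < S \<Longrightarrow> S < 1 - t \<Longrightarrow> continuous_on {0..S} (coef j)"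
  unfolding continuous_on_eq_continuous_within
  by (intro ballI DERIV_continuous[OF coef_derivative]) auto

lemma coef_mono:
  assumes "j \<in> {0, 1}" "0 \<le> s" "s \<le> S" "S < 1 - t"
  shows "coef j s \<le> coef j S"
  using assms coef_denominator_pos[of j S] unfolding coef_def
  by (intro divide_left_mono mult_pos_pos) auto

lemma quadratic_variation_derivative:
  assumes "j \<in> {0, 1}" "0 \<le> s" "s < 1 - t"
  shows "((\<lambda>u. coef j 0 * coef j u * u) has_real_derivative (coef j s)\<^sup>2) (at s within A)"
proof -
  have eq: "coef j 0 * (j * (coef j s)\<^sup>2 * s + coef j s) = (coef j s)\<^sup>2"
  proof -
    define a b where "a = 1 - j * t" and "b = 1 - j * (t + s)"
    have ab: "0 < a" "0 < b" "a = b + j * s"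
      using coef_denominator_pos[OF assms] coef_denominator_pos[OF assms(1), of 0] t_less_1
      by (simp_all add: a_def b_def algebra_simps)
    have "j * (1 / b)\<^sup>2 * s + 1 / b = a / b\<^sup>2"
      unfolding ab(3) using ab(2) by (simp add: field_simps power2_eq_square)
    then have "1 / a * (j * (1 / b)\<^sup>2 * s + 1 / b) = (1 / b)\<^sup>2"
      using ab(1) by (simp add: power_divide)
    then show ?thesis by (simp add: coef_def a_def b_def)
  qed
  have "((\<lambda>u. coef j 0 * coef j u * u) has_real_derivative
     coef j 0 * (j * (coef j s)\<^sup>2 * s + coef j s)) (at s within A)"
    using assms by (auto intro!: derivative_eq_intros coef_derivative simp: algebra_simps)
  then show ?thesis unfolding eq .
qed

lemma stopping_time_past_version:
  assumes "stopping_time (observed_filtration M t X) \<tau>" "0 \<le> s" "s < 1 - t"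
  shows "\<exists>G\<in>sets (past (t + s)). AE \<omega> in M. \<omega> \<in> G \<longleftrightarrow> s < \<tau> \<omega>"
proof -
  have "{\<omega>\<in>space M. s < \<tau> \<omega>} \<in> sets (observed_filtration M t X s)"
    using stopping_timeD2[OF assms(1), of s] by (simp add: pred_def)
  then obtain G where G: "G \<in> sets (past (t + s))" "AE \<omega> in M. \<omega> \<in> {\<omega>\<in>space M. s < \<tau> \<omega>} \<longleftrightarrow> \<omega> \<in> G"
    using observed_event_past_version[OF assms(2,3)] by blast
  have "AE \<omega> in M. \<omega> \<in> G \<longleftrightarrow> s < \<tau> \<omega>"
    using G(2) AE_space by eventually_elim simp
  with G(1) show ?thesis by blast
qed

lemma stopping_time_measurable:
  assumes "stopping_time (observed_filtration M t X) \<tau>"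
  shows "\<tau> \<in> borel_measurable M"
  by (rule measurable_stopping_time[OF assms sets_observed_filtration_subset]) simp

text \<open>The discrete exponentials stopped on a grid have the required mean exactly. They
  converge almost surely to the stopped exponential and are bounded in L2, because their squares are
  controlled by the same exponentials with parameter 2 l.\<close>

lemma optional_stopping_exponential:
  assumes st: "stopping_time (observed_filtration M t X) \<tau>" and \<tau>: "\<And>\<omega>. \<omega> \<in> space M \<Longrightarrow> 0 \<le> \<tau> \<omega>"
    and j: "j \<in> {0, 1}" and S: "0 < S" "S < 1 - t"
  shows "stopped_exp j l S \<tau> \<in> borel_measurable M" "integrable M (stopped_exp j l S \<tau>)"
    "(\<integral>\<omega>. stopped_exp j l S \<tau> \<omega> \<partial>M) = \<P>(\<omega> in M. \<theta> \<omega> = j) * exp (l * coef j 0 * x)"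
proof -
  define g where "g = stopped_exp j l S \<tau>"
  have g_def: "g = (\<lambda>\<omega>. indicator {j} (\<theta> \<omega>) * exp (exponent j l (min (\<tau> \<omega>) S) (X (t + min (\<tau> \<omega>) S) \<omega>)))"
    by (simp add: g_def stopped_exp_def fun_eq_iff)
  note [measurable] = stopping_time_measurable[OF st] random_variable_theta
    stopped_before_measurable[OF stopping_time_measurable[OF st] \<tau> S]
  have g_meas[measurable]: "g \<in> borel_measurable M"
    unfolding g_def exponent_def coef_def by measurable
  define u where "u m k = real k * S / real m" for m k :: nat
  have u: "0 \<le> u m k" "u m k < 1 - t" if "k < m" for k m
    using S that mult_strict_right_mono[of "real k" "real m" S]
    by (auto simp: u_def pos_divide_le_eq mult.commute intro: le_less_trans[of _ S])
  \<comment> \<open>The event u m k < \<tau> itself need not be a past event, so a version of it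
    switches the increments.\<close>
  define G where "G m k = (SOME G. G \<in> sets (past (t + u m k)) \<and> (AE \<omega> in M. \<omega> \<in> G \<longleftrightarrow> u m k < \<tau> \<omega>))" for m k
  have "G m k \<in> sets (past (t + u m k)) \<and> (AE \<omega> in M. \<omega> \<in> G m k \<longleftrightarrow> u m k < \<tau> \<omega>)" if "k < m" for m k
    unfolding G_def by (rule someI_ex) (use stopping_time_past_version[OF st u[OF that]] in blast)
  then have G: "G m k \<in> sets (past (t + u m k))" "AE \<omega> in M. \<omega> \<in> G m k \<longleftrightarrow> u m k < \<tau> \<omega>" if "k < m" for m k
    using that by blast+
  \<comment> \<open>The multiplier h is 1 for the approximants and 2 for the bound on their
    squares.\<close>
  define f where "f h m = exp_transform j (h * l * coef j 0 * x) (G m) (\<lambda>k. h * l * coef j (u m k)) (\<lambda>k. t + u m k) m"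
    for h m
  have f: "f h m \<in> borel_measurable M" "integrable M (f h m)"
    "(\<integral>\<omega>. f h m \<omega> \<partial>M) = \<P>(\<omega> in M. \<theta> \<omega> = j) * exp (h * l * coef j 0 * x)" if m: "0 < m" for h m
  proof -
    have r: "0 \<le> t + u m 0" "t + u m k < t + u m (Suc k)" for k
      using t_nonneg S m by (auto simp: u_def divide_strict_right_mono)
    show "integrable M (f h m)"
      "(\<integral>\<omega>. f h m \<omega> \<partial>M) = \<P>(\<omega> in M. \<theta> \<omega> = j) * exp (h * l * coef j 0 * x)"
      unfolding f_def using exp_transform_martingale(2,3)[of "\<lambda>k. t + u m k" m "G m", OF r G(1)] by auto
    then show "f h m \<in> borel_measurable M" by (auto dest: borel_measurable_integrable)
  qed
  define K where "K = exp (l\<^sup>2 * (coef j S)\<^sup>2 * S)"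
  have sq: "(f 1 m \<omega>)\<^sup>2 \<le> K * f 2 m \<omega>" if m: "0 < m" for m \<omega>
  proof -
    define D where "D k = B (t + u m (Suc k)) \<omega> - B (t + u m k) \<omega>" for k
    define q where "q = (\<Sum>k<m. indicator (G m k) \<omega> * ((l * coef j (u m k))\<^sup>2 * (S / real m)))"
    have inc: "t + u m (Suc k) - (t + u m k) = S / real m" for k
      by (simp add: u_def field_simps add_divide_distrib)
    \<comment> \<open>Doubling the exponent doubles l but leaves a surplus, as - l^2 = - (2 l)^2 / 2
      + l^2. The surplus q is a discrete quadratic variation, bounded because the coefficient
      increases up to S.\<close>
    have "2 * (l * coef j 0 * x + (\<Sum>k<m. indicator (G m k) \<omega> * (l * coef j (u m k) * D k - (l * coef j (u m k))\<^sup>2 * (S / real m) / 2)))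
      = q + (2 * l * coef j 0 * x + (\<Sum>k<m. indicator (G m k) \<omega> * (2 * l * coef j (u m k) * D k - (2 * l * coef j (u m k))\<^sup>2 * (S / real m) / 2)))"
      unfolding q_def distrib_left sum_distrib_left
      by (simp add: sum.distrib[symmetric] sum_subtractf[symmetric] algebra_simps power2_eq_square)
    then have "(f 1 m \<omega>)\<^sup>2 = exp q * f 2 m \<omega>"
      unfolding f_def exp_transform_def inc D_def[symmetric] power_mult_distrib exp_double[symmetric]
      by (simp add: exp_add indicator_def power2_eq_square)
    moreover have "q \<le> l\<^sup>2 * (coef j S)\<^sup>2 * S"
    proof -
      have "q \<le> (\<Sum>k<m. l\<^sup>2 * (coef j S)\<^sup>2 * (S / real m))"
        unfolding q_def
      proof (rule sum_mono)
        fix k assume "k \<in> {..<m}"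
        then have k: "k < m" by simp
        have "u m k \<le> S"
          using k S mult_right_mono[of "real k" "real m" S] by (simp add: u_def pos_divide_le_eq mult.commute)
        then have "(coef j (u m k))\<^sup>2 \<le> (coef j S)\<^sup>2"
          using coef_mono[OF j, of "u m k" S] coef_pos[OF j, of "u m k"] u[OF k] S by (intro power_mono) auto
        then have "(l * coef j (u m k))\<^sup>2 * (S / real m) \<le> l\<^sup>2 * (coef j S)\<^sup>2 * (S / real m)"
          unfolding power_mult_distrib using S by (intro mult_right_mono mult_left_mono) auto
        then show "indicator (G m k) \<omega> * ((l * coef j (u m k))\<^sup>2 * (S / real m)) \<le> l\<^sup>2 * (coef j S)\<^sup>2 * (S / real m)"
          using S by (auto simp: indicator_def)
      qed
      also have "\<dots> = l\<^sup>2 * (coef j S)\<^sup>2 * S" using m by simp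
      finally show ?thesis .
    qed
    moreover have "0 \<le> f 2 m \<omega>" by (simp add: f_def exp_transform_def)
    ultimately show ?thesis by (simp add: K_def mult_right_mono)
  qed
  \<comment> \<open>The mesh S / m needs m > 0, hence the index \<open>Suc n\<close>.\<close>
  have "AE \<omega> in M. (\<lambda>n. f 1 (Suc n) \<omega>) \<longlonglongrightarrow> g \<omega>"
  proof -
    have "AE \<omega> in M. \<forall>m k. k < m \<longrightarrow> (\<omega> \<in> G m k \<longleftrightarrow> u m k < \<tau> \<omega>)"
      using G(2) by (auto simp: AE_all_countable intro: AE_impI)
    with euler_sum_converges AE_space show ?thesis
    proof eventually_elim
      fix \<omega> assume \<omega>: "\<omega> \<in> space M" and G: "\<forall>m k. k < m \<longrightarrow> (\<omega> \<in> G m k \<longleftrightarrow> u m k < \<tau> \<omega>)"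
       and H: "X t \<omega> = x \<and> (\<forall>S e. 0 < S \<longrightarrow> S < 1 - t \<longrightarrow> 0 < e \<longrightarrow>
         (\<forall>\<^sub>F m in sequentially. \<forall>i\<le>m. \<bar>coef (\<theta> \<omega>) (real i * S / real m) * X (t + real i * S / real m) \<omega>
            - euler_sum (\<theta> \<omega>) S m i \<omega>\<bar> \<le> e))"
      show "(\<lambda>n. f 1 (Suc n) \<omega>) \<longlonglongrightarrow> g \<omega>"
      proof (cases "\<theta> \<omega> = j")
        case False
        then show ?thesis by (simp add: f_def exp_transform_def g_def)
      next
        case True
        define n where "n m = grid_index S m (\<tau> \<omega>)" for m
        define \<sigma> where "\<sigma> = min (\<tau> \<omega>) S"
        define Q where "Q m = (\<Sum>k<n m. (coef j (u m k))\<^sup>2 * (u m (Suc k) - u m k))" for m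
        have un: "(\<lambda>m. u m (n m)) \<longlonglongrightarrow> \<sigma>" "\<And>m. u m (n m) \<in> {0..S}" "\<sigma> \<in> {0..S}"
          using grid_index_tendsto[OF S(1) \<tau>[OF \<omega>]] grid_index_range[OF S(1)] min_range[OF \<tau>[OF \<omega>] S(1)]
          by (simp_all add: u_def n_def \<sigma>_def)
        have 1: "(\<lambda>m. euler_sum j S m (n m) \<omega>) \<longlonglongrightarrow> coef j \<sigma> * X (t + \<sigma>) \<omega>"
        proof -
          have "continuous_on {0..S} (\<lambda>u. coef j u * X (t + u) \<omega>)"
            using coef_continuous[OF j S] X_continuous[OF \<omega> S(2)] by (intro continuous_intros)
          then have *: "(\<lambda>m. coef j (u m (n m)) * X (t + u m (n m)) \<omega>) \<longlonglongrightarrow> coef j \<sigma> * X (t + \<sigma>) \<omega>"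
            by (rule continuous_on_tendsto_compose) (use un in auto)
          have "(\<lambda>m. coef j (u m (n m)) * X (t + u m (n m)) \<omega> - euler_sum j S m (n m) \<omega>) \<longlonglongrightarrow> 0"
          proof (rule tendstoI)
            fix e :: real assume e: "0 < e"
            have "\<forall>\<^sub>F m in sequentially. \<forall>i\<le>m. \<bar>coef (\<theta> \<omega>) (real i * S / real m) * X (t + real i * S / real m) \<omega>
              - euler_sum (\<theta> \<omega>) S m i \<omega>\<bar> \<le> e / 2"
              using conjunct2[OF H] S half_gt_zero[OF e] by blast
            then show "\<forall>\<^sub>F m in sequentially. dist (coef j (u m (n m)) * X (t + u m (n m)) \<omega> - euler_sum j S m (n m) \<omega>) 0 < e"
            proof eventually_elim
              case (elim m)
              then have "\<bar>coef j (u m (n m)) * X (t + u m (n m)) \<omega> - euler_sum j S m (n m) \<omega>\<bar> \<le> e / 2"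
                using grid_index_le[of S m "\<tau> \<omega>"] by (simp add: u_def n_def True)
              then show ?case using e by simp
            qed
          qed
          from tendsto_diff[OF * this] show ?thesis by simp
        qed
        have 2: "Q \<longlonglongrightarrow> coef j 0 * coef j \<sigma> * \<sigma>"
        proof -
          define V where "V u = coef j 0 * coef j u * u" for u
          have V': "(V has_real_derivative (coef j s)\<^sup>2) (at s within {0..S})" if "s \<in> {0..S}" for s
            unfolding V_def[abs_def] using that S by (intro quadratic_variation_derivative[OF j]) auto
          then have "continuous_on {0..S} V"
            unfolding continuous_on_eq_continuous_within by (intro ballI DERIV_continuous)
          then have *: "(\<lambda>m. V (u m (n m))) \<longlonglongrightarrow> V \<sigma>"
            by (rule continuous_on_tendsto_compose) (use un in auto)
          have cont: "continuous_on {0..S} (\<lambda>u. (coef j u)\<^sup>2)"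
            using coef_continuous[OF j S] by (intro continuous_intros)
          have "(\<lambda>m. V (u m (n m)) - Q m) \<longlonglongrightarrow> 0"
          proof (rule tendstoI)
            fix e :: real assume e: "0 < e"
            have "\<forall>\<^sub>F m in sequentially. \<forall>i\<le>m. \<bar>V (real i * S / real m) - (V 0 + (\<Sum>k<i. (coef j (real k * S / real m))\<^sup>2 *
              (real (Suc k) * S / real m - real k * S / real m)))\<bar> \<le> e / 2"
              by (rule riemann_sum_uniform_limit[OF S(1) half_gt_zero[OF e] V' cont])
            then show "\<forall>\<^sub>F m in sequentially. dist (V (u m (n m)) - Q m) 0 < e"
            proof eventually_elim
              case (elim m)
              have "\<bar>V (u m (n m)) - (V 0 + Q m)\<bar> \<le> e / 2"
                using elim[rule_format, OF grid_index_le[of S m "\<tau> \<omega>"]] unfolding u_def n_def Q_def .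
              then show ?case using e by (simp add: V_def)
            qed
          qed
          from tendsto_diff[OF * this] show ?thesis by (simp add: V_def)
        qed
        \<comment> \<open>Exact, not only in the limit: on such a path G m k holds precisely for k <
          n m, so the switched sum is the sum cut at the rounded stopping index.\<close>
        have eq: "f 1 m \<omega> = exp (l * euler_sum j S m (n m) \<omega> - l\<^sup>2 / 2 * Q m)" if m: "0 < m" for m
        proof -
          define F where "F k = l * coef j (u m k) * (B (t + u m (Suc k)) \<omega> - B (t + u m k) \<omega>) -
              (l * coef j (u m k))\<^sup>2 * (u m (Suc k) - u m k) / 2" for k
          have "(\<Sum>k<m. indicator (G m k) \<omega> * F k) = (\<Sum>k<n m. F k)"
          proof (rule sum.mono_neutral_cong_right)
            show "{..<n m} \<subseteq> {..<m}" using grid_index_le[of S m "\<tau> \<omega>"] by (auto simp: n_def)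
            show "\<forall>i\<in>{..<m} - {..<n m}. indicator (G m i) \<omega> * F i = 0"
            proof
              fix i assume i: "i \<in> {..<m} - {..<n m}"
              then have "\<omega> \<notin> G m i"
                using G less_grid_index[OF S(1) m, of i "\<tau> \<omega>"] by (simp add: n_def u_def)
              then show "indicator (G m i) \<omega> * F i = 0" by simp
            qed
            show "indicator (G m k) \<omega> * F k = F k" if "k \<in> {..<n m}" for k
            proof -
              have "\<omega> \<in> G m k"
                using that G less_grid_index[OF S(1) m, of k "\<tau> \<omega>"] by (simp add: n_def u_def)
              then show ?thesis by simp
            qed
          qed simp
          then have "f 1 m \<omega> = exp (l * coef j 0 * x + (\<Sum>k<n m. F k))"
            by (simp add: f_def exp_transform_def True F_def)
          also have "l * coef j 0 * x + (\<Sum>k<n m. F k) = l * euler_sum j S m (n m) \<omega> - l\<^sup>2 / 2 * Q m"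
            unfolding F_def euler_sum_def Q_def u_def[symmetric]
            by (simp add: sum_subtractf sum_distrib_left distrib_left power_mult_distrib mult_ac u_def del: of_nat_Suc)
          finally show ?thesis .
        qed
        have "(\<lambda>m. exp (l * euler_sum j S m (n m) \<omega> - l\<^sup>2 / 2 * Q m)) \<longlonglongrightarrow>
           exp (l * (coef j \<sigma> * X (t + \<sigma>) \<omega>) - l\<^sup>2 / 2 * (coef j 0 * coef j \<sigma> * \<sigma>))"
          by (intro tendsto_intros 1 2)
        then have "(\<lambda>m. exp (l * euler_sum j S m (n m) \<omega> - l\<^sup>2 / 2 * Q m)) \<longlonglongrightarrow> g \<omega>"
          by (simp add: g_def exponent_def \<sigma>_def True mult.assoc)
        then show ?thesis
          by (subst (asm) filterlim_sequentially_Suc[symmetric]) (simp add: eq del: of_nat_Suc)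
      qed
    qed
  qed
  moreover have "(\<integral>\<^sup>+\<omega>. ennreal ((f 1 (Suc n) \<omega>)\<^sup>2) \<partial>M) \<le> ennreal (K * (\<P>(\<omega> in M. \<theta> \<omega> = j) * exp (2 * l * coef j 0 * x)))" for n
  proof -
    have "(\<integral>\<^sup>+\<omega>. ennreal ((f 1 (Suc n) \<omega>)\<^sup>2) \<partial>M) \<le> (\<integral>\<^sup>+\<omega>. ennreal (K * f 2 (Suc n) \<omega>) \<partial>M)"
      by (intro nn_integral_mono ennreal_leI sq) simp
    also have "\<dots> = ennreal (\<integral>\<omega>. K * f 2 (Suc n) \<omega> \<partial>M)"
      by (intro nn_integral_eq_integral integrable_mult_right f) (auto simp: K_def f_def exp_transform_def)
    finally show ?thesis using f(3)[of "Suc n" 2] by simp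
  qed
  ultimately have "integrable M g" and lim: "(\<lambda>n. \<integral>\<omega>. f 1 (Suc n) \<omega> \<partial>M) \<longlonglongrightarrow> (\<integral>\<omega>. g \<omega> \<partial>M)"
    using L2_bounded_limit[of "\<lambda>n. f 1 (Suc n)" g] f(1) by auto
  have "(\<lambda>n. \<integral>\<omega>. f 1 (Suc n) \<omega> \<partial>M) \<longlonglongrightarrow> \<P>(\<omega> in M. \<theta> \<omega> = j) * exp (l * coef j 0 * x)"
    using f(3)[of _ 1] by simp
  with lim have "(\<integral>\<omega>. g \<omega> \<partial>M) = \<P>(\<omega> in M. \<theta> \<omega> = j) * exp (l * coef j 0 * x)"
    by (rule LIMSEQ_unique)
  moreover have "stopped_exp j l S \<tau> = g"
    by (simp add: g_def stopped_exp_def fun_eq_iff)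
  ultimately show "stopped_exp j l S \<tau> \<in> borel_measurable M" "integrable M (stopped_exp j l S \<tau>)"
    "(\<integral>\<omega>. stopped_exp j l S \<tau> \<omega> \<partial>M) = \<P>(\<omega> in M. \<theta> \<omega> = j) * exp (l * coef j 0 * x)"
    using \<open>integrable M g\<close> g_meas by simp_all
qed

end

section \<open>The hitting time of the boundary\<close>

text \<open>All members of the hitting set lie in [0, 1 - t], so the cap takes effect only when the
  set is empty and the infimum is infinite.\<close>

lemma tau_star_characterization:
  assumes t: "t < 1"
  shows "tau_star t w =
    (let A = {s. 0 \<le> s \<and> s \<le> 1 - t \<and> w (t + s) \<ge> alpha * sqrt (1 - t - s)} in if A = {} then 1 - t else Inf A)"
proof -
  define A where "A = {s. 0 \<le> s \<and> s \<le> 1 - t \<and> w (t + s) \<ge> alpha * sqrt (1 - t - s)}"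
  have "tau_star t w = (if A = {} then 1 - t else Inf A)"
  proof (cases "A = {}")
    case True
    then have "tau_b t w = \<infinity>" unfolding tau_b_def A_def[symmetric] by (simp add: top_ereal_def)
    then show ?thesis using True by (simp add: tau_star_def)
  next
    case False
    have bdd: "bdd_below A" unfolding A_def by (rule bdd_belowI[of _ 0]) auto
    obtain a where a: "a \<in> A" using False by blast
    have "tau_b t w = ereal (Inf A)"
      unfolding tau_b_def A_def[symmetric] using bdd False by (simp add: ereal_Inf')
    moreover have "Inf A \<le> 1 - t"
      using cInf_lower[OF a bdd] a by (simp add: A_def)
    ultimately show ?thesis using False by (simp add: tau_star_def)
  qed
  then show ?thesis unfolding A_def[symmetric] Let_def .
qed

lemma tau_star_range: "t < 1 \<Longrightarrow> 0 \<le> tau_star t w \<and> tau_star t w \<le> 1 - t"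
proof -
  assume t: "t < 1"
  define A where "A = {s. 0 \<le> s \<and> s \<le> 1 - t \<and> w (t + s) \<ge> alpha * sqrt (1 - t - s)}"
  have "0 \<le> Inf A \<and> Inf A \<le> 1 - t" if ne: "A \<noteq> {}"
  proof -
    obtain a where a: "a \<in> A" using ne by blast
    have "bdd_below A" by (rule bdd_belowI[of _ 0]) (auto simp: A_def)
    then have "Inf A \<le> a" by (rule cInf_lower[OF a])
    moreover have "0 \<le> Inf A" using ne by (rule cInf_greatest) (auto simp: A_def)
    ultimately show ?thesis using a by (auto simp: A_def)
  qed
  then show ?thesis
    unfolding tau_star_characterization[OF t] A_def[symmetric] Let_def using t by auto
qed

lemma tau_star_le:
  assumes "t < 1" "0 \<le> s" "s \<le> 1 - t" "w (t + s) \<ge> alpha * sqrt (1 - t - s)"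
  shows "tau_star t w \<le> s"
proof -
  define A where "A = {s. 0 \<le> s \<and> s \<le> 1 - t \<and> w (t + s) \<ge> alpha * sqrt (1 - t - s)}"
  have "s \<in> A" using assms by (simp add: A_def)
  moreover from this have "Inf A \<le> s"
    by (rule cInf_lower) (auto simp: A_def intro: bdd_belowI[of _ 0])
  ultimately show ?thesis
    unfolding tau_star_characterization[OF assms(1)] A_def[symmetric] Let_def by auto
qed

lemma continuous_above_boundary:
  fixes w :: "real \<Rightarrow> real"
  assumes "continuous_on {t..<1} w" "s < 1 - t"
  shows "continuous_on {0..s} (\<lambda>u. w (t + u) - alpha * sqrt (1 - t - u))"
  using assms by (intro continuous_intros continuous_on_compose2[OF assms(1)]) auto

text \<open>The infimum is attained. Paths are continuous only before time 1, so compactness is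
  applied to the hitting times up to some hitting time a < 1 - t.\<close>

lemma tau_star_hits:
  assumes t: "t < 1" and w: "continuous_on {t..<1} w" and less: "tau_star t w < 1 - t"
  shows "alpha * sqrt (1 - t - tau_star t w) \<le> w (t + tau_star t w)"
proof -
  define A where "A = {s. 0 \<le> s \<and> s \<le> 1 - t \<and> w (t + s) \<ge> alpha * sqrt (1 - t - s)}"
  have ne: "A \<noteq> {}" and eq: "tau_star t w = Inf A"
    using less unfolding tau_star_characterization[OF t] A_def[symmetric] Let_def by (auto split: if_splits)
  then obtain a where a: "a \<in> A" "a < 1 - t"
    using less cInf_lessD[OF ne, of "1 - t"] by auto
  have "compact ({0..a} \<inter> (\<lambda>u. w (t + u) - alpha * sqrt (1 - t - u)) -` {0..})"
  proof -
    have "closed ({0..a} \<inter> (\<lambda>u. w (t + u) - alpha * sqrt (1 - t - u)) -` {0..})"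
      by (rule continuous_closed_preimage[OF continuous_above_boundary[OF w a(2)]]) auto
    then show ?thesis
      by (simp add: compact_eq_bounded_closed bounded_Int)
  qed
  moreover have "{0..a} \<inter> (\<lambda>u. w (t + u) - alpha * sqrt (1 - t - u)) -` {0..} = {0..a} \<inter> A"
    using a by (auto simp: A_def)
  moreover have "{0..a} \<inter> A \<noteq> {}" using a by (auto simp: A_def)
  ultimately obtain b where b: "b \<in> {0..a} \<inter> A" "\<And>c. c \<in> {0..a} \<inter> A \<Longrightarrow> b \<le> c"
    by (metis compact_attains_inf)
  have "b \<le> c" if "c \<in> A" for c
    using b(1) b(2)[of c] that by (cases "c \<le> a") (auto simp: A_def)
  then have "Inf A = b"
    using b(1) by (intro cInf_eq_minimum) auto
  then show ?thesis using b(1) eq by (simp add: A_def)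
qed

lemma before_tau_star:
  assumes "t < 1" "0 \<le> s" "s < tau_star t w"
  shows "w (t + s) < alpha * sqrt (1 - t - s)"
  using tau_star_le[OF assms(1,2), of w] tau_star_range[OF assms(1), of w] assms(3) by linarith

text \<open>A path that starts below the boundary and is above it at the hitting time would have
  crossed it earlier, by the intermediate value theorem.\<close>

lemma at_tau_star:
  assumes t: "t < 1" and w: "continuous_on {t..<1} w" and less: "tau_star t w < 1 - t"
    and start: "w t < alpha * sqrt (1 - t)"
  shows "w (t + tau_star t w) = alpha * sqrt (1 - t - tau_star t w)"
proof (rule ccontr)
  assume ne: "w (t + tau_star t w) \<noteq> alpha * sqrt (1 - t - tau_star t w)"
  define f where "f u = w (t + u) - alpha * sqrt (1 - t - u)" for u
  define \<tau> where "\<tau> = tau_star t w"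
  have "0 \<le> \<tau>" using tau_star_range[OF t, of w] by (simp add: \<tau>_def)
  moreover have "f 0 \<le> 0" using start by (simp add: f_def)
  moreover have "0 < f \<tau>" using tau_star_hits[OF t w less] ne by (simp add: f_def \<tau>_def)
  moreover have "continuous_on {0..\<tau>} f"
    unfolding f_def using less by (intro continuous_above_boundary[OF w]) (simp add: \<tau>_def)
  ultimately obtain u where u: "0 \<le> u" "u \<le> \<tau>" "f u = 0"
    using IVT'[of f 0 0 \<tau>] by auto
  then have "u < \<tau>" using \<open>0 < f \<tau>\<close> by (cases "u = \<tau>") auto
  then show False using before_tau_star[OF t u(1), of w] u(3) by (simp add: f_def \<tau>_def)
qed

text \<open>A countable description by values up to time s, so that the hitting time is a stopping
  time of the raw filtration. A continuous function reaches 0 on [0, s] exactly when, for every n,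
  it exceeds - 1 / (n + 1) at some grid point: density of the grid gives one direction, the attained
  maximum the other.\<close>

lemma tau_star_le_iff:
  assumes t: "t < 1" and w: "continuous_on {t..<1} w" and s: "0 \<le> s" "s < 1 - t"
  shows "tau_star t w \<le> s \<longleftrightarrow>
    (\<forall>n::nat. \<exists>m k. k \<le> m \<and> w (t + real k * s / real m) - alpha * sqrt (1 - t - real k * s / real m) > - 1 / real (Suc n))"
proof -
  define f where "f u = w (t + u) - alpha * sqrt (1 - t - u)" for u
  have cont: "continuous_on {0..s} f"
    unfolding f_def by (rule continuous_above_boundary[OF w s(2)])
  have range: "real k * s / real m \<in> {0..s}" if "k \<le> m" for k m :: nat
    using that s mult_right_mono[of "real k" "real m" s] by (cases "m = 0") (auto simp: pos_divide_le_eq mult.commute)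
  have "tau_star t w \<le> s \<longleftrightarrow> (\<exists>u\<in>{0..s}. 0 \<le> f u)"
  proof
    assume le: "tau_star t w \<le> s"
    then have "0 \<le> f (tau_star t w)"
      using tau_star_hits[OF t w] s by (simp add: f_def)
    then show "\<exists>u\<in>{0..s}. 0 \<le> f u"
      using le tau_star_range[OF t, of w] by auto
  next
    assume "\<exists>u\<in>{0..s}. 0 \<le> f u"
    then obtain u where "u \<in> {0..s}" "0 \<le> f u" by blast
    then show "tau_star t w \<le> s"
      using tau_star_le[OF t, of u w] s by (simp add: f_def)
  qed
  also have "\<dots> \<longleftrightarrow> (\<forall>n::nat. \<exists>m k. k \<le> m \<and> f (real k * s / real m) > - 1 / real (Suc n))"
  proof safe
    fix u and n :: nat assume u: "u \<in> {0..s}" "0 \<le> f u"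
    have neg: "- 1 / real (Suc n) < 0" by simp
    show "\<exists>m k. k \<le> m \<and> f (real k * s / real m) > - 1 / real (Suc n)"
    proof (cases "s = 0")
      case True
      then show ?thesis using u less_le_trans[OF neg, of "f 0"] by (intro exI[of _ 0]) (simp del: of_nat_Suc)
    next
      case False
      then have s0: "0 < s" using s by simp
      have "(\<lambda>m. real (grid_index s m u) * s / real m) \<longlonglongrightarrow> u"
        using grid_index_tendsto[OF s0, of u] u by simp
      then have "(\<lambda>m. f (real (grid_index s m u) * s / real m)) \<longlonglongrightarrow> f u"
        by (rule continuous_on_tendsto_compose[OF cont]) (use u grid_index_range[OF s0] in auto)
      then have "\<forall>\<^sub>F m in sequentially. - 1 / real (Suc n) < f (real (grid_index s m u) * s / real m)"
        by (rule order_tendstoD(1)[OF _ less_le_trans[OF neg u(2)]])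
      then obtain m where "- 1 / real (Suc n) < f (real (grid_index s m u) * s / real m)"
        by (auto simp: eventually_sequentially)
      then show ?thesis using grid_index_le by blast
    qed
  next
    assume H: "\<forall>n::nat. \<exists>m k. k \<le> m \<and> f (real k * s / real m) > - 1 / real (Suc n)"
    obtain u where u: "u \<in> {0..s}" "\<And>v. v \<in> {0..s} \<Longrightarrow> f v \<le> f u"
      using continuous_attains_sup[OF _ _ cont] s by auto
    have "0 \<le> f u"
    proof (rule ccontr)
      assume "\<not> 0 \<le> f u"
      then obtain n where n: "inverse (real (Suc n)) < - f u"
        using reals_Archimedean[of "- f u"] by auto
      obtain m k where "k \<le> m" "f (real k * s / real m) > - 1 / real (Suc n)"
        using H by blast
      then show False
        using u(2)[OF range[of k m]] n by (simp add: inverse_eq_divide)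
    qed
    then show "\<exists>u\<in>{0..s}. 0 \<le> f u" using u(1) by blast
  qed
  finally show ?thesis by (simp add: f_def)
qed

context embedded_problem_from
begin

lemma tau_star_stopping_time:
  "stopping_time (observed_filtration M t X) (\<lambda>\<omega>. tau_star t (\<lambda>u. X u \<omega>))"
proof
  fix s
  show "Measurable.pred (observed_filtration M t X s) (\<lambda>\<omega>. tau_star t (\<lambda>u. X u \<omega>) \<le> s)"
  proof -
    consider "s < 0" | "1 - t \<le> s" | "0 \<le> s" "s < 1 - t" by linarith
    then show ?thesis
    proof cases
      case 1
      then have "tau_star t (\<lambda>u. X u \<omega>) \<le> s \<longleftrightarrow> False" for \<omega>
        using tau_star_range[OF t_less_1, of "\<lambda>u. X u \<omega>"] by auto
      then show ?thesis by simp
    next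
      case 2
      then have "tau_star t (\<lambda>u. X u \<omega>) \<le> s \<longleftrightarrow> True" for \<omega>
        using tau_star_range[OF t_less_1, of "\<lambda>u. X u \<omega>"] by auto
      then show ?thesis by simp
    next
      case 3
      have range: "real k * s / real m \<in> {0..s}" if "k \<le> m" for k m :: nat
        using that 3 mult_right_mono[of "real k" "real m" s] by (cases "m = 0") (auto simp: pos_divide_le_eq mult.commute)
      have 4: "{\<omega>\<in>space M. k \<le> m \<and> X (t + real k * s / real m) \<omega> - alpha * sqrt (1 - t - real k * s / real m) > - 1 / real (Suc n)}
        \<in> sets (observed_filtration M t X s)" for k m n :: nat
      proof (cases "k \<le> m")
        case True
        have "X (t + real k * s / real m) \<in> borel_measurable (observed_filtration M t X s)"
          using range[OF True] 3 by (intro X_observed) auto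
        then have "{\<omega>\<in>space (observed_filtration M t X s). X (t + real k * s / real m) \<omega> - alpha * sqrt (1 - t - real k * s / real m) > - 1 / real (Suc n)}
        \<in> sets (observed_filtration M t X s)" by measurable
        then show ?thesis using True by (simp only: space_observed_filtration simp_thms)
      next
        case False
        then have "{\<omega>\<in>space M. k \<le> m \<and> X (t + real k * s / real m) \<omega> - alpha * sqrt (1 - t - real k * s / real m) > - 1 / real (Suc n)} = {}"
          by blast
        then show ?thesis by (simp only: sets.empty_sets)
      qed
      have "{\<omega>\<in>space M. tau_star t (\<lambda>u. X u \<omega>) \<le> s} = (\<Inter>n. \<Union>m. \<Union>k. {\<omega>\<in>space M. k \<le> m \<and>
        X (t + real k * s / real m) \<omega> - alpha * sqrt (1 - t - real k * s / real m) > - 1 / real (Suc n)})"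
      proof (rule set_eqI)
        fix \<omega>
        show "\<omega> \<in> {\<omega>\<in>space M. tau_star t (\<lambda>u. X u \<omega>) \<le> s} \<longleftrightarrow> \<omega> \<in> (\<Inter>n. \<Union>m. \<Union>k. {\<omega>\<in>space M. k \<le> m \<and>
          X (t + real k * s / real m) \<omega> - alpha * sqrt (1 - t - real k * s / real m) > - 1 / real (Suc n)})"
        proof (cases "\<omega> \<in> space M")
          case True
          show ?thesis
            unfolding tau_star_le_iff[OF t_less_1 continuous_paths_X[OF True] 3] mem_Collect_eq INT_iff UN_iff
            using True by (simp only: simp_thms UNIV_I bex_UNIV ball_UNIV)
        next
          case False
          then show ?thesis by simp
        qed
      qed
      also have "\<dots> \<in> sets (observed_filtration M t X s)"
        by (intro sets.countable_INT' image_subsetI sets.countable_UN'' 4) auto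
      finally show ?thesis by (simp add: pred_def)
    qed
  qed
qed

lemma tau_star_admissible: "(\<lambda>\<omega>. tau_star t (\<lambda>u. X u \<omega>)) \<in> admissible M t X"
  unfolding admissible_def using tau_star_stopping_time tau_star_range[OF t_less_1] by auto

end

section \<open>Mixtures of exponential martingales\<close>

text \<open>This is G of the overview: the integral of exp (l y - l^2 v / 2) over l \<ge> 0, written
  in the closed form found above.\<close>

definition exp_mixture :: "real \<Rightarrow> real \<Rightarrow> real" where
  "exp_mixture v y = gauss_ratio (y / sqrt v) / sqrt v"

lemma gauss_ratio_measurable[measurable]: "gauss_ratio \<in> borel_measurable borel"
  by (intro borel_measurable_continuous_onI)
     (auto simp: continuous_on_eq_continuous_at intro: DERIV_isCont gauss_ratio_has_real_derivative)

lemma exp_mixture_measurable[measurable (raw)]: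
  assumes [measurable]: "f \<in> borel_measurable N" "g \<in> borel_measurable N"
  shows "(\<lambda>\<omega>. exp_mixture (f \<omega>) (g \<omega>)) \<in> borel_measurable N"
  unfolding exp_mixture_def by measurable

lemma exp_mixture_pos: "0 < v \<Longrightarrow> 0 < exp_mixture v y"
  by (simp add: exp_mixture_def gauss_ratio_pos)

text \<open>For y \<ge> 0, v \<ge> v0 gives v + b \<le> ((v0 + b) / v0) v, which replaces y / v by a
  multiple of y / (v + b); the tangent inequality at y / sqrt (v + b) does the rest. For y < 0 the
  right side is nonnegative and the gain is not positive.\<close>

lemma gain_le_exp_mixture:
  assumes v: "0 < v0" "v0 \<le> v" and b: "0 \<le> b"
  shows "y / v \<le> (v0 + b) / v0 * (1 - alpha\<^sup>2) * exp_mixture (v + b) y"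
proof (cases "0 \<le> y")
  case True
  have vb: "0 < v + b" using v b by simp
  define K where "K = (v0 + b) / v0"
  have "v + b \<le> K * v"
    using v b mult_left_mono[of v0 v b] by (simp add: K_def field_simps)
  then have "y * (v + b) \<le> y * (K * v)"
    using True by (rule mult_left_mono)
  then have "y / v \<le> K * (y / (v + b))"
    using v vb by (simp add: pos_divide_le_eq pos_le_divide_eq mult_ac)
  moreover have "y / (v + b) \<le> (1 - alpha\<^sup>2) * exp_mixture (v + b) y"
  proof -
    have "y / (v + b) = (y / sqrt (v + b)) / sqrt (v + b)"
      using vb by (simp add: real_div_sqrt)
    also have "\<dots> \<le> ((1 - alpha\<^sup>2) * gauss_ratio (y / sqrt (v + b))) / sqrt (v + b)"
      using vb by (intro divide_right_mono le_gauss_ratio) auto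
    finally show ?thesis by (simp add: exp_mixture_def)
  qed
  then have "K * (y / (v + b)) \<le> K * ((1 - alpha\<^sup>2) * exp_mixture (v + b) y)"
    using v b by (intro mult_left_mono) (simp_all add: K_def)
  ultimately show ?thesis unfolding K_def mult.assoc by (rule order_trans)
next
  case False
  then have "y / v \<le> 0" using v by (simp add: divide_nonpos_pos)
  also have "0 \<le> (v0 + b) / v0 * (1 - alpha\<^sup>2) * exp_mixture (v + b) y"
    using v b alpha_sq_less_1 exp_mixture_pos[of "v + b" y] by (intro mult_nonneg_nonneg) auto
  finally show ?thesis .
qed

text \<open>In the stopping region, shifting the clock by \<open>b\<close> moves the starting point onto the boundary.\<close>

lemma V10_eq_shifted_exp_mixture:
  assumes "t < 1"
  defines "v \<equiv> 1 / (1 - t)"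
  shows "\<exists>b\<ge>0. (x \<ge> alpha * sqrt (1 - t) \<or> b = 0) \<and>
    V10 t x = (v + b) / v * (1 - alpha\<^sup>2) * exp_mixture (v + b) (v * x)"
proof -
  define T where "T = 1 - t"
  have T: "0 < T" using assms by (simp add: T_def)
  have v: "v = 1 / T" "0 < v" using T by (simp_all add: v_def T_def)
  show ?thesis
  proof (cases "x < alpha * sqrt T")
    case True
    have "1 / T * x / sqrt (1 / T) = x / sqrt T"
      using T by (simp add: real_sqrt_divide field_simps)
    then have "exp_mixture v (v * x) = gauss_ratio (x / sqrt T) * sqrt T"
      unfolding exp_mixture_def v(1) by (simp add: real_sqrt_divide)
    moreover have "V10 t x = (1 - alpha\<^sup>2) * (gauss_ratio (x / sqrt T) * sqrt T)"
      using True T by (simp add: V10_def T_def[symmetric] gauss_ratio_def power_divide real_sqrt_mult mult_ac)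
    ultimately show ?thesis using v(2) by (intro exI[of _ 0]) simp
  next
    case False
    define y where "y = v * x"
    \<comment> \<open>Solves y / sqrt (v + b) = alpha, the point where the tangent inequality is an
      equality; b is nonnegative exactly because x is not below the boundary.\<close>
    define b where "b = (y / alpha)\<^sup>2 - v"
    have a: "0 < alpha" by (rule alpha_root)
    have x: "alpha * sqrt T \<le> x" "0 < x"
      using False mult_pos_pos[OF a, of "sqrt T"] T by auto
    have "(alpha * sqrt T)\<^sup>2 \<le> x\<^sup>2"
      using x(1) a T by (intro power_mono) auto
    then have "alpha\<^sup>2 * T \<le> x\<^sup>2" using T by (simp add: power_mult_distrib)
    then have "v \<le> (y / alpha)\<^sup>2"
      using T a by (simp add: y_def v(1) field_simps power2_eq_square)
    then have b: "0 \<le> b" by (simp add: b_def)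
    have y: "0 < y" using x v by (simp add: y_def)
    have sq: "sqrt (v + b) = y / alpha" "v + b = (y / alpha)\<^sup>2"
      using y a by (simp_all add: b_def)
    have "(1 - alpha\<^sup>2) * exp_mixture (v + b) y = alpha / (y / alpha)"
      using y a alpha_root(2) by (simp add: exp_mixture_def sq(1))
    then have "(v + b) / v * (1 - alpha\<^sup>2) * exp_mixture (v + b) y = (y / alpha)\<^sup>2 / v * (alpha / (y / alpha))"
      by (simp add: sq(2) mult.assoc)
    also have "\<dots> = y / v"
      using y a v(2) by (simp add: field_simps power2_eq_square)
    also have "\<dots> = x" using v(2) by (simp add: y_def)
    also have "x = V10 t x" using False by (simp add: V10_def T_def)
    finally show ?thesis using b x(1) by (intro exI[of _ b]) (simp add: y_def T_def)
  qed
qed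

text \<open>Only l between a / 2 and a is kept, with a = 1 / sqrt v, where the Gaussian factor is at
  least exp (- 1 / 2). There the integrand is at least exp (- 1 / 2) (a / 2)^3 y^2 / 2; an interval
  of length a / 2 then gives exp (- 1 / 2) a^4 y^2 / 32, and a^4 = 1 / v^2. The weight l supplies
  the fourth power of a.\<close>

lemma sq_le_weighted_exp_mixture:
  assumes v: "0 < v"
  shows "ennreal ((y / v)\<^sup>2) \<le> ennreal (32 * exp (1 / 2)) *
    (\<integral>\<^sup>+l\<in>{0..}. ennreal (l * (exp (l * y - l\<^sup>2 * v / 2) + exp (- l * y - l\<^sup>2 * v / 2))) \<partial>lborel)"
proof -
  define a where "a = 1 / sqrt v"
  have a: "0 < a" "a\<^sup>2 = 1 / v" using v by (auto simp: a_def power_divide)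
  define c where "c = exp (- 1 / 2) * (a / 2) ^ 3 * y\<^sup>2 / 2"
  have c: "0 \<le> c" using a by (simp add: c_def)
  have "c \<le> l * (exp (l * y - l\<^sup>2 * v / 2) + exp (- l * y - l\<^sup>2 * v / 2))" if l: "l \<in> {a / 2..a}" for l
  proof -
    have l0: "0 \<le> l" using l a by auto
    have "l\<^sup>2 \<le> a\<^sup>2" using l l0 by (intro power_mono) auto
    then have "l\<^sup>2 * v \<le> 1" using v a(2) by (simp add: field_simps)
    then have e: "exp (- 1 / 2) \<le> exp (- (l\<^sup>2 * v / 2))" by simp
    have "(a / 2) ^ 3 \<le> l ^ 3" using l a by (intro power_mono) auto
    then have "(a / 2) ^ 3 * y\<^sup>2 \<le> l ^ 3 * y\<^sup>2" by (intro mult_right_mono) auto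
    also have "l ^ 3 * y\<^sup>2 = l * (l * y)\<^sup>2" by (simp add: power2_eq_square power3_eq_cube)
    also have "\<dots> \<le> l * (2 * (exp (l * y) + exp (- (l * y))))"
      using l0 by (intro mult_left_mono sq_le_exp_add_exp)
    finally have "(a / 2) ^ 3 * y\<^sup>2 / 2 \<le> l * (exp (l * y) + exp (- (l * y)))" by (simp add: algebra_simps)
    then have "exp (- 1 / 2) * ((a / 2) ^ 3 * y\<^sup>2 / 2) \<le> exp (- (l\<^sup>2 * v / 2)) * (l * (exp (l * y) + exp (- (l * y))))"
      using e a by (intro mult_mono) auto
    also have "\<dots> = l * (exp (l * y - l\<^sup>2 * v / 2) + exp (- l * y - l\<^sup>2 * v / 2))"
      unfolding diff_conv_add_uminus exp_add by (simp add: algebra_simps)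
    finally show ?thesis by (simp add: c_def)
  qed
  then have le: "(\<integral>\<^sup>+l. ennreal c * indicator {a / 2..a} l \<partial>lborel) \<le>
    (\<integral>\<^sup>+l\<in>{0..}. ennreal (l * (exp (l * y - l\<^sup>2 * v / 2) + exp (- l * y - l\<^sup>2 * v / 2))) \<partial>lborel)"
    using a by (intro nn_integral_mono) (auto simp: indicator_def intro!: ennreal_leI)
  have eq: "(\<integral>\<^sup>+l. ennreal c * indicator {a / 2..a} l \<partial>lborel) = ennreal (c * (a / 2))"
    using a c by (simp add: nn_integral_cmult ennreal_mult[symmetric])
  have "(y / v)\<^sup>2 = 32 * exp (1 / 2) * (c * (a / 2))"
  proof -
    have "32 * (c * (a / 2)) = exp (- 1 / 2) * (a\<^sup>2)\<^sup>2 * y\<^sup>2"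
      by (simp add: c_def power2_eq_square power3_eq_cube)
    then have "32 * exp (1 / 2) * (c * (a / 2)) = exp (1 / 2) * exp (- 1 / 2) * ((a\<^sup>2)\<^sup>2 * y\<^sup>2)"
      by simp
    also have "exp (1 / 2) * exp (- 1 / 2) = (1::real)" by (simp add: mult_exp_exp)
    finally show ?thesis using v by (simp add: a(2) power_divide)
  qed
  then have "ennreal ((y / v)\<^sup>2) = ennreal (32 * exp (1 / 2)) * ennreal (c * (a / 2))"
    using c a by (subst ennreal_mult[symmetric]) auto
  also have "\<dots> \<le> ennreal (32 * exp (1 / 2)) *
    (\<integral>\<^sup>+l\<in>{0..}. ennreal (l * (exp (l * y - l\<^sup>2 * v / 2) + exp (- l * y - l\<^sup>2 * v / 2))) \<partial>lborel)"
    using le unfolding eq by (rule mult_left_mono) simp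
  finally show ?thesis .
qed

section \<open>Moments and mixtures for the stopped process\<close>

context embedded_problem_from
begin

lemma exponent_0: "exponent 0 l s w = l * w - l\<^sup>2 / 2 * s"
  by (simp add: exponent_def coef_def)

lemma coef_1: "coef 1 s = 1 / (1 - t - s)"
  by (simp add: coef_def algebra_simps)

text \<open>By partial fractions the quadratic variation is the increase of coef 1, which therefore
  acts as the clock v of the pinned case.\<close>

lemma exponent_1:
  assumes "0 \<le> s" "s < 1 - t"
  shows "exponent 1 l s w = l * (coef 1 s * w) - l\<^sup>2 * (coef 1 s - coef 1 0) / 2"
proof -
  have "coef 1 0 * coef 1 s * s = coef 1 s - coef 1 0"
    unfolding coef_1 using assms t_less_1 by (simp add: field_simps)
  then show ?thesis by (simp add: exponent_def)
qed

end

locale stopped_problem = embedded_problem_from M B \<theta> X t x p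
  for M :: "'a measure" and B \<theta> X t x p +
  fixes \<tau> :: "'a \<Rightarrow> real"
  assumes stopping: "stopping_time (observed_filtration M t X) \<tau>"
    and nonneg: "\<And>\<omega>. \<omega> \<in> space M \<Longrightarrow> 0 \<le> \<tau> \<omega>"
begin

definition stopped_at :: "real \<Rightarrow> 'a \<Rightarrow> real" where
  "stopped_at S \<omega> = X (t + min (\<tau> \<omega>) S) \<omega>"

lemma tau_measurable[measurable]: "\<tau> \<in> borel_measurable M"
  by (rule stopping_time_measurable[OF stopping])

lemma stopped_at_measurable[measurable]: "0 < S \<Longrightarrow> S < 1 - t \<Longrightarrow> stopped_at S \<in> borel_measurable M"
  unfolding stopped_at_def[abs_def] by (rule stopped_before_measurable[OF tau_measurable nonneg])

lemmas stopped_exp = optional_stopping_exponential[OF stopping nonneg]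

lemma stopped_exp_eq: "stopped_exp j l S \<tau> \<omega> = indicator {j} (\<theta> \<omega>) * exp (exponent j l (min (\<tau> \<omega>) S) (stopped_at S \<omega>))"
  by (simp add: stopped_exp_def stopped_at_def)

lemma stopped_exp_nonneg: "0 \<le> stopped_exp j l S \<tau> \<omega>"
  by (simp add: stopped_exp_def)

lemma min_tau: "\<omega> \<in> space M \<Longrightarrow> 0 < S \<Longrightarrow> S < 1 - t \<Longrightarrow> 0 \<le> min (\<tau> \<omega>) S \<and> min (\<tau> \<omega>) S < 1 - t"
  using nonneg[of \<omega>] by auto

lemma indicator_theta_measurable[measurable]: "(\<lambda>\<omega>. indicator {j} (\<theta> \<omega>) :: real) \<in> borel_measurable M"
  using random_variable_theta by measurable

text \<open>Taken at l = 1 and l = - 1. Elapsed time is at most 1, so removing the normalisation exp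
  (- s / 2) costs at most exp 1, and the bound does not depend on S.\<close>

lemma second_moment_0:
  assumes S: "0 < S" "S < 1 - t"
  shows "(\<integral>\<^sup>+\<omega>. ennreal (indicator {0} (\<theta> \<omega>) * (stopped_at S \<omega>)\<^sup>2) \<partial>M) \<le> ennreal (2 * exp 1 * (exp x + exp (- x)))"
proof -
  define q where "q = \<P>(\<omega> in M. \<theta> \<omega> = 0)"
  have q: "0 \<le> q" "q \<le> 1" by (simp_all add: q_def)
  have "(\<integral>\<^sup>+\<omega>. ennreal (indicator {0} (\<theta> \<omega>) * (stopped_at S \<omega>)\<^sup>2) \<partial>M) \<le>
    (\<integral>\<^sup>+\<omega>. ennreal (2 * exp 1 * (stopped_exp 0 1 S \<tau> \<omega> + stopped_exp 0 (- 1) S \<tau> \<omega>)) \<partial>M)"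
  proof (intro nn_integral_mono ennreal_leI)
    fix \<omega> assume \<omega>: "\<omega> \<in> space M"
    define w where "w = stopped_at S \<omega>"
    define s where "s = min (\<tau> \<omega>) S"
    have "s \<le> 1" using S t_nonneg by (simp add: s_def)
    then have "1 \<le> exp 1 * exp (- (s / 2))" by (simp add: mult_exp_exp)
    then have "1 * (exp w + exp (- w)) \<le> (exp 1 * exp (- (s / 2))) * (exp w + exp (- w))"
      by (intro mult_right_mono) (auto intro: add_nonneg_nonneg)
    moreover have "(exp 1 * exp (- (s / 2))) * (exp w + exp (- w)) = exp 1 * (exp (exponent 0 1 s w) + exp (exponent 0 (- 1) s w))"
      unfolding exponent_0 diff_conv_add_uminus exp_add by (simp add: algebra_simps)
    ultimately have le: "exp w + exp (- w) \<le> exp 1 * (exp (exponent 0 1 s w) + exp (exponent 0 (- 1) s w))"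
      by simp
    have "w\<^sup>2 \<le> 2 * exp 1 * (exp (exponent 0 1 s w) + exp (exponent 0 (- 1) s w))"
      unfolding mult.assoc by (rule order_trans[OF sq_le_exp_add_exp]) (intro mult_left_mono le, simp)
    then show "indicator {0} (\<theta> \<omega>) * (stopped_at S \<omega>)\<^sup>2 \<le> 2 * exp 1 * (stopped_exp 0 1 S \<tau> \<omega> + stopped_exp 0 (- 1) S \<tau> \<omega>)"
      by (simp add: stopped_exp_eq w_def[symmetric] s_def[symmetric] indicator_def)
  qed
  also have "\<dots> = ennreal (2 * exp 1 * (q * exp x + q * exp (- x)))"
    using stopped_exp[of 0 S 1] stopped_exp[of 0 S "- 1"] S
    by (subst nn_integral_eq_integral) (auto simp: stopped_exp_nonneg coef_def q_def)
  also have "\<dots> \<le> ennreal (2 * exp 1 * (exp x + exp (- x)))"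
    using q by (intro ennreal_leI mult_left_mono add_mono mult_left_le_one_le) auto
  finally show ?thesis .
qed

text \<open>Tonelli's theorem applied to the stopped exponentials. The map e allows mixing over l or
  over - l, and k is the mixing weight.\<close>

lemma mixture:
  assumes S: "0 < S" "S < 1 - t"
    and e: "e \<in> borel_measurable borel" and k: "k \<in> borel_measurable borel"
  shows "(\<integral>\<^sup>+\<omega>. (\<integral>\<^sup>+l. ennreal (stopped_exp 1 (e l) S \<tau> \<omega>) * k l \<partial>lborel) \<partial>M) =
    (\<integral>\<^sup>+l. ennreal (\<P>(\<omega> in M. \<theta> \<omega> = 1) * exp (e l * coef 1 0 * x)) * k l \<partial>lborel)"
proof -
  interpret pair_sigma_finite M lborel ..
  note [measurable] = e k stopped_at_measurable[OF S]
  have "(\<lambda>(\<omega>, l). ennreal (stopped_exp 1 (e l) S \<tau> \<omega>) * k l) \<in> borel_measurable (M \<Otimes>\<^sub>M lborel)"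
    unfolding stopped_exp_eq exponent_def coef_def by measurable
  then have "(\<integral>\<^sup>+\<omega>. (\<integral>\<^sup>+l. ennreal (stopped_exp 1 (e l) S \<tau> \<omega>) * k l \<partial>lborel) \<partial>M) =
    (\<integral>\<^sup>+l. (\<integral>\<^sup>+\<omega>. ennreal (stopped_exp 1 (e l) S \<tau> \<omega>) * k l \<partial>M) \<partial>lborel)"
    by (rule Fubini'[symmetric])
  also have "\<dots> = (\<integral>\<^sup>+l. ennreal (\<P>(\<omega> in M. \<theta> \<omega> = 1) * exp (e l * coef 1 0 * x)) * k l \<partial>lborel)"
  proof (intro nn_integral_cong)
    fix l
    have "(\<integral>\<^sup>+\<omega>. ennreal (stopped_exp 1 (e l) S \<tau> \<omega>) * k l \<partial>M) = (\<integral>\<^sup>+\<omega>. ennreal (stopped_exp 1 (e l) S \<tau> \<omega>) \<partial>M) * k l"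
      using stopped_exp(1)[of 1 S "e l"] S by (intro nn_integral_multc) auto
    also have "(\<integral>\<^sup>+\<omega>. ennreal (stopped_exp 1 (e l) S \<tau> \<omega>) \<partial>M) = ennreal (\<P>(\<omega> in M. \<theta> \<omega> = 1) * exp (e l * coef 1 0 * x))"
      using stopped_exp[of 1 S "e l"] S by (subst nn_integral_eq_integral) (auto simp: stopped_exp_nonneg)
    finally show "(\<integral>\<^sup>+\<omega>. ennreal (stopped_exp 1 (e l) S \<tau> \<omega>) * k l \<partial>M) = ennreal (\<P>(\<omega> in M. \<theta> \<omega> = 1) * exp (e l * coef 1 0 * x)) * k l" .
  qed
  finally show ?thesis .
qed

text \<open>Mixing with weight exp (- l^2 (coef 1 0 + b) / 2) on l \<ge> 0 replaces the clock
  increase coef 1 s - coef 1 0 by coef 1 s + b, so the integral over l is G at the shifted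
  clock.\<close>

lemma exp_mixture_expectation:
  assumes S: "0 < S" "S < 1 - t" and b: "0 \<le> b"
  defines "Y \<equiv> \<lambda>\<omega>. indicator {1} (\<theta> \<omega>) * exp_mixture (coef 1 (min (\<tau> \<omega>) S) + b) (coef 1 (min (\<tau> \<omega>) S) * stopped_at S \<omega>)"
  shows "integrable M Y"
    "(\<integral>\<omega>. Y \<omega> \<partial>M) = \<P>(\<omega> in M. \<theta> \<omega> = 1) * exp_mixture (coef 1 0 + b) (coef 1 0 * x)"
proof -
  define q where "q = \<P>(\<omega> in M. \<theta> \<omega> = 1)"
  define k where "k l = ennreal (exp (- (l\<^sup>2 * (coef 1 0 + b) / 2))) * indicator {0..} l" for l :: real
  have k: "k \<in> borel_measurable borel" unfolding k_def[abs_def] by measurable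
  have c0: "0 < coef 1 0" using coef_pos[of 1 0] t_less_1 by simp
  note [measurable] = stopped_at_measurable[OF S]
  have [measurable]: "Y \<in> borel_measurable M"
    unfolding Y_def coef_def by measurable
  have cs: "0 < coef 1 (min (\<tau> \<omega>) S) + b" if "\<omega> \<in> space M" for \<omega>
    using min_tau[OF that S] coef_pos[of 1 "min (\<tau> \<omega>) S"] b by (simp add: add_pos_nonneg)
  have Y: "(\<integral>\<^sup>+l. ennreal (stopped_exp 1 l S \<tau> \<omega>) * k l \<partial>lborel) = ennreal (Y \<omega>)" if \<omega>: "\<omega> \<in> space M" for \<omega>
  proof -
    define s w where "s = min (\<tau> \<omega>) S" and "w = stopped_at S \<omega>"
    have "(\<integral>\<^sup>+l. ennreal (stopped_exp 1 l S \<tau> \<omega>) * k l \<partial>lborel) =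
      (\<integral>\<^sup>+l. indicator {1} (\<theta> \<omega>) * (ennreal (exp (l * (coef 1 s * w) - l\<^sup>2 * (coef 1 s + b) / 2)) * indicator {0..} l) \<partial>lborel)"
    proof (intro nn_integral_cong)
      fix l
      have "exp (exponent 1 l s w) * exp (- (l\<^sup>2 * (coef 1 0 + b) / 2)) = exp (l * (coef 1 s * w) - l\<^sup>2 * (coef 1 s + b) / 2)"
        using min_tau[OF \<omega> S] by (simp add: exponent_1 s_def mult_exp_exp field_simps)
      then show "ennreal (stopped_exp 1 l S \<tau> \<omega>) * k l =
        indicator {1} (\<theta> \<omega>) * (ennreal (exp (l * (coef 1 s * w) - l\<^sup>2 * (coef 1 s + b) / 2)) * indicator {0..} l)"
        by (auto simp: stopped_exp_eq k_def s_def[symmetric] w_def[symmetric] indicator_def ennreal_mult[symmetric])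
    qed
    also have "\<dots> = indicator {1} (\<theta> \<omega>) * ennreal (exp_mixture (coef 1 s + b) (coef 1 s * w))"
      using nn_integral_exp_quadratic[OF cs[OF \<omega>, folded s_def], of "coef 1 s * w"]
      by (subst nn_integral_cmult) (auto simp: exp_mixture_def)
    finally show ?thesis by (simp add: Y_def s_def w_def indicator_def)
  qed
  have "(\<integral>\<^sup>+\<omega>. ennreal (Y \<omega>) \<partial>M) = (\<integral>\<^sup>+\<omega>. (\<integral>\<^sup>+l. ennreal (stopped_exp 1 l S \<tau> \<omega>) * k l \<partial>lborel) \<partial>M)"
    by (intro nn_integral_cong) (simp add: Y)
  also have "\<dots> = (\<integral>\<^sup>+l. ennreal (q * exp (l * coef 1 0 * x)) * k l \<partial>lborel)"
    using mixture[OF S _ k, of "\<lambda>l. l"] by (simp add: q_def)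
  also have "\<dots> = (\<integral>\<^sup>+l. ennreal q * (ennreal (exp (l * (coef 1 0 * x) - l\<^sup>2 * (coef 1 0 + b) / 2)) * indicator {0..} l) \<partial>lborel)"
    by (intro nn_integral_cong) (simp add: k_def indicator_def ennreal_mult[symmetric] q_def mult_exp_exp mult.assoc)
  also have "\<dots> = ennreal (q * exp_mixture (coef 1 0 + b) (coef 1 0 * x))"
    using nn_integral_exp_quadratic[of "coef 1 0 + b" "coef 1 0 * x"] c0 b
    by (subst nn_integral_cmult) (auto simp: exp_mixture_def ennreal_mult[symmetric] q_def gauss_ratio_pos less_imp_le)
  finally have nn: "(\<integral>\<^sup>+\<omega>. ennreal (Y \<omega>) \<partial>M) = ennreal (q * exp_mixture (coef 1 0 + b) (coef 1 0 * x))" .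
  have Y0: "AE \<omega> in M. 0 \<le> Y \<omega>"
    using AE_space by eventually_elim (simp add: Y_def cs exp_mixture_pos less_imp_le)
  show "integrable M Y"
    using nn by (intro integrableI_nonneg Y0) auto
  then show "(\<integral>\<omega>. Y \<omega> \<partial>M) = q * exp_mixture (coef 1 0 + b) (coef 1 0 * x)"
    using nn nn_integral_eq_integral[OF _ Y0] integral_nonneg_AE[OF Y0] exp_mixture_pos[of "coef 1 0 + b" "coef 1 0 * x"] c0 b
    by (simp add: q_def)
qed

text \<open>The square is dominated by mixtures over l and - l with weight l exp (- l^2 coef 1 0 /
  2). Their means are the initial values I 1 and I (- 1), finite and free of S, although the
  coefficient explodes as S tends to 1 - t.\<close>

lemma second_moment_1:
  "\<exists>C. \<forall>S. 0 < S \<longrightarrow> S < 1 - t \<longrightarrow> (\<integral>\<^sup>+\<omega>. ennreal (indicator {1} (\<theta> \<omega>) * (stopped_at S \<omega>)\<^sup>2) \<partial>M) \<le> ennreal C"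
proof -
  define q where "q = \<P>(\<omega> in M. \<theta> \<omega> = 1)"
  define k where "k l = ennreal (l * exp (- (l\<^sup>2 * coef 1 0 / 2))) * indicator {0..} l" for l :: real
  have k: "k \<in> borel_measurable borel" unfolding k_def[abs_def] by measurable
  have c0: "0 < coef 1 0" using coef_pos[of 1 0] t_less_1 by simp
  define I where "I r = (\<integral>\<^sup>+l. ennreal (q * exp (r * l * coef 1 0 * x)) * k l \<partial>lborel)" for r
  have I: "I r < \<infinity>" for r
  proof -
    have "I r = (\<integral>\<^sup>+l. ennreal q * (ennreal (l * exp (l * (r * coef 1 0 * x) - l\<^sup>2 * coef 1 0 / 2)) * indicator {0..} l) \<partial>lborel)"
      unfolding I_def diff_conv_add_uminus exp_add
      by (intro nn_integral_cong) (auto simp: k_def indicator_def ennreal_mult[symmetric] q_def mult_ac)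
    also have "\<dots> = ennreal q * (\<integral>\<^sup>+l\<in>{0..}. ennreal (l * exp (l * (r * coef 1 0 * x) - l\<^sup>2 * coef 1 0 / 2)) \<partial>lborel)"
      by (rule nn_integral_cmult) measurable
    also have "\<dots> < \<infinity>"
      using nn_integral_weighted_exp_quadratic_finite[OF c0, of "r * coef 1 0 * x"] by (simp add: ennreal_mult_less_top)
    finally show ?thesis .
  qed
  define J where "J = ennreal (32 * exp (1 / 2)) * (I 1 + I (- 1))"
  have J: "J < \<infinity>" using I by (simp add: J_def ennreal_mult_less_top)
  have "(\<integral>\<^sup>+\<omega>. ennreal (indicator {1} (\<theta> \<omega>) * (stopped_at S \<omega>)\<^sup>2) \<partial>M) \<le> J" if S: "0 < S" "S < 1 - t" for S
  proof -
    note [measurable] = stopped_at_measurable[OF S] k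
    have m: "(\<lambda>\<omega>. \<integral>\<^sup>+l. ennreal (stopped_exp 1 (r * l) S \<tau> \<omega>) * k l \<partial>lborel) \<in> borel_measurable M" for r
      unfolding stopped_exp_eq exponent_def coef_def by measurable
    have "(\<integral>\<^sup>+\<omega>. ennreal (indicator {1} (\<theta> \<omega>) * (stopped_at S \<omega>)\<^sup>2) \<partial>M) \<le>
      (\<integral>\<^sup>+\<omega>. ennreal (32 * exp (1 / 2)) * ((\<integral>\<^sup>+l. ennreal (stopped_exp 1 (1 * l) S \<tau> \<omega>) * k l \<partial>lborel) +
        (\<integral>\<^sup>+l. ennreal (stopped_exp 1 (- 1 * l) S \<tau> \<omega>) * k l \<partial>lborel)) \<partial>M)"
    proof (intro nn_integral_mono)
      fix \<omega> assume \<omega>: "\<omega> \<in> space M"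
      define s w where "s = min (\<tau> \<omega>) S" and "w = stopped_at S \<omega>"
      have s: "0 \<le> s" "s < 1 - t" using min_tau[OF \<omega> S] by (simp_all add: s_def)
      have cs: "0 < coef 1 s" using s coef_pos[of 1 s] by simp
      show "ennreal (indicator {1} (\<theta> \<omega>) * (stopped_at S \<omega>)\<^sup>2) \<le> ennreal (32 * exp (1 / 2)) *
        ((\<integral>\<^sup>+l. ennreal (stopped_exp 1 (1 * l) S \<tau> \<omega>) * k l \<partial>lborel) +
        (\<integral>\<^sup>+l. ennreal (stopped_exp 1 (- 1 * l) S \<tau> \<omega>) * k l \<partial>lborel))"
      proof (cases "\<theta> \<omega> = 1")
        case True
        have "ennreal (indicator {1} (\<theta> \<omega>) * (stopped_at S \<omega>)\<^sup>2) = ennreal ((coef 1 s * w / coef 1 s)\<^sup>2)"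
          using cs True by (simp add: w_def)
        also have "\<dots> \<le> ennreal (32 * exp (1 / 2)) *
          (\<integral>\<^sup>+l\<in>{0..}. ennreal (l * (exp (l * (coef 1 s * w) - l\<^sup>2 * coef 1 s / 2) + exp (- l * (coef 1 s * w) - l\<^sup>2 * coef 1 s / 2))) \<partial>lborel)"
          by (rule sq_le_weighted_exp_mixture[OF cs])
        also have "(\<integral>\<^sup>+l\<in>{0..}. ennreal (l * (exp (l * (coef 1 s * w) - l\<^sup>2 * coef 1 s / 2) + exp (- l * (coef 1 s * w) - l\<^sup>2 * coef 1 s / 2))) \<partial>lborel)
          = (\<integral>\<^sup>+l. ennreal (stopped_exp 1 (1 * l) S \<tau> \<omega>) * k l + ennreal (stopped_exp 1 (- 1 * l) S \<tau> \<omega>) * k l \<partial>lborel)"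
        proof (intro nn_integral_cong)
          fix l :: real
          have *: "exp (exponent 1 (r * l) s w) * (l * exp (- (l\<^sup>2 * coef 1 0 / 2))) = l * exp (r * l * (coef 1 s * w) - l\<^sup>2 * coef 1 s / 2)"
            if "r\<^sup>2 = 1" for r
          proof -
            have "exponent 1 (r * l) s w + - (l\<^sup>2 * coef 1 0 / 2) = r * l * (coef 1 s * w) - l\<^sup>2 * coef 1 s / 2"
              using s that by (simp add: exponent_1 power_mult_distrib field_simps)
            then have "exp (exponent 1 (r * l) s w) * exp (- (l\<^sup>2 * coef 1 0 / 2)) = exp (r * l * (coef 1 s * w) - l\<^sup>2 * coef 1 s / 2)"
              unfolding mult_exp_exp by simp
            then show ?thesis by (simp add: mult.left_commute)
          qed
          show "ennreal (l * (exp (l * (coef 1 s * w) - l\<^sup>2 * coef 1 s / 2) + exp (- l * (coef 1 s * w) - l\<^sup>2 * coef 1 s / 2))) * indicator {0..} l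
            = ennreal (stopped_exp 1 (1 * l) S \<tau> \<omega>) * k l + ennreal (stopped_exp 1 (- 1 * l) S \<tau> \<omega>) * k l"
          proof (cases "0 \<le> l")
            case l: True
            have "ennreal (stopped_exp 1 (r * l) S \<tau> \<omega>) * k l = ennreal (l * exp (r * l * (coef 1 s * w) - l\<^sup>2 * coef 1 s / 2))"
              if "r\<^sup>2 = 1" for r
              using l True unfolding *[OF that, symmetric]
              by (simp add: stopped_exp_eq k_def s_def[symmetric] w_def[symmetric] ennreal_mult[symmetric])
            from this[of 1] this[of "- 1"] show ?thesis
              using l by (simp add: ennreal_plus[symmetric] distrib_left del: ennreal_plus)
          qed (simp add: k_def)
        qed
        also have "\<dots> = (\<integral>\<^sup>+l. ennreal (stopped_exp 1 (1 * l) S \<tau> \<omega>) * k l \<partial>lborel) + (\<integral>\<^sup>+l. ennreal (stopped_exp 1 (- 1 * l) S \<tau> \<omega>) * k l \<partial>lborel)"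
          unfolding stopped_exp_eq exponent_def by (intro nn_integral_add) measurable
        finally show ?thesis .
      qed simp
    qed
    also have "\<dots> = ennreal (32 * exp (1 / 2)) * (I 1 + I (- 1))"
    proof -
      define F where "F r \<omega> = (\<integral>\<^sup>+l. ennreal (stopped_exp 1 (r * l) S \<tau> \<omega>) * k l \<partial>lborel)" for r \<omega>
      have F: "F r \<in> borel_measurable M" "(\<integral>\<^sup>+\<omega>. F r \<omega> \<partial>M) = I r" for r
        using m[of r] mixture[OF S _ k, of "\<lambda>l. r * l"] by (simp_all add: F_def[abs_def] I_def q_def)
      show ?thesis
        unfolding F_def[symmetric] using F by (simp add: nn_integral_cmult nn_integral_add)
    qed
    finally show ?thesis by (simp add: J_def)
  qed
  then show ?thesis
    using less_imp_neq[OF J] by (intro exI[of _ "enn2real J"]) (simp add: ennreal_enn2real_if)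
qed

end

section \<open>The value of a stopping time\<close>

text \<open>The derivative of exp (h w - h^2 s / 2) at h = 0, taken along h = 1 / (n + 1).\<close>

lemma exp_difference_quotient_tendsto:
  "(\<lambda>n. real (Suc n) * (exp (w / real (Suc n) - (1 / real (Suc n))\<^sup>2 / 2 * s) - 1)) \<longlonglongrightarrow> w"
proof -
  define f where "f h = exp (h * w - h\<^sup>2 / 2 * s)" for h :: real
  have "(f has_real_derivative w) (at 0)"
    unfolding f_def by (auto intro!: derivative_eq_intros)
  then have "((\<lambda>h. (f (0 + h) - f 0) / h) \<longlongrightarrow> w) (at 0)"
    by (simp add: DERIV_def)
  moreover have "filterlim (\<lambda>n. 1 / real (Suc n)) (at 0) sequentially"
    using LIMSEQ_inverse_real_of_nat by (intro filterlim_atI) (simp_all add: inverse_eq_divide)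
  ultimately have "(\<lambda>n. (f (0 + 1 / real (Suc n)) - f 0) / (1 / real (Suc n))) \<longlonglongrightarrow> w"
    by (rule filterlim_compose)
  then show ?thesis by (simp add: f_def mult.commute)
qed

lemma abs_exp_minus_1_le: "\<bar>exp u - 1\<bar> \<le> \<bar>u\<bar> * exp \<bar>u\<bar>" for u :: real
proof (cases "0 \<le> u")
  case True
  have "(1 - u) * exp u \<le> exp (- u) * exp u"
    using exp_ge_add_one_self[of "- u"] by (intro mult_right_mono) auto
  then have "exp u - 1 \<le> u * exp u" by (simp add: mult_exp_exp algebra_simps)
  then show ?thesis using True by simp
next
  case False
  have "1 - exp u \<le> - u" using exp_ge_add_one_self[of u] by linarith
  also have "\<dots> \<le> - u * exp (- u)" using False by (simp add: mult_le_cancel_left1)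
  finally show ?thesis using False by simp
qed

context stopped_problem
begin

text \<open>Differentiates the exponential identity at l = 0 through difference quotients; dominated
  convergence exchanges limit and mean.\<close>

lemma mean_0:
  assumes S: "0 < S" "S < 1 - t"
  shows "(\<integral>\<omega>. indicator {0} (\<theta> \<omega>) * stopped_at S \<omega> \<partial>M) = \<P>(\<omega> in M. \<theta> \<omega> = 0) * x"
proof -
  define q where "q = \<P>(\<omega> in M. \<theta> \<omega> = 0)"
  note [measurable] = stopped_at_measurable[OF S]
  define h where "h n \<omega> = real (Suc n) * (stopped_exp 0 (1 / real (Suc n)) S \<tau> \<omega> - indicator {0} (\<theta> \<omega>))" for n \<omega>
  have se: "integrable M (stopped_exp 0 l S \<tau>)" "(\<integral>\<omega>. stopped_exp 0 l S \<tau> \<omega> \<partial>M) = q * exp (l * x)" for l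
    using stopped_exp[of 0 S l] S by (simp_all add: q_def coef_def)
  have ind: "integrable M (\<lambda>\<omega>. indicator {0} (\<theta> \<omega>) :: real)"
    by (intro integrable_const_bound[where B=1]) auto
  have Eind: "(\<integral>\<omega>. indicator {0} (\<theta> \<omega>) \<partial>M) = q"
  proof -
    have "(\<integral>\<omega>. indicator {0} (\<theta> \<omega>) \<partial>M) = (\<integral>\<omega>. indicator {\<omega>\<in>space M. \<theta> \<omega> = 0} \<omega> \<partial>M :: real)"
      by (intro Bochner_Integration.integral_cong) (auto simp: indicator_def)
    moreover have "{\<omega>\<in>space M. \<theta> \<omega> = 0} \<inter> space M = {\<omega>\<in>space M. \<theta> \<omega> = 0}" by auto
    ultimately show ?thesis by (simp add: q_def)
  qed
  \<comment> \<open>The quotients are at most (|w| + 1) exp (|w| + 1) \<le> exp 2 * exp (2 |w|),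
    hence the parameters 2 and - 2. Their normalisation exp (- 2 s) with s \<le> 1 costs a second
    factor exp 2, which makes exp 4.\<close>
  have "(\<lambda>n. \<integral>\<omega>. h n \<omega> \<partial>M) \<longlonglongrightarrow> (\<integral>\<omega>. indicator {0} (\<theta> \<omega>) * stopped_at S \<omega> \<partial>M)"
  proof (rule integral_dominated_convergence[where w="\<lambda>\<omega>. exp 4 * (stopped_exp 0 2 S \<tau> \<omega> + stopped_exp 0 (- 2) S \<tau> \<omega>)"])
    show "integrable M (\<lambda>\<omega>. exp 4 * (stopped_exp 0 2 S \<tau> \<omega> + stopped_exp 0 (- 2) S \<tau> \<omega>))"
      using se(1) by auto
    show "h n \<in> borel_measurable M" for n
      unfolding h_def[abs_def] using borel_measurable_integrable[OF se(1)] by measurable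
    show "AE \<omega> in M. (\<lambda>n. h n \<omega>) \<longlonglongrightarrow> indicator {0} (\<theta> \<omega>) * stopped_at S \<omega>"
    proof (intro AE_I2)
      fix \<omega>
      have "h n \<omega> = indicator {0} (\<theta> \<omega>) * (real (Suc n) *
        (exp (stopped_at S \<omega> / real (Suc n) - (1 / real (Suc n))\<^sup>2 / 2 * min (\<tau> \<omega>) S) - 1))" for n
        by (simp add: h_def stopped_exp_eq exponent_0 indicator_def del: of_nat_Suc)
      then show "(\<lambda>n. h n \<omega>) \<longlonglongrightarrow> indicator {0} (\<theta> \<omega>) * stopped_at S \<omega>"
        by (simp only:) (intro tendsto_mult tendsto_const exp_difference_quotient_tendsto)
    qed
    show "AE \<omega> in M. norm (h n \<omega>) \<le> exp 4 * (stopped_exp 0 2 S \<tau> \<omega> + stopped_exp 0 (- 2) S \<tau> \<omega>)" for n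
      using AE_space
    proof eventually_elim
      fix \<omega> assume \<omega>: "\<omega> \<in> space M"
      define s w N where "s = min (\<tau> \<omega>) S" and "w = stopped_at S \<omega>" and "N = real (Suc n)"
      have s: "0 \<le> s" "s \<le> 1" using min_tau[OF \<omega> S] t_nonneg by (auto simp: s_def)
      have N: "1 \<le> N" by (simp add: N_def)
      show "norm (h n \<omega>) \<le> exp 4 * (stopped_exp 0 2 S \<tau> \<omega> + stopped_exp 0 (- 2) S \<tau> \<omega>)"
      proof (cases "\<theta> \<omega> = 0")
        case True
        define u where "u = w / N - (1 / N)\<^sup>2 / 2 * s"
        have "N * \<bar>u\<bar> \<le> \<bar>w\<bar> + 1"
        proof -
          have "N * u = w - s / (2 * N)" using N by (simp add: u_def field_simps power2_eq_square)
          moreover have "s / (2 * N) \<le> 1" "0 \<le> s / (2 * N)" using s N by (auto simp: pos_divide_le_eq)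
          ultimately have "\<bar>N * u\<bar> \<le> \<bar>w\<bar> + 1" by linarith
          then show ?thesis using N by (simp add: abs_mult)
        qed
        moreover have "\<bar>u\<bar> \<le> N * \<bar>u\<bar>" using N by (simp add: mult_le_cancel_right1)
        ultimately have u: "N * \<bar>u\<bar> \<le> \<bar>w\<bar> + 1" "\<bar>u\<bar> \<le> \<bar>w\<bar> + 1" by linarith+
        have "norm (h n \<omega>) = N * \<bar>exp u - 1\<bar>"
          using True by (simp add: h_def stopped_exp_eq exponent_0 abs_mult u_def N_def s_def w_def del: of_nat_Suc)
        also have "\<dots> \<le> N * (\<bar>u\<bar> * exp \<bar>u\<bar>)"
          using N by (intro mult_left_mono abs_exp_minus_1_le) auto
        also have "\<dots> = (N * \<bar>u\<bar>) * exp \<bar>u\<bar>" by simp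
        also have "\<dots> \<le> (\<bar>w\<bar> + 1) * exp (\<bar>w\<bar> + 1)"
          using u by (intro mult_mono) auto
        also have "\<dots> \<le> exp (\<bar>w\<bar> + 1) * exp (\<bar>w\<bar> + 1)"
          using exp_ge_add_one_self[of "\<bar>w\<bar> + 1"] by (intro mult_right_mono) auto
        also have "\<dots> = exp 2 * exp (2 * \<bar>w\<bar>)" by (simp add: mult_exp_exp)
        also have "\<dots> \<le> exp 2 * (exp (2 * w) + exp (- 2 * w))"
          by (intro mult_left_mono) (auto simp: abs_if)
        also have "\<dots> \<le> exp 4 * (exp (exponent 0 2 s w) + exp (exponent 0 (- 2) s w))"
        proof -
          have "exp 2 * exp (2 * w) \<le> exp 4 * exp (exponent 0 2 s w)"
            "exp 2 * exp (- 2 * w) \<le> exp 4 * exp (exponent 0 (- 2) s w)"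
            unfolding mult_exp_exp exp_le_cancel_iff exponent_0 using s by simp_all
          then show ?thesis unfolding distrib_left by (rule add_mono)
        qed
        finally show ?thesis using True by (simp add: stopped_exp_eq s_def w_def)
      qed (simp add: h_def stopped_exp_eq)
    qed
  qed measurable
  moreover have "(\<lambda>n. \<integral>\<omega>. h n \<omega> \<partial>M) \<longlonglongrightarrow> q * x"
  proof -
    \<comment> \<open>The mean is put in the form of the same difference quotient, at w = x and s =
      0.\<close>
    have "(\<integral>\<omega>. h n \<omega> \<partial>M) = q * (real (Suc n) * (exp (x / real (Suc n) - (1 / real (Suc n))\<^sup>2 / 2 * 0) - 1))" for n
      using se ind Eind by (simp add: h_def algebra_simps del: of_nat_Suc)
    then show ?thesis
      by (simp only:) (intro tendsto_mult tendsto_const exp_difference_quotient_tendsto)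
  qed
  ultimately show ?thesis unfolding q_def by (rule LIMSEQ_unique)
qed

lemma second_moment:
  assumes "j \<in> {0, 1}"
  shows "\<exists>C. \<forall>S. 0 < S \<longrightarrow> S < 1 - t \<longrightarrow> (\<integral>\<^sup>+\<omega>. ennreal ((indicator {j} (\<theta> \<omega>) * stopped_at S \<omega>)\<^sup>2) \<partial>M) \<le> ennreal C"
proof -
  have "(indicator {j} (\<theta> \<omega>) * stopped_at S \<omega>)\<^sup>2 = indicator {j} (\<theta> \<omega>) * (stopped_at S \<omega>)\<^sup>2" for S \<omega>
    by (simp add: indicator_def)
  then show ?thesis using assms second_moment_0 second_moment_1 by auto
qed

lemma stopped_at_integrable:
  assumes "j \<in> {0, 1}" "0 < S" "S < 1 - t"
  shows "integrable M (\<lambda>\<omega>. indicator {j} (\<theta> \<omega>) * stopped_at S \<omega>)"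
proof -
  note [measurable] = stopped_at_measurable[OF assms(2,3)]
  obtain C where "(\<integral>\<^sup>+\<omega>. ennreal ((indicator {j} (\<theta> \<omega>) * stopped_at S \<omega>)\<^sup>2) \<partial>M) \<le> ennreal C"
    using second_moment[OF assms(1)] assms(2,3) by blast
  \<comment> \<open>The integrability part of the limit lemma, used for a constant sequence.\<close>
  then show ?thesis
    using L2_bounded_limit(1)[of "\<lambda>_ \<omega>. indicator {j} (\<theta> \<omega>) * stopped_at S \<omega>" "\<lambda>\<omega>. indicator {j} (\<theta> \<omega>) * stopped_at S \<omega>" C]
    by simp
qed

lemma mean_1_le:
  assumes S: "0 < S" "S < 1 - t"
  shows "(\<integral>\<omega>. indicator {1} (\<theta> \<omega>) * stopped_at S \<omega> \<partial>M) \<le> \<P>(\<omega> in M. \<theta> \<omega> = 1) * V10 t x"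
proof -
  define v where "v = coef 1 0"
  have v: "v = 1 / (1 - t)" "0 < v" using t_less_1 by (simp_all add: v_def coef_1)
  obtain b where b: "0 \<le> b" "V10 t x = (v + b) / v * (1 - alpha\<^sup>2) * exp_mixture (v + b) (v * x)"
    using V10_eq_shifted_exp_mixture[OF t_less_1, of x] unfolding v(1) by blast
  define Y where "Y \<omega> = indicator {1} (\<theta> \<omega>) *
    exp_mixture (coef 1 (min (\<tau> \<omega>) S) + b) (coef 1 (min (\<tau> \<omega>) S) * stopped_at S \<omega>)" for \<omega>
  note Y = exp_mixture_expectation[OF S b(1), folded Y_def v_def]
  have "(\<integral>\<omega>. indicator {1} (\<theta> \<omega>) * stopped_at S \<omega> \<partial>M) \<le> (\<integral>\<omega>. (v + b) / v * (1 - alpha\<^sup>2) * Y \<omega> \<partial>M)"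
  proof (intro integral_mono stopped_at_integrable S integrable_mult_right Y)
    fix \<omega> assume \<omega>: "\<omega> \<in> space M"
    define s where "s = min (\<tau> \<omega>) S"
    have s: "0 \<le> s" "s < 1 - t" using min_tau[OF \<omega> S] by (simp_all add: s_def)
    have "v \<le> coef 1 s" unfolding v_def using s by (intro coef_mono) auto
    then have "coef 1 s * stopped_at S \<omega> / coef 1 s \<le> (v + b) / v * (1 - alpha\<^sup>2) * exp_mixture (coef 1 s + b) (coef 1 s * stopped_at S \<omega>)"
      using b(1) v(2) by (intro gain_le_exp_mixture) auto
    moreover have "coef 1 s \<noteq> 0" using coef_pos[of 1 s] s by simp
    ultimately show "indicator {1} (\<theta> \<omega>) * stopped_at S \<omega> \<le> (v + b) / v * (1 - alpha\<^sup>2) * Y \<omega>"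
      by (simp add: Y_def s_def[symmetric] indicator_def)
  qed auto
  also have "\<dots> = \<P>(\<omega> in M. \<theta> \<omega> = 1) * V10 t x"
    using Y by (simp add: b(2))
  finally show ?thesis .
qed

text \<open>The offset 2 keeps the first horizon strictly positive.\<close>

definition horizon :: "nat \<Rightarrow> real" where
  "horizon n = (1 - t) * (1 - 1 / real (n + 2))"

lemma horizon: "0 < horizon n" "horizon n < 1 - t" "horizon \<longlonglongrightarrow> 1 - t"
proof -
  have a: "0 < 1 / real (n + 2)" "1 / real (n + 2) < 1" by auto
  then show "0 < horizon n"
    unfolding horizon_def using t_less_1 by (intro mult_pos_pos) linarith+
  show "horizon n < 1 - t"
    unfolding horizon_def using mult_strict_left_mono[of "1 - 1 / real (n + 2)" 1 "1 - t"] a t_less_1 by simp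
  have "(\<lambda>n. 1 / real (n + 2)) \<longlonglongrightarrow> 0"
    using LIMSEQ_ignore_initial_segment[OF lim_const_over_n[of 1], of 2] by simp
  then have "(\<lambda>n. (1 - t) * (1 - 1 / real (n + 2))) \<longlonglongrightarrow> (1 - t) * (1 - 0)"
    by (intro tendsto_intros)
  then show "horizon \<longlonglongrightarrow> 1 - t" by (simp add: horizon_def[abs_def])
qed

lemma stopped_limit_before:
  assumes "\<tau> \<omega> < 1 - t"
  shows "(\<lambda>n. stopped_at (horizon n) \<omega>) \<longlonglongrightarrow> stopped t X \<tau> \<omega>"
proof (rule tendsto_eventually)
  have "\<forall>\<^sub>F n in sequentially. \<tau> \<omega> < horizon n"
    using horizon(3) assms by (rule order_tendstoD(1))
  then show "\<forall>\<^sub>F n in sequentially. stopped_at (horizon n) \<omega> = stopped t X \<tau> \<omega>"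
    by eventually_elim (simp add: stopped_at_def stopped_def)
qed

text \<open>Paths stopped before the end are eventually constant in n; only those stopped at 1 - t
  use that X 1 is the left limit, which holds almost surely.\<close>

lemma stopped_limit:
  assumes bounded: "\<And>\<omega>. \<omega> \<in> space M \<Longrightarrow> \<tau> \<omega> \<le> 1 - t"
  shows "AE \<omega> in M. (\<lambda>n. stopped_at (horizon n) \<omega>) \<longlonglongrightarrow> stopped t X \<tau> \<omega>"
  using X_1 AE_space
proof eventually_elim
  fix \<omega> assume lim: "((\<lambda>u. X u \<omega>) \<longlongrightarrow> X 1 \<omega>) (at_left 1)" and \<omega>: "\<omega> \<in> space M"
  show "(\<lambda>n. stopped_at (horizon n) \<omega>) \<longlonglongrightarrow> stopped t X \<tau> \<omega>"
  proof (cases "\<tau> \<omega> < 1 - t")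
    case False
    then have \<tau>: "\<tau> \<omega> = 1 - t" using bounded[OF \<omega>] by simp
    have "(\<lambda>n. t + horizon n) \<longlonglongrightarrow> t + (1 - t)"
      by (intro tendsto_intros horizon(3))
    then have "filterlim (\<lambda>n. t + horizon n) (at_left 1) sequentially"
      using horizon(2) by (intro tendsto_imp_filterlim_at_left) (auto simp: less_diff_eq add.commute)
    then have "(\<lambda>n. X (t + horizon n) \<omega>) \<longlonglongrightarrow> X 1 \<omega>"
      by (rule filterlim_compose[OF lim])
    moreover have "min (1 - t) (horizon n) = horizon n" for n
      using horizon(2)[of n] by simp
    ultimately show ?thesis by (simp add: \<tau> stopped_at_def stopped_def)
  qed (rule stopped_limit_before)
qed

text \<open>At the terminal time the limit of the truncated values agrees with X 1 only almost
  surely, so X 1 is inserted directly there and genuine measurability results.\<close>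

lemma stopped_measurable:
  assumes bounded: "\<And>\<omega>. \<omega> \<in> space M \<Longrightarrow> \<tau> \<omega> \<le> 1 - t"
  shows "stopped t X \<tau> \<in> borel_measurable M"
proof -
  have [measurable]: "X 1 \<in> borel_measurable M"
    using random_variable_X[of 1] t_less_1 by simp
  have [measurable]: "(\<lambda>\<omega>. lim (\<lambda>n. stopped_at (horizon n) \<omega>)) \<in> borel_measurable M"
    by (intro borel_measurable_lim_metric stopped_at_measurable horizon)
  have "(\<lambda>\<omega>. if \<tau> \<omega> < 1 - t then lim (\<lambda>n. stopped_at (horizon n) \<omega>) else X 1 \<omega>) \<in> borel_measurable M"
    by measurable
  also have "?this \<longleftrightarrow> stopped t X \<tau> \<in> borel_measurable M"
  proof (rule measurable_cong)
    fix \<omega> assume \<omega>: "\<omega> \<in> space M"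
    show "(if \<tau> \<omega> < 1 - t then lim (\<lambda>n. stopped_at (horizon n) \<omega>) else X 1 \<omega>) = stopped t X \<tau> \<omega>"
      using bounded[OF \<omega>] limI[OF stopped_limit_before[of \<omega>]] by (auto simp: stopped_def)
  qed
  finally show ?thesis .
qed

text \<open>The L2 bounds are applied separately for each value of \<open>\<theta>\<close>. For
  \<open>\<theta> = 0\<close> the truncated means are constant, so that part of the limit is
  explicit and is moved to the other side.\<close>

lemma stopped_mean:
  assumes bounded: "\<And>\<omega>. \<omega> \<in> space M \<Longrightarrow> \<tau> \<omega> \<le> 1 - t"
  shows "integrable M (stopped t X \<tau>)"
    and "(\<lambda>n. \<integral>\<omega>. indicator {1} (\<theta> \<omega>) * stopped_at (horizon n) \<omega> \<partial>M)
      \<longlonglongrightarrow> (\<integral>\<omega>. stopped t X \<tau> \<omega> \<partial>M) - \<P>(\<omega> in M. \<theta> \<omega> = 0) * x"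
proof -
  have lim: "AE \<omega> in M. (\<lambda>n. stopped_at (horizon n) \<omega>) \<longlonglongrightarrow> stopped t X \<tau> \<omega>"
    by (rule stopped_limit) (rule bounded)
  have [measurable]: "stopped t X \<tau> \<in> borel_measurable M"
    by (rule stopped_measurable) (rule bounded)
  note [measurable] = stopped_at_measurable[OF horizon(1,2)]
  have *: "integrable M (\<lambda>\<omega>. indicator {j} (\<theta> \<omega>) * stopped t X \<tau> \<omega>) \<and>
    (\<lambda>n. \<integral>\<omega>. indicator {j} (\<theta> \<omega>) * stopped_at (horizon n) \<omega> \<partial>M) \<longlonglongrightarrow>
     (\<integral>\<omega>. indicator {j} (\<theta> \<omega>) * stopped t X \<tau> \<omega> \<partial>M)" if j: "j \<in> {0, 1}" for j
  proof -
    obtain C where C: "\<And>n. (\<integral>\<^sup>+\<omega>. ennreal ((indicator {j} (\<theta> \<omega>) * stopped_at (horizon n) \<omega>)\<^sup>2) \<partial>M) \<le> ennreal C"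
      using second_moment[OF j] horizon by blast
    have "AE \<omega> in M. (\<lambda>n. indicator {j} (\<theta> \<omega>) * stopped_at (horizon n) \<omega>) \<longlonglongrightarrow> indicator {j} (\<theta> \<omega>) * stopped t X \<tau> \<omega>"
      using lim by eventually_elim (intro tendsto_intros)
    then show ?thesis
      by (intro conjI L2_bounded_limit[OF _ _ _ C]) auto
  qed
  have eq: "stopped t X \<tau> \<omega> = indicator {0} (\<theta> \<omega>) * stopped t X \<tau> \<omega> + indicator {1} (\<theta> \<omega>) * stopped t X \<tau> \<omega>"
    if "\<omega> \<in> space M" for \<omega>
    using theta_values[OF that] by auto
  have "integrable M (\<lambda>\<omega>. indicator {0} (\<theta> \<omega>) * stopped t X \<tau> \<omega> + indicator {1} (\<theta> \<omega>) * stopped t X \<tau> \<omega>)"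
    using *[of 0] *[of 1] by simp
  also have "?this \<longleftrightarrow> integrable M (stopped t X \<tau>)"
    by (rule Bochner_Integration.integrable_cong[OF refl]) (rule eq[symmetric])
  finally show "integrable M (stopped t X \<tau>)" .
  have "(\<integral>\<omega>. stopped t X \<tau> \<omega> \<partial>M) = (\<integral>\<omega>. indicator {0} (\<theta> \<omega>) * stopped t X \<tau> \<omega> + indicator {1} (\<theta> \<omega>) * stopped t X \<tau> \<omega> \<partial>M)"
    by (rule Bochner_Integration.integral_cong[OF refl eq])
  also have "\<dots> = (\<integral>\<omega>. indicator {0} (\<theta> \<omega>) * stopped t X \<tau> \<omega> \<partial>M) + (\<integral>\<omega>. indicator {1} (\<theta> \<omega>) * stopped t X \<tau> \<omega> \<partial>M)"
    using *[of 0] *[of 1] by simp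
  also have "(\<integral>\<omega>. indicator {0} (\<theta> \<omega>) * stopped t X \<tau> \<omega> \<partial>M) = \<P>(\<omega> in M. \<theta> \<omega> = 0) * x"
    using *[of 0] mean_0[OF horizon(1,2)] by (simp add: LIMSEQ_const_iff)
  finally show "(\<lambda>n. \<integral>\<omega>. indicator {1} (\<theta> \<omega>) * stopped_at (horizon n) \<omega> \<partial>M)
      \<longlonglongrightarrow> (\<integral>\<omega>. stopped t X \<tau> \<omega> \<partial>M) - \<P>(\<omega> in M. \<theta> \<omega> = 0) * x"
    using *[of 1] by simp
qed

lemma stopped_mean_le:
  assumes bounded: "\<And>\<omega>. \<omega> \<in> space M \<Longrightarrow> \<tau> \<omega> \<le> 1 - t"
  shows "(\<integral>\<omega>. stopped t X \<tau> \<omega> \<partial>M) \<le> \<P>(\<omega> in M. \<theta> \<omega> = 0) * x + \<P>(\<omega> in M. \<theta> \<omega> = 1) * V10 t x"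
proof -
  have "(\<integral>\<omega>. stopped t X \<tau> \<omega> \<partial>M) - \<P>(\<omega> in M. \<theta> \<omega> = 0) * x \<le> \<P>(\<omega> in M. \<theta> \<omega> = 1) * V10 t x"
    using stopped_mean(2) bounded mean_1_le[OF horizon(1,2)] by (intro LIMSEQ_le_const2) auto
  then show ?thesis by simp
qed

end

section \<open>Optimality of the hitting time\<close>

text \<open>With v = 1 / T the martingale is increasing in w, and at w = alpha * sqrt T the root
  equation makes it equal to w.\<close>

lemma exp_mixture_le_boundary:
  assumes T: "0 < T" and w: "w \<le> alpha * sqrt T"
  shows "(1 - alpha\<^sup>2) * exp_mixture (1 / T) (1 / T * w) \<le> alpha * sqrt T"
proof -
  have "exp_mixture (1 / T) (1 / T * w) = gauss_ratio (w / sqrt T) * sqrt T"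
  proof -
    have "w * sqrt T / T = w / sqrt T" using T by (simp add: frac_eq_eq)
    then show ?thesis by (simp add: exp_mixture_def real_sqrt_divide)
  qed
  moreover have "gauss_ratio (w / sqrt T) \<le> gauss_ratio alpha"
    using T w by (intro mono_gauss_ratio) (simp add: pos_divide_le_eq)
  then have "(1 - alpha\<^sup>2) * (gauss_ratio (w / sqrt T) * sqrt T) \<le> (1 - alpha\<^sup>2) * (gauss_ratio alpha * sqrt T)"
    using alpha_sq_less_1 T by (intro mult_left_mono mult_right_mono) auto
  moreover have "(1 - alpha\<^sup>2) * (gauss_ratio alpha * sqrt T) = alpha * sqrt T"
    unfolding mult.assoc[symmetric] alpha_root(2) ..
  ultimately show ?thesis by simp
qed

context embedded_problem_from
begin

text \<open>Quantitative pinning. With l = \<delta> or - \<delta> and \<delta> = sqrt (1 - t - S),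
  the linear part of the exponent is the rescaled position z = X / \<delta> up to sign and the
  quadratic part stays below 1, so |z| \<le> 1 + z^2 has a mean bounded uniformly in S.\<close>

lemma abs_mean_near_horizon:
  assumes S: "0 < S" "S < 1 - t"
  shows "integrable M (\<lambda>\<omega>. indicator {1} (\<theta> \<omega>) * \<bar>X (t + S) \<omega>\<bar>)"
    and "(\<integral>\<omega>. indicator {1} (\<theta> \<omega>) * \<bar>X (t + S) \<omega>\<bar> \<partial>M)
      \<le> sqrt (1 - t - S) * (1 + 4 * exp 1 * exp (\<bar>x\<bar> / (1 - t)))"
proof -
  \<comment> \<open>The constant time 1 - t truncated at S is S, so the exponential identities are
    evaluated at the fixed time t + S.\<close>
  interpret const: stopped_problem M B \<theta> X t x p "\<lambda>_. 1 - t"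
    by unfold_locales (use t_less_1 in \<open>auto intro: stopping_time_const\<close>)
  define \<delta> where "\<delta> = sqrt (1 - t - S)"
  have \<delta>: "0 < \<delta>" "\<delta> \<le> 1" "\<delta>\<^sup>2 = 1 - t - S"
    using S t_nonneg by (simp_all add: \<delta>_def)
  have X: "const.stopped_at S \<omega> = X (t + S) \<omega>" for \<omega>
    using S by (simp add: const.stopped_at_def)
  have [measurable]: "X (t + S) \<in> borel_measurable M"
    using S by (intro X_measurable) auto
  define Y where "Y \<omega> = \<delta> * (1 + 2 * exp 1 * (stopped_exp 1 \<delta> S (\<lambda>_. 1 - t) \<omega> + stopped_exp 1 (- \<delta>) S (\<lambda>_. 1 - t) \<omega>))" for \<omega>
  have bound: "indicator {1} (\<theta> \<omega>) * \<bar>X (t + S) \<omega>\<bar> \<le> Y \<omega>" for \<omega>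
  proof (cases "\<theta> \<omega> = 1")
    case True
    define w where "w = X (t + S) \<omega>"
    define z where "z = w / \<delta>"
    have c: "\<delta> * coef 1 S = 1 / \<delta>"
      unfolding coef_1 \<delta>(3)[symmetric] using \<delta>(1) by (simp add: power2_eq_square)
    have "\<delta>\<^sup>2 * (coef 1 S - coef 1 0) / 2 \<le> 1"
    proof -
      have "\<delta>\<^sup>2 * coef 1 S = 1"
        using \<delta>(1) c by (simp add: power2_eq_square mult.assoc)
      moreover have "0 \<le> \<delta>\<^sup>2 * coef 1 0" using coef_pos[of 1 0] t_less_1 by simp
      ultimately show ?thesis by (simp add: right_diff_distrib)
    qed
    then have "z - 1 \<le> exponent 1 \<delta> S w" "- z - 1 \<le> exponent 1 (- \<delta>) S w"
      using S c by (simp_all add: exponent_1 z_def mult.assoc[symmetric])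
    then have e: "exp z \<le> exp 1 * exp (exponent 1 \<delta> S w)" "exp (- z) \<le> exp 1 * exp (exponent 1 (- \<delta>) S w)"
      unfolding mult_exp_exp by simp_all
    have "\<bar>z\<bar> \<le> 1 + z\<^sup>2"
      using zero_le_power2[of "\<bar>z\<bar> - 1"] abs_ge_zero[of z] by (simp add: power2_eq_square algebra_simps abs_mult_self_eq)
    also have "\<dots> \<le> 1 + 2 * (exp z + exp (- z))"
      using sq_le_exp_add_exp[of z] by simp
    also have "\<dots> \<le> 1 + 2 * (exp 1 * exp (exponent 1 \<delta> S w) + exp 1 * exp (exponent 1 (- \<delta>) S w))"
      using e by (intro add_mono mult_left_mono) auto
    finally have "\<delta> * \<bar>z\<bar> \<le> \<delta> * (1 + 2 * (exp 1 * exp (exponent 1 \<delta> S w) + exp 1 * exp (exponent 1 (- \<delta>) S w)))"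
      using \<delta>(1) by (intro mult_left_mono) auto
    moreover have "\<delta> * \<bar>z\<bar> = \<bar>w\<bar>" using \<delta>(1) by (simp add: z_def)
    moreover have "Y \<omega> = \<delta> * (1 + 2 * (exp 1 * exp (exponent 1 \<delta> S w) + exp 1 * exp (exponent 1 (- \<delta>) S w)))"
      using S True by (simp add: Y_def const.stopped_exp_eq X w_def distrib_left mult.assoc)
    ultimately show ?thesis using True by (simp add: w_def)
  qed (use \<delta>(1) in \<open>simp add: Y_def const.stopped_exp_eq\<close>)
  define q where "q = \<P>(\<omega> in M. \<theta> \<omega> = 1)"
  have q: "0 \<le> q" "q \<le> 1" by (simp_all add: q_def)
  have se: "integrable M (stopped_exp 1 l S (\<lambda>_. 1 - t))"
    "(\<integral>\<omega>. stopped_exp 1 l S (\<lambda>_. 1 - t) \<omega> \<partial>M) = q * exp (l * coef 1 0 * x)" for l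
    using const.stopped_exp[of 1 S l] S by (simp_all add: q_def)
  have Y: "integrable M Y" unfolding Y_def using se(1) by simp
  show int: "integrable M (\<lambda>\<omega>. indicator {1} (\<theta> \<omega>) * \<bar>X (t + S) \<omega>\<bar>)"
  proof (rule Bochner_Integration.integrable_bound[OF Y])
    show "AE \<omega> in M. norm (indicator {1} (\<theta> \<omega>) * \<bar>X (t + S) \<omega>\<bar>) \<le> norm (Y \<omega>)"
      using bound by (intro AE_I2) (simp add: abs_mult, meson abs_ge_self order_trans)
  qed (use const.indicator_theta_measurable in measurable)
  have "(\<integral>\<omega>. indicator {1} (\<theta> \<omega>) * \<bar>X (t + S) \<omega>\<bar> \<partial>M) \<le> (\<integral>\<omega>. Y \<omega> \<partial>M)"
    by (intro integral_mono int Y bound)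
  also have "\<dots> = \<delta> * (1 + 2 * exp 1 * (q * exp (\<delta> * coef 1 0 * x) + q * exp (- \<delta> * coef 1 0 * x)))"
    unfolding Y_def using se by (simp add: prob_space)
  also have "\<dots> \<le> \<delta> * (1 + 2 * exp 1 * (1 * exp (\<bar>x\<bar> / (1 - t)) + 1 * exp (\<bar>x\<bar> / (1 - t))))"
  proof -
    have "\<bar>\<delta> * coef 1 0 * x\<bar> \<le> \<bar>x\<bar> / (1 - t)"
      using \<delta> t_less_1 by (simp add: coef_1 abs_mult divide_right_mono mult_left_le_one_le)
    then have "\<delta> * coef 1 0 * x \<le> \<bar>x\<bar> / (1 - t)" "- \<delta> * coef 1 0 * x \<le> \<bar>x\<bar> / (1 - t)" by linarith+
    then show ?thesis
      using q \<delta>(1) by (intro mult_left_mono add_mono mult_mono) auto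
  qed
  finally show "(\<integral>\<omega>. indicator {1} (\<theta> \<omega>) * \<bar>X (t + S) \<omega>\<bar> \<partial>M)
      \<le> sqrt (1 - t - S) * (1 + 4 * exp 1 * exp (\<bar>x\<bar> / (1 - t)))"
    by (simp add: \<delta>_def mult.assoc)
qed

lemma theta_prob_sum: "\<P>(\<omega> in M. \<theta> \<omega> = 0) + \<P>(\<omega> in M. \<theta> \<omega> = 1) = 1"
  unfolding theta_0 theta_1 by simp

text \<open>A start at or beyond the boundary stops at once. Otherwise, at the truncated time, gain
  and martingale agree on paths that have hit; on the others the martingale is at most alpha * sqrt
  (1 - t - S) and the gain at least - |X (t + S)|. Both losses vanish in the limit.\<close>

lemma tau_star_mean_ge:
  "\<P>(\<omega> in M. \<theta> \<omega> = 0) * x + \<P>(\<omega> in M. \<theta> \<omega> = 1) * V10 t x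
    \<le> (\<integral>\<omega>. stopped t X (\<lambda>\<omega>. tau_star t (\<lambda>u. X u \<omega>)) \<omega> \<partial>M)"
proof -
  interpret star: stopped_problem M B \<theta> X t x p "\<lambda>\<omega>. tau_star t (\<lambda>u. X u \<omega>)"
    by unfold_locales (use tau_star_stopping_time tau_star_range[OF t_less_1] in auto)
  have bounded: "tau_star t (\<lambda>u. X u \<omega>) \<le> 1 - t" for \<omega>
    using tau_star_range[OF t_less_1] by blast
  have start: "AE \<omega> in M. X t \<omega> = x"
    using euler_sum_converges by eventually_elim simp
  show ?thesis
  proof (cases "x < alpha * sqrt (1 - t)")
    case False
    have "AE \<omega> in M. stopped t X (\<lambda>\<omega>. tau_star t (\<lambda>u. X u \<omega>)) \<omega> = x"
      using start
    proof eventually_elim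
      fix \<omega> assume X: "X t \<omega> = x"
      have "tau_star t (\<lambda>u. X u \<omega>) \<le> 0"
        using X False t_less_1 by (intro tau_star_le) auto
      then have "tau_star t (\<lambda>u. X u \<omega>) = 0"
        using tau_star_range[OF t_less_1, of "\<lambda>u. X u \<omega>"] by linarith
      then show "stopped t X (\<lambda>\<omega>. tau_star t (\<lambda>u. X u \<omega>)) \<omega> = x"
        using X by (simp add: stopped_def)
    qed
    then have "(\<integral>\<omega>. stopped t X (\<lambda>\<omega>. tau_star t (\<lambda>u. X u \<omega>)) \<omega> \<partial>M) = (\<integral>\<omega>. x \<partial>M)"
      using star.stopped_measurable[OF bounded] by (intro integral_cong_AE) auto
    moreover have "V10 t x = x" using False by (simp add: V10_def)
    ultimately show ?thesis
      using theta_prob_sum by (simp add: prob_space distrib_right[symmetric])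
  next
    case True
    define q where "q = \<P>(\<omega> in M. \<theta> \<omega> = 1)"
    define v where "v = coef 1 0"
    \<comment> \<open>The summand \<open>alpha\<close> pays for the martingale left at the horizon,
      the other for the mean of |X (t + S)|; both multiply sqrt (1 - t - S).\<close>
    define C where "C = alpha + (1 + 4 * exp 1 * exp (\<bar>x\<bar> / (1 - t)))"
    have V: "V10 t x = (1 - alpha\<^sup>2) * exp_mixture v (v * x)"
    proof -
      obtain b where "x \<ge> alpha * sqrt (1 - t) \<or> b = 0"
        "V10 t x = (v + b) / v * (1 - alpha\<^sup>2) * exp_mixture (v + b) (v * x)"
        using V10_eq_shifted_exp_mixture[OF t_less_1, of x] by (auto simp: v_def coef_1)
      moreover have "v \<noteq> 0" using coef_pos[of 1 0] t_less_1 by (simp add: v_def)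
      ultimately show ?thesis using True by simp
    qed
    have lower: "q * V10 t x - C * sqrt (1 - t - S) \<le> (\<integral>\<omega>. indicator {1} (\<theta> \<omega>) * star.stopped_at S \<omega> \<partial>M)"
      if S: "0 < S" "S < 1 - t" for S
    proof -
      define Y where "Y \<omega> = indicator {1} (\<theta> \<omega>) * exp_mixture (coef 1 (min (tau_star t (\<lambda>u. X u \<omega>)) S) + 0)
          (coef 1 (min (tau_star t (\<lambda>u. X u \<omega>)) S) * star.stopped_at S \<omega>)" for \<omega>
      note Y = star.exp_mixture_expectation[OF S order_refl, folded Y_def]
      define R where "R \<omega> = indicator {1} (\<theta> \<omega>) * \<bar>X (t + S) \<omega>\<bar>" for \<omega>
      note R = abs_mean_near_horizon[OF S, folded R_def]
      have "AE \<omega> in M. (1 - alpha\<^sup>2) * Y \<omega> - R \<omega> - alpha * sqrt (1 - t - S) \<le> indicator {1} (\<theta> \<omega>) * star.stopped_at S \<omega>"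
        using start AE_space
      proof eventually_elim
        fix \<omega> assume X: "X t \<omega> = x" and \<omega>: "\<omega> \<in> space M"
        define \<tau> s w where "\<tau> = tau_star t (\<lambda>u. X u \<omega>)" and "s = min \<tau> S" and "w = star.stopped_at S \<omega>"
        have w: "w = X (t + s) \<omega>" by (simp add: w_def s_def \<tau>_def star.stopped_at_def)
        have s: "0 \<le> s" "s < 1 - t" using star.min_tau[OF \<omega> S] by (simp_all add: s_def \<tau>_def)
        have a0: "0 \<le> alpha * sqrt (1 - t - S)" using alpha_root(1) S by simp
        show "(1 - alpha\<^sup>2) * Y \<omega> - R \<omega> - alpha * sqrt (1 - t - S) \<le> indicator {1} (\<theta> \<omega>) * star.stopped_at S \<omega>"
        proof (cases "\<theta> \<omega> = 1")
          case th: True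
          have at: "w = alpha * sqrt (1 - t - s)" if "\<tau> \<le> S"
            using at_tau_star[OF t_less_1 continuous_paths_X[OF \<omega>]] that S X True
            by (simp add: w s_def \<tau>_def)
          have before: "w < alpha * sqrt (1 - t - s)" if "S < \<tau>"
            using before_tau_star[OF t_less_1, of S "\<lambda>u. X u \<omega>"] that S by (simp add: w s_def \<tau>_def)
          have Yw: "(1 - alpha\<^sup>2) * Y \<omega> = (1 - alpha\<^sup>2) * exp_mixture (1 / (1 - t - s)) (1 / (1 - t - s) * w)"
            using th by (simp add: Y_def s_def \<tau>_def w_def coef_1)
          have "w \<le> alpha * sqrt (1 - t - s)" using at before by (cases "\<tau> \<le> S") auto
          then have le: "(1 - alpha\<^sup>2) * Y \<omega> \<le> alpha * sqrt (1 - t - s)"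
            unfolding Yw using s by (intro exp_mixture_le_boundary) auto
          have "(1 - alpha\<^sup>2) * Y \<omega> - R \<omega> - alpha * sqrt (1 - t - S) \<le> w"
          proof (cases "\<tau> \<le> S")
            case True
            moreover have "0 \<le> R \<omega>" by (simp add: R_def)
            ultimately show ?thesis using le a0 at by linarith
          next
            case False
            then have "s = S" by (simp add: s_def)
            moreover from this have "R \<omega> = \<bar>w\<bar>" using w th by (simp add: R_def)
            ultimately show ?thesis using le by (simp add: abs_if split: if_splits)
          qed
          then show ?thesis using th by (simp add: w_def)
        qed (use a0 in \<open>simp add: Y_def R_def\<close>)
      qed
      then have "(\<integral>\<omega>. (1 - alpha\<^sup>2) * Y \<omega> - R \<omega> - alpha * sqrt (1 - t - S) \<partial>M) \<le> (\<integral>\<omega>. indicator {1} (\<theta> \<omega>) * star.stopped_at S \<omega> \<partial>M)"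
        using Y(1) R(1) star.stopped_at_integrable[OF _ S, of 1] by (intro integral_mono_AE) auto
      also have "(\<integral>\<omega>. (1 - alpha\<^sup>2) * Y \<omega> - R \<omega> - alpha * sqrt (1 - t - S) \<partial>M) =
        (1 - alpha\<^sup>2) * (\<integral>\<omega>. Y \<omega> \<partial>M) - (\<integral>\<omega>. R \<omega> \<partial>M) - alpha * sqrt (1 - t - S)"
        using Y(1) R(1) by (simp add: prob_space)
      also have "(1 - alpha\<^sup>2) * (\<integral>\<omega>. Y \<omega> \<partial>M) = q * V10 t x"
        unfolding V Y(2) by (simp add: q_def v_def)
      finally show ?thesis using R(2) by (simp add: C_def algebra_simps)
    qed
    have "(\<lambda>n. q * V10 t x - C * sqrt (1 - t - star.horizon n)) \<longlonglongrightarrow> q * V10 t x - C * sqrt (1 - t - (1 - t))"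
      by (intro tendsto_intros star.horizon)
    moreover have "(\<lambda>n. \<integral>\<omega>. indicator {1} (\<theta> \<omega>) * star.stopped_at (star.horizon n) \<omega> \<partial>M)
      \<longlonglongrightarrow> (\<integral>\<omega>. stopped t X (\<lambda>\<omega>. tau_star t (\<lambda>u. X u \<omega>)) \<omega> \<partial>M) - \<P>(\<omega> in M. \<theta> \<omega> = 0) * x"
      by (rule star.stopped_mean(2)) (rule bounded)
    ultimately have "q * V10 t x - C * sqrt (1 - t - (1 - t)) \<le>
        (\<integral>\<omega>. stopped t X (\<lambda>\<omega>. tau_star t (\<lambda>u. X u \<omega>)) \<omega> \<partial>M) - \<P>(\<omega> in M. \<theta> \<omega> = 0) * x"
      by (rule LIMSEQ_le) (use lower[OF star.horizon(1,2)] in auto)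
    then show ?thesis by (simp add: q_def)
  qed
qed

lemma admissible_stopped:
  assumes "\<tau> \<in> admissible M t X"
  shows "integrable M (stopped t X \<tau>)"
    and "(\<integral>\<omega>. stopped t X \<tau> \<omega> \<partial>M) \<le> \<P>(\<omega> in M. \<theta> \<omega> = 0) * x + \<P>(\<omega> in M. \<theta> \<omega> = 1) * V10 t x"
proof -
  interpret stopped_problem M B \<theta> X t x p \<tau>
    by unfold_locales (use assms in \<open>auto simp: admissible_def\<close>)
  have bounded: "\<tau> \<omega> \<le> 1 - t" if "\<omega> \<in> space M" for \<omega>
    using assms that by (auto simp: admissible_def)
  show "integrable M (stopped t X \<tau>)"
    by (rule stopped_mean(1)) (rule bounded)
  show "(\<integral>\<omega>. stopped t X \<tau> \<omega> \<partial>M) \<le> \<P>(\<omega> in M. \<theta> \<omega> = 0) * x + \<P>(\<omega> in M. \<theta> \<omega> = 1) * V10 t x"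
    by (rule stopped_mean_le) (rule bounded)
qed

lemma value_function_and_optimality:
  "value_function M t X = ereal ((1 - posterior t x p) * x + posterior t x p * V10 t x)"
  "optimal_stopping_time M t X (\<lambda>\<omega>. tau_star t (\<lambda>u. X u \<omega>))"
proof -
  let ?\<tau> = "\<lambda>\<omega>. tau_star t (\<lambda>u. X u \<omega>)"
  let ?v = "(1 - posterior t x p) * x + posterior t x p * V10 t x"
  have star: "integral\<^sup>L M (stopped t X ?\<tau>) = ?v"
    using tau_star_mean_ge admissible_stopped(2)[OF tau_star_admissible]
    unfolding theta_0 theta_1 by (rule antisym[rotated])
  show *: "value_function M t X = ereal ?v"
    unfolding value_function_def
  proof (rule antisym)
    show "(SUP \<tau>\<in>admissible M t X. ereal (integral\<^sup>L M (stopped t X \<tau>))) \<le> ereal ?v"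
      using admissible_stopped(2) unfolding theta_0 theta_1 by (intro SUP_least) simp
    show "ereal ?v \<le> (SUP \<tau>\<in>admissible M t X. ereal (integral\<^sup>L M (stopped t X \<tau>)))"
      using SUP_upper[OF tau_star_admissible, of "\<lambda>\<tau>. ereal (integral\<^sup>L M (stopped t X \<tau>))"] star by simp
  qed
  show "optimal_stopping_time M t X ?\<tau>"
    unfolding optimal_stopping_time_def using tau_star_admissible star * by simp
qed

end

theorem theorem4p3:
  fixes M :: "'a measure" and B :: "real \<Rightarrow> 'a \<Rightarrow> real" and \<theta> :: "'a \<Rightarrow> real"
    and X :: "real \<Rightarrow> 'a \<Rightarrow> real" and t x p :: real
  assumes "0 \<le> t" and "t < 1" and "0 \<le> p" and "p \<le> 1"
    and "embedded_problem M B \<theta> X t x p"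
  shows "(\<forall>\<tau>\<in>admissible M t X. integrable M (stopped t X \<tau>)) \<and>
         value_function M t X = ereal ((1 - posterior t x p) * x + posterior t x p * V10 t x) \<and>
         optimal_stopping_time M t X (\<lambda>\<omega>. tau_star t (\<lambda>u. X u \<omega>))"
proof -
  interpret embedded_problem_from M B \<theta> X t x p
    by (intro embedded_problem_from.intro embedded_problem_from_axioms.intro assms)
  show ?thesis
    using admissible_stopped(1) value_function_and_optimality by blast
qed

end
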